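(* Let $d\ge 3$ and $q\ge 2$, let $L(s,F)$ be an $L$-function of degree $d$ satisfying the framework described in the context, and let $0\le\beta<1$. Assume: (A1) $|\lambda_F(n)|\le \tau_d(n)$ for all integers $n\ge 1$. (A2) For some fixed (but arbitrary) $\varepsilon>0$, $\sum_{X\le n\le X+Y}|\lambda_F(n)|^2\ll_F Y$ holds for all large $X\geq 2$ and all $X^{1-\varepsilon}\le Y\le X$. (A3) For any $2\le P_1\le P_2\le X$, $\displaystyle\sum_{n\le X,\ (n,\prod_{P_1\le p\le P_2}p)=1}|\lambda_F(n)|^2\ll_F X\frac{\log P_1}{\log P_2}$. (A4) for all primitive characters: there is a small constant $c_F>0$ depending only on $F$ such that, for every primitive Dirichlet character $\chi$ modulo $q$ and any $T$ with $\log^{100}q\ll T\ll q^{o(1)}$, $$L(\sigma+it,F\times\chi)\ne 0\quad\text{for } \sigma>1-\frac{c_F}{\log^{\beta}(qT)},\ |t|\le T.$$ Then, for every primitive Dirichlet character $\chi$ modulo $q$ and any $\eta<\frac{1-\beta}{2}$, $$L\big(\tfrac12,F\times\chi\big)\ll_F\frac{q^{d/4}}{\log^{\eta}q}.$$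
   Context: Framework. $L(s,F)=\sum_{n\ge1}\lambda_F(n)n^{-s}=\prod_p\prod_{j=1}^d(1-\alpha_{j,F}(p)p^{-s})^{-1}$ is a Dirichlet series with Euler product of degree $d$, both absolutely convergent for $\Re(s)>1$; $\lambda_F$ is multiplicative with $\lambda_F(p^r)=\sum_{r_1,\dots,r_d\ge0,\ r_1+\cdots+r_d=r}\prod_{j=1}^d\alpha_{j,F}(p)^{r_j}$. For $q\ge2$ and a primitive Dirichlet character $\chi$ modulo $q$, $$L(s,F\times\chi)=\sum_{n\ge1}\frac{\lambda_F(n)\chi(n)}{n^s}=\prod_p\prod_{j=1}^d\Big(1-\frac{\alpha_{j,F}(p)\chi(p)}{p^s}\Big)^{-1},$$ both absolutely convergent for $\Re(s)>1$. Put $L_\infty(s,F\times\chi)=N^{s/2}\prod_{j=1}^d\Gamma_{\mathbb R}(s+\mu_j)$ with $\Gamma_{\mathbb R}(s)=\pi^{-s/2}\Gamma(s/2)$, where the conductor $N$ (a positive integer) depends only on $F$ and $q$, and the $\mu_j\in\mathbb C$ depend only on $F$ and $\chi(-1)$ and satisfy $\Re(\mu_j)\ge-1+\theta_F$ for some fixed $\theta_F$ with $\frac1{2d}<\theta_F<\frac12$. Let $\Lambda(s,F\times\chi)=L(s,F\times\chi)L_\infty(s,F\times\chi)$. It is assumed that: (1) $\Lambda(s,F\times\chi)$ extends to an entire function of order 1; (2) $\Lambda(s,F\times\chi)=\kappa\,\Lambda(1-s,\tilde F\times\overline\chi)$ for some $\kappa=\kappa_{F,\chi}$ with $|\kappa|=1$,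 where $\tilde F$ is the dual form with $\lambda_{\tilde F}(n)=\overline{\lambda_F(n)}$ (its completed $L$-function is formed in the same way, with the same $N$ and with parameters $\overline{\mu_j}$); (3) with the analytic conductor $C(s,F\times\chi)=N\prod_{j=1}^d(|s+\mu_j+3|)$ and $C(F\times\chi)=C(\frac12,F\times\chi)$, one has $C(F\times\chi)\ll_F N\ll_F q^d$ for large $q$. Notation. $\tau_d$ is the $d$-fold divisor function, $p$ denotes a prime, $\log^a x=(\log x)^a$. The condition $\log^{100}q\ll T\ll q^{o(1)}$ refers to functions $T=T(q)$ with $T\gg\log^{100}q$ and $\log T\leq o(\log q)$ as $q\to\infty$. $F$ (and $d,\beta,\eta$) are fixed, all constants in the hypotheses are uniform in $q$ and $\chi$, and the implied constant in the conclusion depends on $F$ and the fixed parameters but not on $q$ or $\chi$. *)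

theory Defs
  imports "HOL-Complex_Analysis.Complex_Analysis" "HOL-Library.Landau_Symbols"
begin

section \<open>Dirichlet characters\<close>

definition dirichlet_character :: "nat \<Rightarrow> (int \<Rightarrow> complex) \<Rightarrow> bool" where
  "dirichlet_character q chi \<longleftrightarrow> q > 0 \<and>
     (\<forall>m n. chi (m * n) = chi m * chi n) \<and>
     (\<forall>n. chi (n + int q) = chi n) \<and>
     (\<forall>n. chi n \<noteq> 0 \<longleftrightarrow> coprime n (int q))"

definition primitive_character :: "nat \<Rightarrow> (int \<Rightarrow> complex) \<Rightarrow> bool" where
  "primitive_character q chi \<longleftrightarrow> dirichlet_character q chi \<and>
     \<not> (\<exists>m \<psi>. m dvd q \<and> m < q \<and> dirichlet_character m \<psi> \<and>
           (\<forall>n. coprime n (int q) \<longrightarrow> chi n = \<psi> n))"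


section \<open>Dirichlet series and Euler products\<close>

text \<open>Number of ordered \<open>d\<close>-tuples of natural numbers with product \<open>n\<close>; meaningful for \<open>n \<ge> 1\<close>.\<close>
definition divisor_tau :: "nat \<Rightarrow> nat \<Rightarrow> nat" where
  "divisor_tau d n = card {f \<in> {1..d} \<rightarrow>\<^sub>E UNIV. (\<Prod>j=1..d. f j) = n}"

definition multiplicative_fn :: "(nat \<Rightarrow> complex) \<Rightarrow> bool" where
  "multiplicative_fn a \<longleftrightarrow> a 1 = 1 \<and> (\<forall>m n. coprime m n \<longrightarrow> a (m * n) = a m * a n)"

definition dirichlet_term :: "(nat \<Rightarrow> complex) \<Rightarrow> complex \<Rightarrow> nat \<Rightarrow> complex" where
  "dirichlet_term a s n = a n / of_nat n powr s"

definition dirichlet_series :: "(nat \<Rightarrow> complex) \<Rightarrow> complex \<Rightarrow> complex" where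
  "dirichlet_series a s = (\<Sum>n. dirichlet_term a s (Suc n))"

text \<open>The product over primes is an infinite product over all \<open>n\<close> with factor 1 at non-primes.\<close>
definition euler_factor :: "nat \<Rightarrow> (nat \<Rightarrow> nat \<Rightarrow> complex) \<Rightarrow> complex \<Rightarrow> nat \<Rightarrow> complex" where
  "euler_factor d \<alpha> s p =
     (if prime p then \<Prod>j=1..d. inverse (1 - \<alpha> p j / of_nat p powr s) else 1)"

text \<open>The condition that no \<open>1 - \<alpha> p j / p powr s\<close> vanishes is needed because \<open>inverse 0 = 0\<close>.\<close>
definition has_euler_product ::
  "nat \<Rightarrow> (nat \<Rightarrow> complex) \<Rightarrow> (nat \<Rightarrow> nat \<Rightarrow> complex) \<Rightarrow> bool" where
  "has_euler_product d a \<alpha> \<longleftrightarrow>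
     (\<forall>s. Re s > 1 \<longrightarrow>
        summable (\<lambda>n. norm (dirichlet_term a s (Suc n))) \<and>
        (\<forall>p j. prime p \<and> j \<in> {1..d} \<longrightarrow> \<alpha> p j / of_nat p powr s \<noteq> 1) \<and>
        abs_convergent_prod (euler_factor d \<alpha> s) \<and>
        dirichlet_series a s = prodinf (euler_factor d \<alpha> s))"


section \<open>Entire functions\<close>

definition entire_order :: "(complex \<Rightarrow> complex) \<Rightarrow> ereal" where
  "entire_order f =
     Inf (ereal ` {\<rho>. \<rho> \<ge> 0 \<and> (\<lambda>z. norm (f z)) \<in> O[at_infinity](\<lambda>z. exp (norm z powr \<rho>))})"

text \<open>Continuation of a function given on the half-plane \<open>Re s > 1\<close>.\<close>
definition is_entire_continuation :: "(complex \<Rightarrow> complex) \<Rightarrow> (complex \<Rightarrow> complex) \<Rightarrow> bool" where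
  "is_entire_continuation f g \<longleftrightarrow>
     g holomorphic_on UNIV \<and> (\<forall>s. Re s > 1 \<longrightarrow> g s = f s)"

definition entire_continuation :: "(complex \<Rightarrow> complex) \<Rightarrow> complex \<Rightarrow> complex" where
  "entire_continuation f = (THE g. is_entire_continuation f g)"

lemma is_entire_continuation_unique:
  assumes g: "is_entire_continuation f g" and h: "is_entire_continuation f h"
  shows "g = h"
proof
  fix z
  let ?U = "{s::complex. Re s > 1}"
  have hol: "g holomorphic_on UNIV" "h holomorphic_on UNIV"
    using g h by (auto simp: is_entire_continuation_def)
  have agree: "g s = h s" if "s \<in> ?U" for s
    using g h that by (auto simp: is_entire_continuation_def)
  have "(\<lambda>s. g s - h s) z = 0"
  proof (rule analytic_continuation_open[where s = "?U" and s' = UNIV and f = "\<lambda>s. g s - h s" and g = "\<lambda>_. 0"])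
    show "open ?U" by (rule open_halfspace_Re_gt)
    show "?U \<noteq> {}" by (auto intro!: exI[of _ 2])
  qed (use agree hol in \<open>auto intro!: holomorphic_intros\<close>)
  thus "g z = h z" by simp
qed

lemma entire_continuation_eq:
  "is_entire_continuation f g \<Longrightarrow> entire_continuation f = g"
  unfolding entire_continuation_def
  by (rule the_equality) (auto intro: is_entire_continuation_unique)


section \<open>L-functions and their twists\<close>

text \<open>\<open>satake F p j\<close> is $\alpha_{j,F}(p)$ for \<open>1 \<le> j \<le> degree_of F\<close>.
  The conductor of \<open>F \<times> chi\<close> for \<open>chi\<close> modulo \<open>q\<close> is \<open>conductor F q\<close>, and the
  archimedean parameters are \<open>arch_param F (chi (-1)) j\<close>; this encodes that they depend on
  \<open>chi\<close> only through \<open>q\<close> and through \<open>chi (-1)\<close>, respectively.\<close>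
record L_datum =
  degree_of :: nat
  coeff_of :: "nat \<Rightarrow> complex"
  satake :: "nat \<Rightarrow> nat \<Rightarrow> complex"
  conductor :: "nat \<Rightarrow> nat"
  arch_param :: "complex \<Rightarrow> nat \<Rightarrow> complex"

definition dual :: "L_datum \<Rightarrow> L_datum" where
  "dual F = F\<lparr>coeff_of := \<lambda>n. cnj (coeff_of F n),
              satake := \<lambda>p j. cnj (satake F p j),
              arch_param := \<lambda>\<epsilon> j. cnj (arch_param F \<epsilon> j)\<rparr>"

definition twist_coeff :: "L_datum \<Rightarrow> (int \<Rightarrow> complex) \<Rightarrow> nat \<Rightarrow> complex" where
  "twist_coeff F chi n = coeff_of F n * chi (int n)"

definition twist_satake :: "L_datum \<Rightarrow> (int \<Rightarrow> complex) \<Rightarrow> nat \<Rightarrow> nat \<Rightarrow> complex" where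
  "twist_satake F chi p j = satake F p j * chi (int p)"

definition Gamma_R :: "complex \<Rightarrow> complex" where
  "Gamma_R s = of_real pi powr (- s / 2) * Gamma (s / 2)"

definition L_infty :: "L_datum \<Rightarrow> nat \<Rightarrow> (int \<Rightarrow> complex) \<Rightarrow> complex \<Rightarrow> complex" where
  "L_infty F q chi s =
     of_nat (conductor F q) powr (s / 2) *
     (\<Prod>j=1..degree_of F. Gamma_R (s + arch_param F (chi (-1)) j))"

text \<open>\<open>L_twist\<close> is continued separately rather than defined as \<open>Lambda_twist / L_infty\<close>,
  because \<open>L_infty\<close> may have poles (even at \<open>s = 1/2\<close>).\<close>
definition L_twist :: "L_datum \<Rightarrow> (int \<Rightarrow> complex) \<Rightarrow> complex \<Rightarrow> complex" where
  "L_twist F chi = entire_continuation (dirichlet_series (twist_coeff F chi))"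

definition completed_series :: "L_datum \<Rightarrow> nat \<Rightarrow> (int \<Rightarrow> complex) \<Rightarrow> complex \<Rightarrow> complex" where
  "completed_series F q chi s = dirichlet_series (twist_coeff F chi) s * L_infty F q chi s"

definition Lambda_twist :: "L_datum \<Rightarrow> nat \<Rightarrow> (int \<Rightarrow> complex) \<Rightarrow> complex \<Rightarrow> complex" where
  "Lambda_twist F q chi = entire_continuation (completed_series F q chi)"

definition analytic_conductor ::
  "L_datum \<Rightarrow> nat \<Rightarrow> (int \<Rightarrow> complex) \<Rightarrow> complex \<Rightarrow> real" where
  "analytic_conductor F q chi s =
     real (conductor F q) * (\<Prod>j=1..degree_of F. norm (s + arch_param F (chi (-1)) j + 3))"

definition L_framework :: "L_datum \<Rightarrow> bool" where
  "L_framework F \<longleftrightarrow>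
     multiplicative_fn (coeff_of F) \<and>
     (\<forall>p r. prime p \<longrightarrow>
        coeff_of F (p ^ r) =
          (\<Sum>e \<in> {e \<in> {1..degree_of F} \<rightarrow>\<^sub>E (UNIV :: nat set). (\<Sum>j=1..degree_of F. e j) = r}.
             \<Prod>j=1..degree_of F. satake F p j ^ e j)) \<and>
     has_euler_product (degree_of F) (coeff_of F) (satake F) \<and>
     (\<forall>q\<ge>2. \<forall>chi. primitive_character q chi \<longrightarrow>
        has_euler_product (degree_of F) (twist_coeff F chi) (twist_satake F chi)) \<and>
     (\<forall>q\<ge>2. conductor F q > 0) \<and>
     (\<exists>\<theta>. 1 / (2 * real (degree_of F)) < \<theta> \<and> \<theta> < 1 / 2 \<and>
        (\<forall>q\<ge>2. \<forall>chi. primitive_character q chi \<longrightarrow>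
           (\<forall>j\<in>{1..degree_of F}. Re (arch_param F (chi (-1)) j) \<ge> -1 + \<theta>))) \<and>
     (\<forall>q\<ge>2. \<forall>chi. primitive_character q chi \<longrightarrow>
        (\<exists>g. is_entire_continuation (completed_series F q chi) g) \<and>
        entire_order (Lambda_twist F q chi) = 1) \<and>
     (\<forall>q\<ge>2. \<forall>chi. primitive_character q chi \<longrightarrow>
        (\<exists>\<kappa>. norm \<kappa> = 1 \<and>
           (\<forall>s. Lambda_twist F q chi s = \<kappa> * Lambda_twist (dual F) q (\<lambda>n. cnj (chi n)) (1 - s)))) \<and>
     (\<exists>K. \<forall>\<^sub>F q in sequentially. \<forall>chi. primitive_character q chi \<longrightarrow>
        analytic_conductor F q chi (1 / 2) \<le> K * real (conductor F q)) \<and>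
     (\<exists>K. \<forall>\<^sub>F q in sequentially. \<forall>chi. primitive_character q chi \<longrightarrow>
        real (conductor F q) \<le> K * real q ^ degree_of F)"

lemma L_twist_is_continuation:
  assumes F: "L_framework F" and q: "q \<ge> 2" and chi: "primitive_character q chi"
  shows "is_entire_continuation (dirichlet_series (twist_coeff F chi)) (L_twist F chi)"
proof -
  define D where "D = dirichlet_series (twist_coeff F chi)"
  define \<mu> where "\<mu> = arch_param F (chi (-1))"
  define N where "N = conductor F q"
  have Lam: "\<exists>g. is_entire_continuation (completed_series F q chi) g"
    and arch: "\<exists>\<theta>. 1 / (2 * real (degree_of F)) < \<theta> \<and> \<theta> < 1 / 2 \<and>
        (\<forall>q\<ge>2. \<forall>chi. primitive_character q chi \<longrightarrow>
           (\<forall>j\<in>{1..degree_of F}. Re (arch_param F (chi (-1)) j) \<ge> -1 + \<theta>))"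
    and N: "N > 0"
    using F q chi unfolding L_framework_def N_def by simp_all
  from Lam obtain g where g: "is_entire_continuation (completed_series F q chi) g" ..
  from arch obtain \<theta> where \<theta>: "1 / (2 * real (degree_of F)) < \<theta>"
      "\<And>j. j \<in> {1..degree_of F} \<Longrightarrow> Re (\<mu> j) \<ge> -1 + \<theta>"
    using q chi unfolding \<mu>_def by blast
  have "1 / (2 * real (degree_of F)) \<ge> 0" by simp
  with \<theta>(1) have \<theta>0: "\<theta> > 0" by linarith
  define G where "G s = g s * (of_nat N powr (- s / 2) *
      (\<Prod>j=1..degree_of F. of_real pi powr ((s + \<mu> j) / 2) * rGamma ((s + \<mu> j) / 2)))" for s
  have "is_entire_continuation D G"
    unfolding is_entire_continuation_def
  proof (intro conjI allI impI)
    have "g holomorphic_on UNIV" using g by (auto simp: is_entire_continuation_def)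
    thus "G holomorphic_on UNIV"
      unfolding G_def using N by (intro holomorphic_intros) auto
  next
    fix s :: complex assume s: "Re s > 1"
    have gs: "g s = D s * L_infty F q chi s"
      using g s by (auto simp: is_entire_continuation_def completed_series_def D_def)
    have 1: "Gamma_R (s + \<mu> j) * (of_real pi powr ((s + \<mu> j) / 2) * rGamma ((s + \<mu> j) / 2)) = 1"
      if j: "j \<in> {1..degree_of F}" for j
    proof -
      have "Re ((s + \<mu> j) / 2) > 0" using \<theta>(2)[OF j] \<theta>0 s by simp
      hence "(s + \<mu> j) / 2 \<notin> \<int>\<^sub>\<le>\<^sub>0"
        by (metis not_less Re_complex_of_real nonpos_Ints_cases of_int_le_0_iff of_real_of_int_eq)
      hence "Gamma ((s + \<mu> j) / 2) * rGamma ((s + \<mu> j) / 2) = 1"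
        by (simp add: Gamma_def rGamma_eq_zero_iff)
      moreover have "of_real pi powr (- (s + \<mu> j) / 2) * of_real pi powr ((s + \<mu> j) / 2) = (1::complex)"
        by (simp add: add_divide_distrib diff_divide_distrib flip: powr_add)
      ultimately show ?thesis
        by (simp add: Gamma_R_def mult.assoc mult.left_commute [of "Gamma _"])
    qed
    have 2: "(of_nat N :: complex) powr (s / 2) * of_nat N powr (- s / 2) = 1"
      using N by (simp flip: powr_add)
    have 3: "(\<Prod>j=1..degree_of F. Gamma_R (s + \<mu> j)) *
      (\<Prod>j=1..degree_of F. of_real pi powr ((s + \<mu> j) / 2) * rGamma ((s + \<mu> j) / 2)) = 1"
      unfolding prod.distrib [symmetric] using 1 by (intro prod.neutral) auto
    have "G s = D s * ((of_nat N :: complex) powr (s / 2) * of_nat N powr (- s / 2)) *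
      ((\<Prod>j=1..degree_of F. Gamma_R (s + \<mu> j)) *
      (\<Prod>j=1..degree_of F. of_real pi powr ((s + \<mu> j) / 2) * rGamma ((s + \<mu> j) / 2)))"
      unfolding G_def gs L_infty_def N_def \<mu>_def by (simp only: mult_ac)
    thus "G s = D s" unfolding 2 3 by simp
  qed
  thus ?thesis unfolding L_twist_def D_def [symmetric] by (simp add: entire_continuation_eq)
qed

end

(*
Write a(n) = lambda_F(n) chi(n), L(s) for the twisted L-function, X = q^(d/2) and x = log q.  By the
functional equation L(1/2) is a sum of two integrals of L(1/2 + s) K(s) over a vertical line to the
right of 1/2, with a rapidly decaying kernel K(s) of size X^(Re s).

For a small step h = x^(-beta-epsilon) and a large fixed k put v(p) = (1 - p^(-h))^k, which is tiny for
small primes and close to 1 once log p is much larger than 1/h, and let u(n) = a(n) prod_{p | n} (1 - v(p)),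
with Dirichlet series U(s).

On the one hand |u(n)| is at most |lambda_F(n)|, and it is negligible unless n has no prime factor p with
log p > x^(beta+2epsilon).  Hypothesis (A3) and the Cauchy-Schwarz inequality then bound the partial sums
of |u(n)| with a saving of x^(-(1-beta)/2+epsilon), and this bounds the contribution of U.

On the other hand L(s)/U(s) is, up to a factor 1 + O(h^k), the exponential of the k-th difference of
log L with step h at s, because summing v(p) a(p) p^(-s) over p takes the k-th difference of the sum of
a(p) p^(-s).  In the zero-free disc of radius r >> x^(-beta) one has log L << x by the Borel-Caratheodory
theorem, so by Cauchy's estimates the k-th difference is << (h/r)^k x << x^(1-k epsilon).  Hence L - U is
negligible on Re s = 1 + 1/x and its contribution is small as well.
*)
theory Submission
  imports Defs "HOL-Real_Asymp.Real_Asymp"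
begin

text \<open>Neither input reaches s = 1/2 alone: the zero-free region controls L only near real part
  1, and (A3) saves only if a long range of primes is excluded. The weight 1 - v(p) joins them: it
  is small on the primes to be excluded, and its complement v(p) is exactly the multiplier that k
  differences produce.

  One difference gains only x^(-\<epsilon>) over the size x of log L. With
  \<open>\<epsilon> * k \<ge> 4\<close> the gain covers that size, the size x of the Dirichlet
  series at real part 1 + 1/x, fixed constants, and a final saving 1/x. That abscissa is chosen
  because X^(1/x) is bounded.

  The factor exp(s^2) in the kernel leaves a decay exp(-|t|), so only zeros with |t| up to x + 1
  matter.

  The margin \<theta> in the condition on the \<mu>_j keeps the poles of the gamma quotient off such
  a line.\<close>

section \<open>Integrals over vertical lines\<close>

text \<open>Integration is with respect to the ordinate, so this is the contour integral divided by the
  imaginary unit; as a Bochner integral it is 0 when the integrand is not integrable.\<close>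
definition vertical_integral :: "real \<Rightarrow> (complex \<Rightarrow> complex) \<Rightarrow> complex" where
  "vertical_integral a f = (\<integral>y. f (Complex a y) \<partial>lborel)"

lemma integrable_inverse_1_plus_square: "integrable lborel (\<lambda>y::real. 1 / (1 + y\<^sup>2))"
proof -
  have I: "set_integrable lborel {0..} (\<lambda>y::real. 1 / (1 + y\<^sup>2))"
  proof -
    have "has_bochner_integral lborel (\<lambda>y::real. indicator {0..} y *\<^sub>R (1 / (1 + y\<^sup>2))) (pi / 2 - arctan 0)"
      unfolding has_bochner_integral_iff
    proof
      have nn: "(\<integral>\<^sup>+ y. ennreal (1 / (1 + y\<^sup>2)) * indicator {0..} y \<partial>lborel) = ennreal (pi / 2 - arctan (0::real))"
        by (rule nn_integral_FTC_atLeast)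
           (auto intro!: derivative_eq_intros tendsto_arctan_at_top simp: field_simps)
      have nn2: "(\<integral>\<^sup>+ y. ennreal (indicator {0..} y *\<^sub>R (1 / (1 + y\<^sup>2))) \<partial>lborel) = ennreal (pi / 2 - arctan (0::real))"
        by (subst nn [symmetric], rule nn_integral_cong) (auto simp: indicator_def)
      have nneg: "(pi / 2 - arctan (0::real)) \<ge> 0" by simp
      have hb: "has_bochner_integral lborel (\<lambda>y::real. indicator {0..} y *\<^sub>R (1 / (1 + y\<^sup>2))) (pi / 2 - arctan 0)"
        by (rule has_bochner_integral_nn_integral) (use nn2 nneg in auto)
      show "integrable lborel (\<lambda>y::real. indicator {0..} y *\<^sub>R (1 / (1 + y\<^sup>2)))"
        using hb by (simp add: has_bochner_integral_iff)
      show "integral\<^sup>L lborel (\<lambda>y::real. indicator {0..} y *\<^sub>R (1 / (1 + y\<^sup>2))) = pi / 2 - arctan 0"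
        using hb by (simp add: has_bochner_integral_iff)
    qed
    thus ?thesis by (simp add: set_integrable_def has_bochner_integral_iff)
  qed
  \<comment> \<open>Reflection gives the negative half-line. The two halves overlap only at 0, so
    their sum dominates the integrand.\<close>
  have J: "integrable lborel (\<lambda>y::real. indicator {0..} (- y) *\<^sub>R (1 / (1 + (- y)\<^sup>2)))"
    using I lborel_integrable_real_affine[of "\<lambda>y::real. indicator {0..} y *\<^sub>R (1 / (1 + y\<^sup>2))" "-1" 0]
    unfolding set_integrable_def by simp
  have "integrable lborel (\<lambda>y::real. indicator {0..} y *\<^sub>R (1 / (1 + y\<^sup>2)) + indicator {0..} (- y) *\<^sub>R (1 / (1 + (- y)\<^sup>2)))"
    using I J unfolding set_integrable_def by (rule Bochner_Integration.integrable_add)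
  then show ?thesis
    by (rule Bochner_Integration.integrable_bound) (auto simp: indicator_def)
qed

text \<open>Its value is \<pi>; it stays symbolic because it enters only as a nonnegative
  factor.\<close>

definition cauchy_weight :: real where
  "cauchy_weight = (\<integral>y. 1 / (1 + y\<^sup>2) \<partial>lborel)"

lemma cauchy_weight_nonneg: "cauchy_weight \<ge> 0"
  unfolding cauchy_weight_def by (rule Bochner_Integration.integral_nonneg) auto

lemma continuous_on_vertical:
  fixes f :: "complex \<Rightarrow> complex"
  assumes "continuous_on {z. Re z = a} f"
  shows "continuous_on UNIV (\<lambda>y. f (Complex a y))"
proof -
  have "continuous_on UNIV (\<lambda>y. Complex a y)"
    unfolding Complex_eq by (intro continuous_intros)
  moreover have "continuous_on (range (Complex a)) f"
    by (rule continuous_on_subset[OF assms]) auto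
  ultimately show ?thesis
    using continuous_on_compose[of UNIV "Complex a" f] by (simp add: o_def)
qed

text \<open>The majorant \<open>C / (1 + y\<^sup>2)\<close> is the one form of decay asked for on
  every vertical line: for integrability, for truncation and for moving the line.\<close>

lemma integrable_vertical:
  fixes f :: "complex \<Rightarrow> complex"
  assumes "continuous_on {z. Re z = a} f"
    and "\<And>y. norm (f (Complex a y)) \<le> C / (1 + y\<^sup>2)"
  shows "integrable lborel (\<lambda>y. f (Complex a y))"
proof (rule Bochner_Integration.integrable_bound[where f = "\<lambda>y. C * (1 / (1 + y\<^sup>2))"])
  show "integrable lborel (\<lambda>y::real. C * (1 / (1 + y\<^sup>2)))"
    using integrable_inverse_1_plus_square by (rule integrable_mult_right)
  show "(\<lambda>y. f (Complex a y)) \<in> borel_measurable lborel"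
    using continuous_on_vertical[OF assms(1)] by (simp add: borel_measurable_continuous_onI)
  show "AE y in lborel. norm (f (Complex a y)) \<le> norm (C * (1 / (1 + y\<^sup>2)))"
    by (intro AE_I2 order_trans[OF assms(2)]) (auto intro!: divide_right_mono)
qed

lemma norm_vertical_integral_le:
  fixes f :: "complex \<Rightarrow> complex"
  assumes "continuous_on {z. Re z = a} f"
    and "\<And>y. norm (f (Complex a y)) \<le> C / (1 + y\<^sup>2)"
  shows "norm (vertical_integral a f) \<le> C * cauchy_weight"
proof -
  have "norm (vertical_integral a f) \<le> (\<integral>y. C * (1 / (1 + y\<^sup>2)) \<partial>lborel)"
    unfolding vertical_integral_def
    by (rule Bochner_Integration.integral_norm_bound_integral[OF integrable_vertical[OF assms]])
       (use assms(2) integrable_mult_right[OF integrable_inverse_1_plus_square, of C] in auto)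
  also have "\<dots> = C * cauchy_weight"
    unfolding cauchy_weight_def by (rule integral_mult_right_zero)
  finally show ?thesis .
qed

lemma vertical_integral_add:
  fixes f g :: "complex \<Rightarrow> complex"
  assumes "continuous_on {z. Re z = a} f" "continuous_on {z. Re z = a} g"
    and "\<And>y. norm (f (Complex a y)) \<le> C / (1 + y\<^sup>2)"
    and "\<And>y. norm (g (Complex a y)) \<le> D / (1 + y\<^sup>2)"
  shows "vertical_integral a (\<lambda>z. f z + g z) = vertical_integral a f + vertical_integral a g"
  unfolding vertical_integral_def
  by (rule Bochner_Integration.integral_add; rule integrable_vertical; fact)

text \<open>Truncation to symmetric segments passes from the Lebesgue integral to gauge integrals
  over intervals, where the fundamental theorem of calculus applies.\<close>

lemma vertical_integral_tendsto:
  fixes f :: "complex \<Rightarrow> complex"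
  assumes "continuous_on {z. Re z = a} f"
    and "\<And>y. norm (f (Complex a y)) \<le> C / (1 + y\<^sup>2)"
  shows "(\<lambda>n. integral {- real n..real n} (\<lambda>y. f (Complex a y))) \<longlonglongrightarrow> vertical_integral a f"
proof -
  let ?f = "\<lambda>y. f (Complex a y)"
  have int: "integrable lborel ?f" by (rule integrable_vertical) fact+
  have eq: "integral {- real n..real n} ?f = (\<integral>y. indicator {- real n..real n} y *\<^sub>R ?f y \<partial>lborel)" for n
  proof -
    have "set_integrable lborel {- real n..real n} ?f"
      unfolding set_integrable_def using int by (rule integrable_mult_indicator[rotated]) auto
    thus ?thesis using set_borel_integral_eq_integral(2) unfolding set_lebesgue_integral_def by metis
  qed
  show ?thesis
    unfolding eq vertical_integral_def
  proof (rule integral_dominated_convergence)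
    show "integrable lborel (\<lambda>y. norm (?f y))" using int by simp
    show "?f \<in> borel_measurable lborel" using int by simp
    show "(\<lambda>y. indicator {- real n..real n} y *\<^sub>R ?f y) \<in> borel_measurable lborel" for n
      using int by simp
    show "AE y in lborel. norm (indicator {- real n..real n} y *\<^sub>R ?f y) \<le> norm (?f y)" for n
      by (intro AE_I2) (auto simp: indicator_def)
    show "AE y in lborel. (\<lambda>n. indicator {- real n..real n} y *\<^sub>R ?f y) \<longlonglongrightarrow> ?f y"
    proof (intro AE_I2)
      fix y :: real
      have "eventually (\<lambda>n. indicator {- real n..real n} y *\<^sub>R ?f y = ?f y) sequentially"
        using eventually_ge_at_top[of "nat \<lceil>\<bar>y\<bar>\<rceil>"]
        by eventually_elim (simp add: indicator_def, linarith)
      thus "(\<lambda>n. indicator {- real n..real n} y *\<^sub>R ?f y) \<longlonglongrightarrow> ?f y"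
        by (rule tendsto_eventually)
    qed
  qed
qed

text \<open>As a function of the ordinate, \<open>G\<close> has derivative \<open>\<i> * f\<close>;
  hence the division by \<open>\<i>\<close>.\<close>

lemma integral_vertical_primitive:
  assumes G: "\<And>y. (G has_field_derivative f (Complex a y)) (at (Complex a y))" and "H \<ge> 0"
  shows "integral {-H..H} (\<lambda>y. f (Complex a y)) = (G (Complex a H) - G (Complex a (-H))) / \<i>"
proof -
  have "((\<lambda>y. f (Complex a y)) has_integral (G (Complex a H) / \<i> - G (Complex a (-H)) / \<i>)) {-H..H}"
  proof (rule fundamental_theorem_of_calculus)
    fix y assume "y \<in> {-H..H}"
    have "((\<lambda>y. Complex a y) has_vector_derivative \<i>) (at y within {-H..H})"
      unfolding Complex_eq by (auto intro!: derivative_eq_intros simp: has_vector_derivative_def scaleR_conv_of_real)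
    moreover have "(G has_field_derivative f (Complex a y)) (at (Complex a y) within (Complex a) ` {-H..H})"
      using G by (rule has_field_derivative_at_within)
    ultimately have "(G \<circ> Complex a has_vector_derivative \<i> * f (Complex a y)) (at y within {-H..H})"
      by (rule field_vector_diff_chain_within)
    from has_vector_derivative_divide[OF this, of \<i>]
    show "((\<lambda>y. G (Complex a y) / \<i>) has_vector_derivative f (Complex a y)) (at y within {-H..H})"
      by (simp add: o_def)
  qed (use assms in auto)
  thus ?thesis unfolding diff_divide_distrib by (rule integral_unique)
qed

lemma strip_convex_open:
  "convex {z. a < Re z \<and> Re z < b}" "open {z. a < Re z \<and> Re z < b}"
proof -
  have *: "{z. a < Re z \<and> Re z < b} = {z. Re z > a} \<inter> {z. Re z < b}" by auto
  show "convex {z. a < Re z \<and> Re z < b}"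
    unfolding * by (intro convex_Int convex_halfspace_Re_gt convex_halfspace_Re_lt)
  show "open {z. a < Re z \<and> Re z < b}"
    unfolding * by (intro open_Int open_halfspace_Re_gt open_halfspace_Re_lt)
qed

text \<open>Controls a horizontal side of a rectangle by a primitive and the mean value inequality,
  so that no path integrals occur.\<close>

lemma horizontal_primitive_bound:
  assumes "a \<le> b"
    and "\<And>x. a \<le> x \<Longrightarrow> x \<le> b \<Longrightarrow> (G has_field_derivative f (Complex x y)) (at (Complex x y))"
    and "\<And>x. a \<le> x \<Longrightarrow> x \<le> b \<Longrightarrow> norm (f (Complex x y)) \<le> B"
  shows "norm (G (Complex b y) - G (Complex a y)) \<le> B * (b - a)"
proof -
  let ?S = "closed_segment (Complex a y) (Complex b y)"
  have S: "\<exists>x. z = Complex x y \<and> a \<le> x \<and> x \<le> b" if "z \<in> ?S" for z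
    using that assms(1) closed_segment_same_Im[of "Complex a y" "Complex b y"]
    by (auto simp: closed_segment_eq_real_ivl complex_eq_iff intro!: exI[of _ "Re z"])
  have "norm (G (Complex b y) - G (Complex a y)) \<le> B * norm (Complex b y - Complex a y)"
  proof (rule field_differentiable_bound[where S = ?S and f' = f])
    show "convex ?S" by simp
    fix z assume "z \<in> ?S"
    then obtain x where x: "z = Complex x y" "a \<le> x" "x \<le> b" using S by blast
    show "(G has_field_derivative f z) (at z within ?S)"
      using assms(2)[OF x(2,3)] x(1) by (auto intro: has_field_derivative_at_within)
    show "norm (f z) \<le> B" using assms(3)[OF x(2,3)] x(1) by simp
  qed auto
  also have "norm (Complex b y - Complex a y) = b - a"
    using assms(1) by (simp add: cmod_def)
  finally show ?thesis .
qed

lemma quadratic_decay_at_naturals: "(\<lambda>n. C / (1 + (real n)\<^sup>2)) \<longlonglongrightarrow> (0::real)"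
  by real_asymp

text \<open>A primitive on the convex strip takes the place of Cauchy's theorem for rectangles:
  truncated at height n, the two integrals differ by the increments of \<open>G\<close> along two
  horizontal sides, which are O(n^-2).\<close>

theorem vertical_integral_shift:
  assumes ab: "a' < a" "a \<le> b" "b < b'"
    and holo: "f holomorphic_on {z. a' < Re z \<and> Re z < b'}"
    and bound: "\<And>z. a \<le> Re z \<Longrightarrow> Re z \<le> b \<Longrightarrow> norm (f z) \<le> C / (1 + (Im z)\<^sup>2)"
  shows "vertical_integral a f = vertical_integral b f"
proof -
  let ?S = "{z. a' < Re z \<and> Re z < b'}"
  obtain G where G: "\<And>z. z \<in> ?S \<Longrightarrow> (G has_field_derivative f z) (at z)"
    using holomorphic_convex_primitive'[OF strip_convex_open holo] strip_convex_open(2)[of a' b']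
    by (metis at_within_open)
  have cont: "continuous_on {z. Re z = c} f" if "c \<in> {a..b}" for c
    by (rule continuous_on_subset[OF holomorphic_on_imp_continuous_on[OF holo]]) (use ab that in auto)
  define V where "V c n = integral {- real n..real n} (\<lambda>y. f (Complex c y))" for c n
  have V: "V c \<longlonglongrightarrow> vertical_integral c f" if "c \<in> {a..b}" for c
    unfolding V_def by (rule vertical_integral_tendsto[OF cont[OF that]]) (use bound[of "Complex c _"] that in auto)
  have "(\<lambda>n. V b n - V a n) \<longlonglongrightarrow> 0"
  proof (rule tendsto_norm_zero_cancel, rule tendsto_sandwich[OF _ _ tendsto_const])
    show "\<forall>\<^sub>F n in sequentially. 0 \<le> norm (V b n - V a n)" by simp
    show "(\<lambda>n. (2 * C * (b - a)) / (1 + (real n)\<^sup>2)) \<longlonglongrightarrow> 0" by (rule quadratic_decay_at_naturals)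
    show "\<forall>\<^sub>F n in sequentially. norm (V b n - V a n) \<le> (2 * C * (b - a)) / (1 + (real n)\<^sup>2)"
    proof (rule always_eventually, rule allI)
      fix n
      have eq: "V c n = (G (Complex c (real n)) - G (Complex c (- real n))) / \<i>" if "c \<in> {a..b}" for c
        unfolding V_def by (rule integral_vertical_primitive) (use G ab that in auto)
      have h: "norm (G (Complex b y) - G (Complex a y)) \<le> C / (1 + y\<^sup>2) * (b - a)" for y
        by (rule horizontal_primitive_bound[where f = f, OF ab(2)])
           (use G ab bound[of "Complex _ y"] in auto)
      have "V b n - V a n = ((G (Complex b (real n)) - G (Complex a (real n))) - (G (Complex b (- real n)) - G (Complex a (- real n)))) / \<i>"
        using ab by (simp add: eq field_simps)
      hence "norm (V b n - V a n) \<le> norm (G (Complex b (real n)) - G (Complex a (real n))) + norm (G (Complex b (- real n)) - G (Complex a (- real n)))"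
        by (simp only: norm_divide norm_ii div_by_1 norm_triangle_ineq4)
      also have "\<dots> \<le> 2 * (C / (1 + (real n)\<^sup>2) * (b - a))"
        using h[of "real n"] h[of "- real n"] by simp
      finally show "norm (V b n - V a n) \<le> (2 * C * (b - a)) / (1 + (real n)\<^sup>2)" by simp
    qed
  qed
  moreover have "(\<lambda>n. V b n - V a n) \<longlonglongrightarrow> vertical_integral b f - vertical_integral a f"
    using ab by (intro tendsto_diff V) auto
  ultimately show ?thesis using LIMSEQ_unique by fastforce
qed

text \<open>The modulus is the same at both end points, so only the argument changes, in the limit
  from -\<pi>/2 to \<pi>/2.\<close>

lemma Ln_vertical_difference:
  assumes "b > 0"
  shows "(\<lambda>n. Ln (Complex b (real n)) - Ln (Complex b (- real n))) \<longlonglongrightarrow> \<i> * pi"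
proof -
  have eq: "Ln (Complex b (real n)) - Ln (Complex b (- real n)) = \<i> * of_real (2 * arctan (real n / b))" for n
  proof -
    have "Complex b (- real n) = cnj (Complex b (real n))" by (simp add: complex_eq_iff)
    moreover have "Complex b (real n) \<notin> \<real>\<^sub>\<le>\<^sub>0" using assms by (auto simp: complex_nonpos_Reals_iff)
    ultimately have "Ln (Complex b (- real n)) = cnj (Ln (Complex b (real n)))"
      by (simp add: cnj_Ln)
    moreover have "Im (Ln (Complex b (real n))) = arctan (real n / b)"
      using assms by (subst Im_Ln_eq) (auto simp: complex_eq_iff)
    ultimately show ?thesis by (simp add: complex_eq_iff)
  qed
  have "(\<lambda>n. 2 * arctan (real n / b)) \<longlonglongrightarrow> 2 * (pi / 2)"
    by (intro tendsto_mult tendsto_const filterlim_compose[OF tendsto_arctan_at_top])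
       (use assms in real_asymp)
  hence "(\<lambda>n. \<i> * of_real (2 * arctan (real n / b))) \<longlonglongrightarrow> \<i> * of_real (2 * (pi / 2))"
    by (rule tendsto_mult[OF tendsto_const tendsto_of_real])
  moreover have "\<i> * of_real (2 * (pi / 2)) = \<i> * pi" by simp
  ultimately show ?thesis unfolding eq by (simp only:)
qed

text \<open>Without the polar part \<open>F 0 / z\<close> there remains an entire function with a
  primitive \<open>G\<close>, whose contributions to the two lines cancel in the limit. The polar
  part is integrated by a logarithm on each line and adds \<pi> F(0) to the difference each
  time.\<close>

theorem vertical_integral_residue:
  fixes F :: "complex \<Rightarrow> complex"
  assumes b: "b > 0" and holo: "F holomorphic_on UNIV"
    and bound: "\<And>z. \<bar>Re z\<bar> \<le> b \<Longrightarrow> norm (F z) \<le> C / (1 + (Im z)\<^sup>2)"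
  shows "vertical_integral b (\<lambda>z. F z / z) - vertical_integral (- b) (\<lambda>z. F z / z) = 2 * pi * F 0"
proof -
  have C: "C \<ge> 0" using order_trans[OF norm_ge_zero bound[of 0]] b by simp
  define f where "f z = (if z = 0 then deriv F 0 else F z / z - F 0 / z)" for z
  have "(\<lambda>z. if z = 0 then deriv F 0 else F z / z - F 0 / (z - 0)) holomorphic_on UNIV"
    by (rule pole_theorem_open[OF holo]) auto
  moreover have "f = (\<lambda>z. if z = 0 then deriv F 0 else F z / z - F 0 / (z - 0))" by (simp add: fun_eq_iff f_def)
  ultimately have f: "f holomorphic_on UNIV" by metis
  obtain G where "\<And>z. z \<in> UNIV \<Longrightarrow> (G has_field_derivative f z) (at z within UNIV)"
    using holomorphic_convex_primitive'[OF _ _ f] by auto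
  hence G: "(G has_field_derivative f z) (at z)" for z by simp
  define V where "V c n = integral {- real n..real n} (\<lambda>y. F (Complex c y) / Complex c y)" for c n
  have contF: "continuous_on S F" for S
    using continuous_on_subset[OF holomorphic_on_imp_continuous_on[OF holo]] by auto
  have V: "V c \<longlonglongrightarrow> vertical_integral c (\<lambda>z. F z / z)" if c: "\<bar>c\<bar> = b" for c
    unfolding V_def
  proof (rule vertical_integral_tendsto[where C = "C / b"])
    show "continuous_on {z. Re z = c} (\<lambda>z. F z / z)"
      by (intro continuous_intros contF) (use b c in auto)
    fix y
    have "norm (F (Complex c y) / Complex c y) \<le> (C / (1 + y\<^sup>2)) / b"
      unfolding norm_divide using bound[of "Complex c y"] abs_Re_le_cmod[of "Complex c y"] b c C
      by (intro frac_le) auto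
    thus "norm (F (Complex c y) / Complex c y) \<le> (C / b) / (1 + y\<^sup>2)" by (simp add: field_simps)
  qed
  have Vb: "V b n = (G (Complex b n) - G (Complex b (- real n))) / \<i> + F 0 * (Ln (Complex b n) - Ln (Complex b (- real n))) / \<i>" for n
  proof -
    have "V b n = ((\<lambda>z. G z + F 0 * Ln z) (Complex b n) - (\<lambda>z. G z + F 0 * Ln z) (Complex b (- real n))) / \<i>"
      unfolding V_def
    proof (rule integral_vertical_primitive[where G = "\<lambda>z. G z + F 0 * Ln z" and f = "\<lambda>z. F z / z"])
      fix y
      have "Complex b y \<notin> \<real>\<^sub>\<le>\<^sub>0" "Complex b y \<noteq> 0" using b by (auto simp: complex_nonpos_Reals_iff complex_eq_iff)
      thus "((\<lambda>z. G z + F 0 * Ln z) has_field_derivative F (Complex b y) / Complex b y) (at (Complex b y))"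
        by (auto intro!: derivative_eq_intros G simp: f_def field_simps)
    qed auto
    thus ?thesis by (simp add: field_simps)
  qed
  \<comment> \<open>On the left line \<open>Ln (- z)\<close> is the primitive of
    \<open>1 / z\<close> whose cut stays off the line. The reflection swaps the end points, hence
    the opposite sign.\<close>
  have Vmb: "V (-b) n = (G (Complex (-b) n) - G (Complex (-b) (- real n))) / \<i> + F 0 * (Ln (Complex b (- real n)) - Ln (Complex b n)) / \<i>" for n
  proof -
    have "V (-b) n = ((\<lambda>z. G z + F 0 * Ln (-z)) (Complex (-b) n) - (\<lambda>z. G z + F 0 * Ln (-z)) (Complex (-b) (- real n))) / \<i>"
      unfolding V_def
    proof (rule integral_vertical_primitive[where G = "\<lambda>z. G z + F 0 * Ln (-z)" and f = "\<lambda>z. F z / z"])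
      fix y
      have "- Complex (-b) y \<notin> \<real>\<^sub>\<le>\<^sub>0" "Complex (-b) y \<noteq> 0" using b by (auto simp: complex_nonpos_Reals_iff complex_eq_iff)
      thus "((\<lambda>z. G z + F 0 * Ln (-z)) has_field_derivative F (Complex (-b) y) / Complex (-b) y) (at (Complex (-b) y))"
        by (auto intro!: derivative_eq_intros G simp: f_def field_simps)
    qed auto
    moreover have "- Complex (-b) y = Complex b (-y)" for y by (simp add: complex_eq_iff)
    ultimately show ?thesis by (simp add: field_simps)
  qed
  \<comment> \<open>On horizontal sides \<open>F 0 / z\<close> decays only like 1/|y|, more slowly
    than \<open>F\<close>, but this still tends to 0.\<close>
  define K where "K y = (C / (1 + y\<^sup>2) + norm (F 0)) / \<bar>y\<bar> * (b - (-b))" for y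
  have h: "norm (G (Complex b y) - G (Complex (-b) y)) \<le> K y" if y: "y \<noteq> 0" for y
    unfolding K_def
  proof (rule horizontal_primitive_bound[where f = f])
    fix x assume x: "-b \<le> x" "x \<le> b"
    have n0: "Complex x y \<noteq> 0" using y by (auto simp: complex_eq_iff)
    have "norm (f (Complex x y)) = norm (F (Complex x y) - F 0) / norm (Complex x y)"
      using n0 by (simp add: f_def norm_divide flip: diff_divide_distrib)
    also have "\<dots> \<le> (C / (1 + y\<^sup>2) + norm (F 0)) / \<bar>y\<bar>"
    proof (rule frac_le)
      have "norm (F (Complex x y) - F 0) \<le> norm (F (Complex x y)) + norm (F 0)" by (rule norm_triangle_ineq4)
      thus "norm (F (Complex x y) - F 0) \<le> C / (1 + y\<^sup>2) + norm (F 0)"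
        using bound[of "Complex x y"] x by (simp add: abs_le_iff)
      show "\<bar>y\<bar> \<le> norm (Complex x y)" using abs_Im_le_cmod[of "Complex x y"] by simp
    qed (use C y in auto)
    finally show "norm (f (Complex x y)) \<le> (C / (1 + y\<^sup>2) + norm (F 0)) / \<bar>y\<bar>" .
  qed (use b G in auto)
  have Gd: "(\<lambda>n. (G (Complex b (real n)) - G (Complex (-b) (real n))) - (G (Complex b (- real n)) - G (Complex (-b) (- real n)))) \<longlonglongrightarrow> 0"
  proof (rule tendsto_norm_zero_cancel, rule tendsto_sandwich[OF _ _ tendsto_const])
    let ?B = "\<lambda>n. K (real n) + K (- real n)"
    have "?B = (\<lambda>n. 2 * ((C / (1 + (real n)\<^sup>2) + norm (F 0)) / real n * (b - (-b))))"
      by (simp add: K_def fun_eq_iff mult_ac)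
    moreover have "\<dots> \<longlonglongrightarrow> 0" by real_asymp
    ultimately show "?B \<longlonglongrightarrow> 0" by simp
    show "\<forall>\<^sub>F n in sequentially. norm ((G (Complex b (real n)) - G (Complex (-b) (real n))) - (G (Complex b (- real n)) - G (Complex (-b) (- real n)))) \<le> ?B n"
      using eventually_gt_at_top[of 0]
    proof eventually_elim
      case (elim n)
      show ?case
        by (rule order_trans[OF norm_triangle_ineq4]) (use add_mono[OF h[of "real n"] h[of "- real n"]] elim in simp)
    qed
  qed simp
  have "(\<lambda>n. ((G (Complex b (real n)) - G (Complex (-b) (real n))) - (G (Complex b (- real n)) - G (Complex (-b) (- real n)))) / \<i>
      + 2 * F 0 * (Ln (Complex b (real n)) - Ln (Complex b (- real n))) / \<i>) \<longlonglongrightarrow> 0 / \<i> + 2 * F 0 * (\<i> * pi) / \<i>"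
    by (intro tendsto_intros Gd Ln_vertical_difference b) auto
  moreover have "V b n - V (-b) n = ((G (Complex b (real n)) - G (Complex (-b) (real n))) - (G (Complex b (- real n)) - G (Complex (-b) (- real n)))) / \<i>
      + 2 * F 0 * (Ln (Complex b (real n)) - Ln (Complex b (- real n))) / \<i>" for n
    unfolding Vb Vmb by (simp add: field_simps)
  ultimately have "(\<lambda>n. V b n - V (-b) n) \<longlonglongrightarrow> 2 * pi * F 0"
    by (simp add: mult.commute mult.left_commute)
  moreover have "(\<lambda>n. V b n - V (-b) n) \<longlonglongrightarrow> vertical_integral b (\<lambda>z. F z / z) - vertical_integral (- b) (\<lambda>z. F z / z)"
    using b by (intro tendsto_diff V) auto
  ultimately show ?thesis using LIMSEQ_unique by fastforce
qed

section \<open>The Borel-Caratheodory theorem and Cauchy estimates for iterated differences\<close>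

theorem Borel_Caratheodory:
  assumes holo: "f holomorphic_on ball c R" and R: "0 < R"
    and M: "\<And>z. z \<in> ball c R \<Longrightarrow> Re (f z) < M"
    and z: "norm (z - c) \<le> \<rho>" and \<rho>: "\<rho> < R"
  shows "norm (f z - f c) \<le> 2 * \<rho> / (R - \<rho>) * (M - Re (f c))"
proof -
  define A where "A = M - Re (f c)"
  have A: "A > 0" unfolding A_def using M[of c] R by simp
  define h where "h w = f (c + of_real R * w) - f c" for w
  have in_ball: "c + of_real R * w \<in> ball c R" if "norm w < 1" for w
    using that R by (simp add: dist_norm norm_mult)
  have hA: "Re (h w) < A" if "norm w < 1" for w
    using M[OF in_ball[OF that]] by (simp add: h_def A_def)
  have h_holo: "h holomorphic_on ball 0 1"
    unfolding h_def
    by (intro holomorphic_intros holomorphic_on_compose_gen[OF _ holo, unfolded o_def])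
       (use in_ball in auto)
  have nz: "2 * of_real A - h w \<noteq> 0" if "norm w < 1" for w
    using hA[OF that] A by (auto simp: complex_eq_iff)
  \<comment> \<open>\<open>h\<close> takes values in the half-plane of real parts below
    \<open>A\<close>, which w / (2A - w) maps into the unit disc with 0 fixed; the Schwarz lemma
    applies to the composition.\<close>
  define \<phi> where "\<phi> w = h w / (2 * of_real A - h w)" for w
  have lt: "norm (\<phi> w) < 1" if w: "norm w < 1" for w
  proof -
    have "(norm (h w))\<^sup>2 < (norm (2 * of_real A - h w))\<^sup>2"
    proof -
      have "(norm (2 * of_real A - h w))\<^sup>2 - (norm (h w))\<^sup>2 = 4 * A * (A - Re (h w))"
        unfolding cmod_power2 by (simp add: power2_eq_square algebra_simps)
      also have "\<dots> > 0" using A hA[OF w] by simp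
      finally show ?thesis by simp
    qed
    hence "norm (h w) < norm (2 * of_real A - h w)" by (rule power2_less_imp_less) simp
    thus ?thesis using nz[OF w] by (simp add: \<phi>_def norm_divide)
  qed
  have \<phi>_holo: "\<phi> holomorphic_on ball 0 1"
    unfolding \<phi>_def by (intro holomorphic_intros h_holo) (use nz in auto)
  have \<rho>0: "0 \<le> \<rho>" using z norm_ge_zero order_trans by blast
  define w where "w = (z - c) / of_real R"
  have w: "norm w \<le> \<rho> / R" using z R by (simp add: w_def norm_divide divide_right_mono)
  have w1: "norm w < 1" using w \<rho> R by (smt (verit) divide_less_eq_1)
  have "norm (\<phi> w) \<le> norm w"
    by (rule Schwarz_Lemma(1)[OF \<phi>_holo _ lt w1]) (simp_all add: \<phi>_def h_def)
  with w have p: "norm (\<phi> w) \<le> \<rho> / R" by simp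
  have fz: "f z - f c = h w" using R by (simp add: h_def w_def)
  have eq: "h w * (1 + \<phi> w) = 2 * of_real A * \<phi> w"
    using nz[OF w1] by (simp add: \<phi>_def field_simps)
  have "norm (1 + \<phi> w) \<ge> 1 - norm (\<phi> w)"
    using norm_triangle_ineq4[of "1 + \<phi> w" "\<phi> w"] by simp
  hence "norm (1 + \<phi> w) \<ge> 1 - \<rho> / R" using p by simp
  hence "norm (h w) * (1 - \<rho> / R) \<le> norm (h w) * norm (1 + \<phi> w)" by (intro mult_left_mono) auto
  also have "\<dots> = 2 * A * norm (\<phi> w)" using eq A by (metis norm_mult norm_of_real abs_of_pos norm_numeral)
  also have "\<dots> \<le> 2 * A * (\<rho> / R)" using A p by (intro mult_left_mono) auto
  finally have "norm (h w) \<le> 2 * A * (\<rho> / R) / (1 - \<rho> / R)"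
    by (subst pos_le_divide_eq) (use \<rho> R in simp_all)
  also have "\<dots> = 2 * \<rho> / (R - \<rho>) * A" using \<rho> R by (simp add: field_simps)
  finally show ?thesis by (simp add: fz A_def)
qed

text \<open>Differences run to the right and have the sign f(w) - f(w + h). For real h \<ge> 0 the
  sample points then stay in the half-plane of absolute convergence, and the multiplier of p^(-s) is
  nonnegative.\<close>

fun fin_diff :: "complex \<Rightarrow> nat \<Rightarrow> (complex \<Rightarrow> complex) \<Rightarrow> complex \<Rightarrow> complex" where
  "fin_diff h 0 f z = f z"
| "fin_diff h (Suc k) f z = fin_diff h k (\<lambda>w. f w - f (w + h)) z"

lemma fin_diff_cong:
  assumes "\<And>j. j \<le> k \<Longrightarrow> f (z + of_nat j * h) = g (z + of_nat j * h)"
  shows "fin_diff h k f z = fin_diff h k g z"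
  using assms
proof (induction k arbitrary: f g)
  case 0
  from this[of 0] show ?case by simp
next
  case (Suc k)
  show ?case
    unfolding fin_diff.simps
  proof (rule Suc.IH)
    fix j assume "j \<le> k"
    thus "f (z + of_nat j * h) - f (z + of_nat j * h + h) = g (z + of_nat j * h) - g (z + of_nat j * h + h)"
      using Suc.prems[of j] Suc.prems[of "Suc j"] by (simp add: algebra_simps)
  qed
qed

lemma deriv_bound_ball:
  assumes "f holomorphic_on ball c R" "\<And>z. z \<in> ball c R \<Longrightarrow> norm (f z) \<le> B"
    and "0 < \<rho>" "dist c z + \<rho> < R"
  shows "norm (deriv f z) \<le> B / \<rho>"
proof -
  have sub: "cball z \<rho> \<subseteq> ball c R"
  proof
    fix w assume "w \<in> cball z \<rho>"
    thus "w \<in> ball c R" using dist_triangle[of c w z] assms(4) by simp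
  qed
  have "norm ((deriv ^^ 1) f z) \<le> fact 1 * B / \<rho> ^ 1"
  proof (rule Cauchy_inequality)
    show "f holomorphic_on ball z \<rho>" "continuous_on (cball z \<rho>) f"
      using assms(1) sub ball_subset_cball
      by (meson holomorphic_on_subset order_trans, meson holomorphic_on_imp_continuous_on holomorphic_on_subset)
    fix x assume "norm (z - x) = \<rho>"
    hence "x \<in> cball z \<rho>" by (simp add: dist_norm)
    thus "norm (f x) \<le> B" using sub assms(2) by blast
  qed fact
  thus ?thesis by simp
qed

text \<open>Each difference gains a factor \<open>norm h / \<rho>\<close> and costs
  \<open>2 * \<rho>\<close> of the radius: one \<open>\<rho>\<close> for the translated point, one
  for Cauchy's estimate of the derivative on the segment. The disc shrinks along the induction, so
  \<open>f\<close>, \<open>R\<close> and \<open>B\<close> vary.\<close>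

theorem norm_fin_diff_le:
  assumes "f holomorphic_on ball c R" "\<And>z. z \<in> ball c R \<Longrightarrow> norm (f z) \<le> B"
    and "norm h \<le> \<rho>" "0 < \<rho>" "dist c z + 2 * \<rho> * real k < R"
  shows "norm (fin_diff h k f z) \<le> (norm h / \<rho>) ^ k * B"
  using assms
proof (induction k arbitrary: f R B)
  case (Suc k)
  define g where "g w = f w - f (w + h)" for w
  have near: "w + of_real t * h \<in> ball c (R - \<rho>)" if "w \<in> ball c (R - 2 * \<rho>)" "0 \<le> t" "t \<le> 1" for w t
  proof -
    have "dist c (w + of_real t * h) \<le> dist c w + norm (of_real t * h)"
      by (metis dist_norm dist_triangle add_diff_cancel_left' dist_commute)
    also have "norm (of_real t * h) \<le> 1 * \<rho>"
      unfolding norm_mult using that Suc.prems(3) by (intro mult_mono) auto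
    finally show ?thesis using that by simp
  qed
  have sub: "ball c (R - 2 * \<rho>) \<subseteq> ball c R" "ball c (R - \<rho>) \<subseteq> ball c R" using Suc.prems(4) by (auto simp: subset_ball)
  have "norm (fin_diff h k g z) \<le> (norm h / \<rho>) ^ k * (norm h / \<rho> * B)"
  proof (rule Suc.IH[where R = "R - 2 * \<rho>"])
    have "(\<lambda>w. f (w + h)) holomorphic_on ball c (R - 2 * \<rho>)"
      by (rule holomorphic_on_compose_gen[OF _ Suc.prems(1), unfolded o_def])
         (use near[of _ 1] sub in \<open>auto intro!: holomorphic_intros\<close>)
    thus "g holomorphic_on ball c (R - 2 * \<rho>)"
      unfolding g_def by (intro holomorphic_intros holomorphic_on_subset[OF Suc.prems(1) sub(1)])
  next
    fix w assume w: "w \<in> ball c (R - 2 * \<rho>)"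
    let ?S = "closed_segment w (w + h)"
    have S: "x \<in> ball c (R - \<rho>)" if x: "x \<in> ?S" for x
    proof -
      from x obtain t where t: "0 \<le> t" "t \<le> 1" "x = (1 - t) *\<^sub>R w + t *\<^sub>R (w + h)"
        by (auto simp: closed_segment_def)
      have "x = w + of_real t * h" using t(3) by (simp add: scaleR_conv_of_real algebra_simps)
      thus ?thesis using near[OF w t(1,2)] by simp
    qed
    have "norm (f (w + h) - f w) \<le> B / \<rho> * norm (w + h - w)"
    proof (rule field_differentiable_bound[where S = ?S and f' = "deriv f"])
      fix x assume x: "x \<in> ?S"
      have "x \<in> ball c R" using S[OF x] sub by blast
      hence "(f has_field_derivative deriv f x) (at x)"
        using Suc.prems(1) by (auto intro: holomorphic_derivI)
      thus "(f has_field_derivative deriv f x) (at x within ?S)" by (rule has_field_derivative_at_within)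
      show "norm (deriv f x) \<le> B / \<rho>"
        by (rule deriv_bound_ball[OF Suc.prems(1,2)]) (use S[OF x] Suc.prems(4) in auto)
    qed auto
    thus "norm (g w) \<le> norm h / \<rho> * B" by (simp add: g_def norm_minus_commute mult.commute)
  next
    show "dist c z + 2 * \<rho> * real k < R - 2 * \<rho>" using Suc.prems(5) by (simp add: algebra_simps)
  qed (use Suc.prems in auto)
  thus ?case unfolding g_def[abs_def] by (simp add: mult_ac)
qed auto

section \<open>Gamma factors\<close>

text \<open>The absolute value is taken inside Euler's integral.\<close>

lemma norm_Gamma_le_Gamma_Re:
  assumes "Re z > 0"
  shows "norm (Gamma z) \<le> Gamma (Re z)"
proof -
  have 1: "((\<lambda>t. of_real t powr (z - 1) / of_real (exp t)) has_integral Gamma z) {0..}"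
    by (rule Gamma_integral_complex) fact
  have 2: "((\<lambda>t. t powr (Re z - 1) / exp t) has_integral Gamma (Re z)) {0..}"
    by (rule Gamma_integral_real) fact
  have "norm (integral {0..} (\<lambda>t. of_real t powr (z - 1) / of_real (exp t) :: complex)) \<le> integral {0..} (\<lambda>t. t powr (Re z - 1) / exp t)"
    by (rule integral_norm_bound_integral)
       (use 1 2 in \<open>auto simp: has_integral_integrable norm_divide norm_powr_real_powr\<close>)
  thus ?thesis using 1 2 by (simp add: integral_unique)
qed

lemma Gamma_bounded_strip:
  assumes "0 < a"
  shows "\<exists>C\<ge>0. \<forall>z. a \<le> Re z \<and> Re z \<le> b \<longrightarrow> norm (Gamma z) \<le> C"
proof -
  have "continuous_on {a..b} (Gamma :: real \<Rightarrow> real)"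
    by (intro continuous_intros) (use assms in \<open>auto elim!: nonpos_Ints_cases\<close>)
  hence "bounded ((Gamma :: real \<Rightarrow> real) ` {a..b})"
    by (intro compact_imp_bounded compact_continuous_image) auto
  then obtain C where "\<forall>x\<in>{a..b}. norm (Gamma x) \<le> C" unfolding bounded_iff by blast
  hence C: "\<And>x. x \<in> {a..b} \<Longrightarrow> norm (Gamma x) \<le> C" by blast
  show ?thesis
  proof (intro exI[of _ "max C 0"] conjI allI impI)
    fix z assume z: "a \<le> Re z \<and> Re z \<le> b"
    have "norm (Gamma z) \<le> Gamma (Re z)" by (rule norm_Gamma_le_Gamma_Re) (use z assms in auto)
    also have "\<dots> \<le> C" using C[of "Re z"] z by auto
    finally show "norm (Gamma z) \<le> max C 0" by simp
  qed simp
qed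

lemma norm_sin_le_exp: "norm (sin z) \<le> exp \<bar>Im z\<bar>"
proof -
  have "norm (sin z) = norm (exp (\<i> * z) - exp (- (\<i> * z))) / 2"
    by (simp add: sin_exp_eq norm_divide norm_mult)
  also have "\<dots> \<le> (norm (exp (\<i> * z)) + norm (exp (- (\<i> * z)))) / 2"
    by (intro divide_right_mono norm_triangle_ineq4) auto
  also have "\<dots> = (exp (- Im z) + exp (Im z)) / 2" by simp
  also have "\<dots> \<le> (exp \<bar>Im z\<bar> + exp \<bar>Im z\<bar>) / 2" by (intro divide_right_mono add_mono) auto
  finally show ?thesis by simp
qed

text \<open>The reflection formula trades the reciprocal for Gamma at \<open>1 - z\<close>, bounded
  to the right of 1/2, and a sine that contributes the exponential. The true rate is smaller, but a
  Gaussian will absorb any such factor.\<close>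

lemma rGamma_strip_left:
  "\<exists>C\<ge>0. \<forall>z. a \<le> Re z \<and> Re z \<le> 1 / 2 \<longrightarrow> norm (rGamma z) \<le> C * exp (pi * \<bar>Im z\<bar>)"
proof -
  obtain C where C: "C \<ge> 0" "\<And>z. 1 / 2 \<le> Re z \<Longrightarrow> Re z \<le> 1 - a \<Longrightarrow> norm (Gamma z) \<le> C"
    using Gamma_bounded_strip[of "1/2" "1 - a"] by auto
  show ?thesis
  proof (intro exI[of _ "C"] conjI allI impI)
    fix z assume z: "a \<le> Re z \<and> Re z \<le> 1 / 2"
    have "(1 - z) \<notin> \<int>\<^sub>\<le>\<^sub>0" using z by (auto elim!: nonpos_Ints_cases simp: complex_eq_iff)
    hence "rGamma (1 - z) * Gamma (1 - z) = 1" by (simp add: Gamma_def rGamma_eq_zero_iff)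
    hence "rGamma z = sin (of_real pi * z) / of_real pi * Gamma (1 - z)"
      using rGamma_reflection_complex[of z] by (metis mult.assoc mult.right_neutral)
    hence "norm (rGamma z) = norm (sin (of_real pi * z)) / pi * norm (Gamma (1 - z))"
      by (simp add: norm_mult norm_divide)
    also have "\<dots> \<le> exp \<bar>Im (of_real pi * z)\<bar> / 1 * C"
      by (intro mult_mono frac_le norm_sin_le_exp C) (use z pi_ge_two in auto)
    also have "\<dots> = C * exp (pi * \<bar>Im z\<bar>)" by (simp add: abs_mult)
    finally show "norm (rGamma z) \<le> C * exp (pi * \<bar>Im z\<bar>)" .
  qed (use C in auto)
qed

text \<open>Unit steps to the right by (z - 1) rGamma(z) = rGamma(z - 1). Outside the unit disc
  around 1 the factor z - 1 only helps, and on that disc compactness gives a bound.\<close>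

lemma rGamma_strip:
  "\<exists>C\<ge>0. \<forall>z. a \<le> Re z \<and> Re z \<le> b \<longrightarrow> norm (rGamma z) \<le> C * exp (pi * \<bar>Im z\<bar>)"
proof -
  have ind: "\<exists>C\<ge>0. \<forall>z. a \<le> Re z \<and> Re z \<le> 1 / 2 + real n \<longrightarrow> norm (rGamma z) \<le> C * exp (pi * \<bar>Im z\<bar>)" for n a
  proof (induction n arbitrary: a)
    case 0 show ?case using rGamma_strip_left[of a] by simp
  next
    case (Suc n)
    obtain C where C: "C \<ge> 0" "\<And>z. a - 1 \<le> Re z \<Longrightarrow> Re z \<le> 1 / 2 + real n \<Longrightarrow> norm (rGamma z) \<le> C * exp (pi * \<bar>Im z\<bar>)"
      using Suc.IH[of "a - 1"] by auto
    have "bounded (rGamma ` cball (1::complex) 1)"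
      by (intro compact_imp_bounded compact_continuous_image continuous_intros) auto
    then obtain D where "\<forall>z\<in>cball (1::complex) 1. norm (rGamma z) \<le> D" unfolding bounded_iff by blast
    hence D: "\<And>z::complex. z \<in> cball 1 1 \<Longrightarrow> norm (rGamma z) \<le> D" by blast
    show ?case
    proof (intro exI[of _ "max C D"] conjI allI impI)
      fix z assume z: "a \<le> Re z \<and> Re z \<le> 1 / 2 + real (Suc n)"
      show "norm (rGamma z) \<le> max C D * exp (pi * \<bar>Im z\<bar>)"
      proof (cases "z \<in> cball 1 1")
        case True
        have "norm (rGamma z) \<le> max C D * 1" using D[OF True] by simp
        also have "\<dots> \<le> max C D * exp (pi * \<bar>Im z\<bar>)" using C by (intro mult_left_mono) auto
        finally show ?thesis .
      next
        case False
        hence n1: "norm (z - 1) \<ge> 1" by (simp add: dist_norm norm_minus_commute)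
        have "norm (rGamma z) \<le> norm (z - 1) * norm (rGamma z)" using n1 by (simp add: mult_le_cancel_right1)
        also have "\<dots> = norm (rGamma (z - 1))"
          using rGamma_plus1[of "z - 1"] by (metis norm_mult diff_add_cancel)
        also have "\<dots> \<le> C * exp (pi * \<bar>Im (z - 1)\<bar>)" by (rule C) (use z in auto)
        also have "\<dots> \<le> max C D * exp (pi * \<bar>Im z\<bar>)" by (intro mult_mono) (use C in auto)
        finally show ?thesis .
      qed
    qed (use C in auto)
  qed
  obtain n where "b \<le> real n" using real_arch_simple by blast
  with ind[of a n] show ?thesis by (meson add_increasing order_trans divide_nonneg_nonneg zero_le_numeral zero_le_one)
qed

text \<open>This is the quotient of \<open>Gamma_R\<close> at w + \<mu> and at 1 - w + cnj \<mu>,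
  one archimedean factor of the functional equation. The denominator is written with the entire
  function \<open>rGamma\<close>, so that only the numerator has poles.\<close>

definition gamma_factor :: "complex \<Rightarrow> complex \<Rightarrow> complex" where
  "gamma_factor \<mu> w = Gamma_R (w + \<mu>) *
     (of_real pi powr ((1 - w + cnj \<mu>) / 2) * rGamma ((1 - w + cnj \<mu>) / 2))"

lemma norm_pi_powr:
  "norm (of_real pi powr z :: complex) = pi powr (Re z)"
  by (simp add: norm_powr_real_powr)

text \<open>The hypothesis puts the strip to the right of the poles. The rate 2 is \<pi>/2 rounded
  up, and the shift by \<open>Im \<mu>\<close> goes into the constant.\<close>

lemma gamma_factor_bound:
  assumes "c1 + Re \<mu> > 0"
  shows "\<exists>C\<ge>0. \<forall>w. c1 \<le> Re w \<and> Re w \<le> c2 \<longrightarrow> norm (gamma_factor \<mu> w) \<le> C * exp (2 * \<bar>Im w\<bar>)"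
proof -
  obtain C where C: "C \<ge> 0" "\<And>z. (c1 + Re \<mu>) / 2 \<le> Re z \<Longrightarrow> Re z \<le> (c2 + Re \<mu>) / 2 \<Longrightarrow> norm (Gamma z) \<le> C"
    using Gamma_bounded_strip[of "(c1 + Re \<mu>) / 2" "(c2 + Re \<mu>) / 2"] assms by auto
  obtain D where D: "D \<ge> 0" "\<And>z. (1 - c2 + Re \<mu>) / 2 \<le> Re z \<Longrightarrow> Re z \<le> (1 - c1 + Re \<mu>) / 2 \<Longrightarrow>
      norm (rGamma z) \<le> D * exp (pi * \<bar>Im z\<bar>)"
    using rGamma_strip[of "(1 - c2 + Re \<mu>) / 2" "(1 - c1 + Re \<mu>) / 2"] by auto
  define P where "P = pi powr ((1 - c1 + Re \<mu>) / 2)"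
  show ?thesis
  proof (intro exI[of _ "1 * C * (P * (D * exp (2 * \<bar>Im \<mu>\<bar>)))"] conjI allI impI)
    show "0 \<le> 1 * C * (P * (D * exp (2 * \<bar>Im \<mu>\<bar>)))" using C D by (simp add: P_def)
    fix w assume w: "c1 \<le> Re w \<and> Re w \<le> c2"
    have "norm (gamma_factor \<mu> w) = pi powr (- (Re w + Re \<mu>) / 2) * norm (Gamma ((w + \<mu>) / 2)) *
        (pi powr ((1 - Re w + Re \<mu>) / 2) * norm (rGamma ((1 - w + cnj \<mu>) / 2)))"
      by (simp add: gamma_factor_def Gamma_R_def norm_mult norm_powr_real_powr)
    also have "\<dots> \<le> 1 * C * (P * (D * exp (2 * \<bar>Im \<mu>\<bar>) * exp (2 * \<bar>Im w\<bar>)))"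
    proof (intro mult_mono)
      have "pi powr (- (Re w + Re \<mu>) / 2) \<le> pi powr 0"
        using w assms pi_ge_two by (intro powr_mono) auto
      thus "pi powr (- (Re w + Re \<mu>) / 2) \<le> 1" by simp
      show "norm (Gamma ((w + \<mu>) / 2)) \<le> C" by (rule C) (use w in auto)
      show "pi powr ((1 - Re w + Re \<mu>) / 2) \<le> P"
        unfolding P_def using w pi_ge_two by (intro powr_mono) auto
      have "norm (rGamma ((1 - w + cnj \<mu>) / 2)) \<le> D * exp (pi * \<bar>Im ((1 - w + cnj \<mu>) / 2)\<bar>)"
        by (rule D) (use w in auto)
      also have "\<bar>Im ((1 - w + cnj \<mu>) / 2)\<bar> \<le> (\<bar>Im w\<bar> + \<bar>Im \<mu>\<bar>) / 2" by simp
      hence "pi * \<bar>Im ((1 - w + cnj \<mu>) / 2)\<bar> \<le> 4 * ((\<bar>Im w\<bar> + \<bar>Im \<mu>\<bar>) / 2)"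
        using pi_less_4 by (intro mult_mono) auto
      hence "D * exp (pi * \<bar>Im ((1 - w + cnj \<mu>) / 2)\<bar>) \<le> D * (exp (2 * \<bar>Im \<mu>\<bar>) * exp (2 * \<bar>Im w\<bar>))"
        using D by (intro mult_left_mono) (auto simp flip: exp_add)
      finally show "norm (rGamma ((1 - w + cnj \<mu>) / 2)) \<le> D * exp (2 * \<bar>Im \<mu>\<bar>) * exp (2 * \<bar>Im w\<bar>)"
        by (simp add: mult_ac)
    qed (use C D in \<open>auto simp: P_def\<close>)
    finally show "norm (gamma_factor \<mu> w) \<le> 1 * C * (P * (D * exp (2 * \<bar>Im \<mu>\<bar>))) * exp (2 * \<bar>Im w\<bar>)"
      by (simp add: mult_ac)
  qed
qed

lemma Re_pos_not_nonpos_Int: "Re z > 0 \<Longrightarrow> z \<notin> \<int>\<^sub>\<le>\<^sub>0"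
  by (auto elim!: nonpos_Ints_cases)

lemma holomorphic_gamma_factor: "gamma_factor \<mu> holomorphic_on {w. Re w > - Re \<mu>}"
  unfolding gamma_factor_def[abs_def] Gamma_R_def
  by (intro holomorphic_intros) (auto intro!: Re_pos_not_nonpos_Int)

lemma gamma_factor_prod_bound:
  assumes "finite J" "\<And>j. j \<in> J \<Longrightarrow> c1 + Re (\<mu> j) > 0"
  shows "\<exists>C\<ge>0. \<forall>w. c1 \<le> Re w \<and> Re w \<le> c2 \<longrightarrow>
    norm (\<Prod>j\<in>J. gamma_factor (\<mu> j) w) \<le> C * exp (2 * real (card J) * \<bar>Im w\<bar>)"
  using assms
proof (induction J rule: finite_induct)
  case empty show ?case by (intro exI[of _ 1]) auto
next
  case (insert j J)
  obtain C where C: "C \<ge> 0" "\<And>w. c1 \<le> Re w \<and> Re w \<le> c2 \<Longrightarrow>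
      norm (\<Prod>j\<in>J. gamma_factor (\<mu> j) w) \<le> C * exp (2 * real (card J) * \<bar>Im w\<bar>)"
    using insert by auto
  obtain D where D: "D \<ge> 0" "\<And>w. c1 \<le> Re w \<and> Re w \<le> c2 \<Longrightarrow> norm (gamma_factor (\<mu> j) w) \<le> D * exp (2 * \<bar>Im w\<bar>)"
    using gamma_factor_bound[of c1 "\<mu> j" c2] insert by auto
  show ?case
  proof (intro exI[of _ "D * C"] conjI allI impI)
    fix w assume w: "c1 \<le> Re w \<and> Re w \<le> c2"
    have "norm (\<Prod>j\<in>insert j J. gamma_factor (\<mu> j) w) \<le> (D * exp (2 * \<bar>Im w\<bar>)) * (C * exp (2 * real (card J) * \<bar>Im w\<bar>))"
      using insert by (simp add: norm_mult) (intro mult_mono C D w; use C D in auto)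
    also have "\<dots> = D * C * (exp (2 * \<bar>Im w\<bar>) * exp (2 * real (card J) * \<bar>Im w\<bar>))" by (simp add: mult_ac)
    also have "exp (2 * \<bar>Im w\<bar>) * exp (2 * real (card J) * \<bar>Im w\<bar>) = exp (2 * real (card (insert j J)) * \<bar>Im w\<bar>)"
      using insert by (simp add: algebra_simps flip: exp_add)
    finally show "norm (\<Prod>j\<in>insert j J. gamma_factor (\<mu> j) w) \<le> D * C * exp (2 * real (card (insert j J)) * \<bar>Im w\<bar>)" .
  qed (use C D in auto)
qed

section \<open>Gaussian decay against exponential growth\<close>

lemma one_plus_square_le_exp: "1 + y\<^sup>2 \<le> 2 * exp (y\<^sup>2 / 2)" for y :: real
proof -
  have "1 + y\<^sup>2 / 2 \<le> exp (y\<^sup>2 / 2)" by (rule exp_ge_add_one_self)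
  moreover have "y\<^sup>2 \<ge> 0" by simp
  ultimately show ?thesis by linarith
qed

text \<open>A factor exp(-|y|) is kept apart from the integrable weight; it will dispose of the
  ordinates beyond the zero-free region. The constant comes from completing the square with
  \<open>A + 1\<close>.\<close>

lemma gaussian_decay:
  fixes y A :: real
  shows "exp (A * \<bar>y\<bar> - y\<^sup>2) \<le> 2 * exp ((A + 1)\<^sup>2 / 2) * exp (- \<bar>y\<bar>) / (1 + y\<^sup>2)"
proof -
  have "exp (A * \<bar>y\<bar> - y\<^sup>2) * (1 + y\<^sup>2) \<le> exp (A * \<bar>y\<bar> - y\<^sup>2) * (2 * exp (y\<^sup>2 / 2))"
    by (intro mult_left_mono one_plus_square_le_exp) auto
  also have "\<dots> = 2 * exp (A * \<bar>y\<bar> - y\<^sup>2 / 2)" by (simp flip: exp_add)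
  also have "A * \<bar>y\<bar> - y\<^sup>2 / 2 \<le> (A + 1)\<^sup>2 / 2 - \<bar>y\<bar>"
  proof -
    have "0 \<le> (\<bar>y\<bar> - (A + 1))\<^sup>2" by simp
    thus ?thesis by (simp add: power2_eq_square algebra_simps flip: abs_mult)
  qed
  hence "2 * exp (A * \<bar>y\<bar> - y\<^sup>2 / 2) \<le> 2 * exp ((A + 1)\<^sup>2 / 2 - \<bar>y\<bar>)" by simp
  also have "\<dots> = 2 * exp ((A + 1)\<^sup>2 / 2) * exp (- \<bar>y\<bar>)" by (simp flip: exp_add)
  finally show ?thesis
    using zero_le_power2[of y] by (subst pos_le_divide_eq) (auto intro: add_pos_nonneg)
qed

text \<open>The split is at 64, where the square root is 8 and the power 3/2 is 512. The coefficient
  1/8 is small enough for the budget of \<open>subgaussian_decay\<close>.\<close>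

lemma powr_three_halves_le: "x powr (3 / 2) \<le> x\<^sup>2 / 8 + 512" if "x \<ge> 0" for x :: real
proof (cases "x \<le> 64")
  case True
  have "x powr (3/2) \<le> 64 powr (3/2)" using that True by (intro powr_mono2) auto
  also have "(64::real) powr (3/2) = (8 powr 2) powr (3/2)" by simp
  also have "\<dots> = 512" by (simp only: powr_powr) simp
  finally show ?thesis using zero_le_power2[of x] by linarith
next
  case False
  have "x powr (3/2) * 8 = x powr (3/2) * 64 powr (1/2)" by (simp add: powr_half_sqrt)
  also have "\<dots> \<le> x powr (3/2) * x powr (1/2)" using False by (intro mult_left_mono powr_mono2) auto
  also have "\<dots> = x\<^sup>2" using False by (simp flip: powr_add)
  finally show ?thesis by simp
qed

text \<open>Growth of order below 2 loses against the Gaussian. Each of the two growing terms is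
  allotted a quarter of y^2, and the remaining half pays for the weight 1 + y^2.\<close>

lemma subgaussian_decay:
  fixes y A B :: real
  assumes "0 \<le> x" "x \<le> B + \<bar>y\<bar>" "0 \<le> B"
  shows "exp (x powr (3 / 2) + A * \<bar>y\<bar> - y\<^sup>2) \<le> 2 * exp (512 + B\<^sup>2 / 4 + A\<^sup>2) / (1 + y\<^sup>2)"
proof -
  have "x\<^sup>2 \<le> (B + \<bar>y\<bar>)\<^sup>2" using assms by (intro power_mono) auto
  also have "\<dots> \<le> 2 * B\<^sup>2 + 2 * y\<^sup>2"
  proof -
    have "0 \<le> (B - \<bar>y\<bar>)\<^sup>2" by simp
    thus ?thesis by (simp add: power2_eq_square algebra_simps flip: abs_mult)
  qed
  finally have x: "x powr (3 / 2) \<le> 512 + B\<^sup>2 / 4 + y\<^sup>2 / 4" using powr_three_halves_le[OF assms(1)] by linarith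
  have A: "A * \<bar>y\<bar> \<le> A\<^sup>2 + y\<^sup>2 / 4"
  proof -
    have "0 \<le> (\<bar>y\<bar> / 2 - A)\<^sup>2" by simp
    thus ?thesis by (simp add: power2_eq_square algebra_simps flip: abs_mult)
  qed
  have "exp (x powr (3 / 2) + A * \<bar>y\<bar> - y\<^sup>2) * (1 + y\<^sup>2) \<le> exp (512 + B\<^sup>2 / 4 + A\<^sup>2 - y\<^sup>2 / 2) * (2 * exp (y\<^sup>2 / 2))"
    by (intro mult_mono one_plus_square_le_exp) (use x A in auto)
  also have "\<dots> = 2 * exp (512 + B\<^sup>2 / 4 + A\<^sup>2)" by (simp flip: exp_add)
  finally show ?thesis
    using zero_le_power2[of y] by (subst pos_le_divide_eq) (auto intro: add_pos_nonneg)
qed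

lemma norm_exp_square: "norm (exp (z\<^sup>2)) = exp ((Re z)\<^sup>2 - (Im z)\<^sup>2)" for z :: complex
  by (simp add: power2_eq_square)

section \<open>Sums over integers and multiplicative weights\<close>

text \<open>Summation by parts: against a decreasing nonnegative weight, information about partial
  sums is all that is needed.\<close>

lemma sum_majorize:
  fixes f \<phi> g :: "nat \<Rightarrow> real"
  assumes maj: "\<And>m. m \<le> M \<Longrightarrow> (\<Sum>n=1..m. f n) \<le> (\<Sum>n=1..m. \<phi> n)"
    and dec: "\<And>n. n \<ge> 1 \<Longrightarrow> g (Suc n) \<le> g n" and nonneg: "\<And>n. g n \<ge> 0"
  shows "(\<Sum>n=1..M. f n * g n) \<le> (\<Sum>n=1..M. \<phi> n * g n)"
proof -
  define H where "H m = (\<Sum>n=1..m. \<phi> n - f n)" for m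
  have H: "H m \<ge> 0" if "m \<le> M" for m
    using maj[OF that] by (simp add: H_def sum_subtractf)
  have "m \<le> M \<Longrightarrow> H m * g m \<le> (\<Sum>n=1..m. (\<phi> n - f n) * g n)" for m
  proof (induction m)
    case (Suc m)
    have "H (Suc m) * g (Suc m) = H m * g (Suc m) + (\<phi> (Suc m) - f (Suc m)) * g (Suc m)"
      by (simp add: H_def algebra_simps)
    also have "H m * g (Suc m) \<le> H m * g m"
      using H[of m] Suc.prems dec[of m] by (cases "m = 0") (auto simp: H_def intro: mult_left_mono)
    finally show ?case using Suc by simp
  qed (simp add: H_def)
  from this[of M] have "0 \<le> (\<Sum>n=1..M. (\<phi> n - f n) * g n)"
    using H[of M] nonneg[of M] by (smt (verit) mult_nonneg_nonneg order_refl)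
  thus ?thesis by (simp add: sum_subtractf left_diff_distrib)
qed

lemma powr_difference_ge:
  fixes c :: real
  assumes "0 < c" "c < 1" "0 < x"
  shows "c * (x + 1) powr (c - 1) \<le> (x + 1) powr c - x powr c"
proof -
  have "\<exists>z. x < z \<and> z < x + 1 \<and> (x + 1) powr c - x powr c = (x + 1 - x) * (c * z powr (c - 1))"
    by (rule MVT2) (use assms in \<open>auto intro!: derivative_eq_intros simp: powr_diff field_simps\<close>)
  then obtain z where z: "x < z" "z < x + 1" "(x + 1) powr c - x powr c = c * z powr (c - 1)" by auto
  have "(x + 1) powr (c - 1) \<le> z powr (c - 1)"
    using z assms by (intro powr_mono2') auto
  thus ?thesis using z assms by simp
qed

lemma sum_powr_le:
  assumes "0 < a" "a < 1"
  shows "(\<Sum>n=1..M. real n powr (- a)) \<le> real M powr (1 - a) / (1 - a)"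
proof (induction M)
  case (Suc M)
  show ?case
  proof (cases "M = 0")
    case True thus ?thesis using assms by (simp add: field_simps)
  next
    case False
    have "(1 - a) * (real M + 1) powr ((1 - a) - 1) \<le> (real M + 1) powr (1 - a) - real M powr (1 - a)"
      by (rule powr_difference_ge) (use assms False in auto)
    hence "real (Suc M) powr (- a) \<le> (real (Suc M) powr (1 - a) - real M powr (1 - a)) / (1 - a)"
      using assms by (simp add: pos_le_divide_eq mult.commute add.commute)
    thus ?thesis using Suc.IH by (simp add: diff_divide_distrib)
  qed
qed (use assms in simp)

text \<open>The bound has the size of the zeta function at 1 + d; the later factors
  \<open>1 + x\<close> and \<open>1 + 4 / r\<close> originate here.\<close>

lemma sum_powr_minus_one_minus_le:
  assumes "0 < d"
  shows "(\<Sum>n=1..M. real n powr (- 1 - d)) \<le> 1 + 1 / d"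
proof -
  have "M \<ge> 1 \<Longrightarrow> (\<Sum>n=1..M. real n powr (- 1 - d)) \<le> 1 + (1 - real M powr (- d)) / d"
  proof (induction M rule: nat_induct_at_least)
    case (Suc M)
    have "\<exists>z. real M < z \<and> z < real M + 1 \<and> (real M + 1) powr (- d) - real M powr (- d) = (real M + 1 - real M) * ((- d) * z powr (- d - 1))"
      by (rule MVT2) (use Suc.hyps in \<open>auto intro!: derivative_eq_intros simp: powr_diff field_simps\<close>)
    then obtain z where z: "real M < z" "z < real M + 1" "(real M + 1) powr (- d) - real M powr (- d) = (- d) * z powr (- d - 1)" by auto
    have "(real M + 1) powr (- d - 1) \<le> z powr (- d - 1)"
      using z Suc.hyps assms by (intro powr_mono2') auto
    moreover have "- d - 1 = - 1 - d" by simp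
    ultimately have le: "(real M + 1) powr (- 1 - d) \<le> z powr (- d - 1)" by metis
    have "d * (real M + 1) powr (- 1 - d) \<le> real M powr (- d) - (real M + 1) powr (- d)"
      using mult_left_mono[OF le less_imp_le[OF assms]] z(3) by linarith
    hence "real (Suc M) powr (- 1 - d) \<le> (real M powr (- d) - real (Suc M) powr (- d)) / d"
      using assms by (simp add: pos_le_divide_eq mult.commute add.commute)
    thus ?case using Suc.IH by (simp add: diff_divide_distrib)
  qed simp
  moreover have "(1 - real M powr (- d)) / d \<le> 1 / d" using assms by (simp add: divide_right_mono)
  ultimately show ?thesis using assms by (cases "M \<ge> 1") (force, simp)
qed

lemma sum_inverse_squares_tail:
  assumes "1 \<le> A" "A \<le> B"
  shows "(\<Sum>n\<in>{A<..B}. 1 / (real n)\<^sup>2) \<le> 1 / real A - 1 / real B"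
  using assms(2)
proof (induction B rule: dec_induct)
  case (step B)
  have "{A<..Suc B} = insert (Suc B) {A<..B}" using step.hyps by auto
  hence "(\<Sum>n\<in>{A<..Suc B}. 1 / (real n)\<^sup>2) \<le> 1 / (real (Suc B))\<^sup>2 + (1 / real A - 1 / real B)"
    using step.IH by simp
  moreover have "1 / (real (Suc B))\<^sup>2 \<le> 1 / (real (Suc B) * real B)"
    using step.hyps assms by (intro divide_left_mono) (auto simp: power2_eq_square)
  moreover have "1 / (real (Suc B) * real B) = 1 / real B - 1 / real (Suc B)"
    using step.hyps assms by (simp add: field_simps)
  ultimately show ?case by linarith
qed simp

lemma bij_betw_prime_power_part:
  assumes "prime (p::nat)"
  shows "bij_betw (\<lambda>(m, r). m * p ^ r) ({m. \<not> p dvd m} \<times> UNIV) (- {0})"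
proof (rule bij_betwI')
  fix x y assume "x \<in> {m. \<not> p dvd m} \<times> (UNIV :: nat set)" "y \<in> {m. \<not> p dvd m} \<times> (UNIV :: nat set)"
  then obtain m r n s where x: "x = (m, r)" "\<not> p dvd m" and y: "y = (n, s)" "\<not> p dvd n" by auto
  have mult: "multiplicity p (k * p ^ t) = t" if "\<not> p dvd k" for k t
  proof -
    have "k \<noteq> 0" using that by (metis dvd_0_right)
    have "multiplicity p (k * p ^ t) = multiplicity p k + t"
      using assms \<open>k \<noteq> 0\<close> by (subst prime_elem_multiplicity_mult_distrib)
        (auto simp: prime_elem_multiplicity_power_distrib prime_gt_0_nat)
    thus ?thesis using that by (simp add: not_dvd_imp_multiplicity_0)
  qed
  show "((case x of (m, r) \<Rightarrow> m * p ^ r) = (case y of (m, r) \<Rightarrow> m * p ^ r)) = (x = y)"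
  proof
    assume "(case x of (m, r) \<Rightarrow> m * p ^ r) = (case y of (m, r) \<Rightarrow> m * p ^ r)"
    hence eq: "m * p ^ r = n * p ^ s" using x y by simp
    hence "r = s" using mult[OF x(2), of r] mult[OF y(2), of s] by simp
    moreover have "m = n" using eq \<open>r = s\<close> assms by (simp add: prime_gt_0_nat)
    ultimately show "x = y" using x y by simp
  qed simp
next
  fix x assume "x \<in> {m. \<not> p dvd m} \<times> (UNIV :: nat set)"
  thus "(case x of (m, r) \<Rightarrow> m * p ^ r) \<in> - {0}"
    using assms by (auto simp: prime_gt_0_nat intro!: Nat.gr0I)
next
  fix n :: nat assume "n \<in> - {0}"
  hence "n \<noteq> 0" by simp
  then obtain m where m: "n = p ^ multiplicity p n * m" "\<not> p dvd m"
    using multiplicity_decompose'[of n p] assms by (metis not_prime_unit)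
  thus "\<exists>x\<in>{m. \<not> p dvd m} \<times> UNIV. n = (case x of (m, r) \<Rightarrow> m * p ^ r)"
    by (intro bexI[of _ "(m, multiplicity p n)"]) (auto simp: mult.commute)
qed

text \<open>Each n > 0 is uniquely m p^r with p not dividing m, and the weight depends only on
  whether r vanishes. The case c = 1 matters as well: it expresses the sum over m through the full
  sum.\<close>

lemma infsum_prime_split:
  fixes f :: "nat \<Rightarrow> complex"
  assumes sm: "(\<lambda>n. norm (f n)) summable_on UNIV" and f0: "f 0 = 0" and f1: "f 1 = 1"
    and mult: "\<And>m n. coprime m n \<Longrightarrow> f (m * n) = f m * f n" and p: "prime p"
    and c: "norm c \<le> 1"
  shows "infsum (\<lambda>n. f n * (if p dvd n then c else 1)) UNIV =
     infsum f {m. \<not> p dvd m} * (1 + c * (infsum (\<lambda>r. f (p ^ r)) UNIV - 1))"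
proof -
  define k where "k r = f (p ^ r) * (if r = 0 then 1 else c)" for r :: nat
  let ?g = "\<lambda>n. f n * (if p dvd n then c else 1)"
  let ?A = "{m. \<not> p dvd m}"
  have inj: "inj (\<lambda>r. p ^ r)" using p prime_gt_1_nat by (auto simp: inj_def)
  have smA: "(\<lambda>n. norm (f n)) summable_on ?A"
    using sm by (rule summable_on_subset_banach) auto
  have smp: "(\<lambda>r. norm (f (p ^ r))) summable_on UNIV"
    using summable_on_reindex[OF inj, of "\<lambda>n. norm (f n)"] summable_on_subset_banach[OF sm, of "range (\<lambda>r. p ^ r)"]
    by (simp add: o_def)
  have smk: "(\<lambda>n. norm (k n)) summable_on UNIV"
  proof (rule Infinite_Sum.abs_summable_on_comparison_test[OF smp])
    fix r show "norm (k r) \<le> norm (f (p ^ r))"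
      unfolding k_def norm_mult using c by (simp add: mult_left_le)
  qed
  have gprod: "?g (m * p ^ r) = f m * k r" if "\<not> p dvd m" for m r
  proof -
    have "coprime m (p ^ r)" using that p by (metis coprime_commute coprime_power_left_iff prime_imp_coprime)
    moreover have "p dvd m * p ^ r \<longleftrightarrow> r \<noteq> 0" using that p by (cases r) (auto dest: not_prime_unit)
    ultimately show ?thesis by (simp add: mult k_def)
  qed
  have "infsum ?g UNIV = infsum ?g (- {0})"
    by (rule infsum_cong_neutral) (use f0 in auto)
  also have "\<dots> = infsum (\<lambda>x. ?g (case x of (m, r) \<Rightarrow> m * p ^ r)) (?A \<times> UNIV)"
    by (rule infsum_reindex_bij_betw[OF bij_betw_prime_power_part[OF p], symmetric])
  also have "\<dots> = infsum (\<lambda>(m, r). f m * k r) (?A \<times> UNIV)"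
  proof (rule infsum_cong)
    fix x assume "x \<in> ?A \<times> (UNIV :: nat set)"
    then obtain m r where "x = (m, r)" "\<not> p dvd m" by auto
    thus "?g (case x of (m, r) \<Rightarrow> m * p ^ r) = (case x of (m, r) \<Rightarrow> f m * k r)"
      using gprod by (simp only: prod.case)
  qed
  also have "\<dots> = infsum (\<lambda>m. infsum (\<lambda>r. f m * k r) UNIV) ?A"
  proof (rule infsum_Sigma'_banach[symmetric])
    show "(\<lambda>(m, r). f m * k r) summable_on ?A \<times> UNIV"
    proof (rule abs_summable_summable, subst Infinite_Sum.abs_summable_on_Sigma_iff, intro conjI ballI)
      fix m assume "m \<in> ?A"
      show "(\<lambda>r. norm (case (m, r) of (m, r) \<Rightarrow> f m * k r)) summable_on UNIV"
        unfolding prod.case norm_mult by (rule summable_on_cmult_right[OF smk])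
    next
      have "infsum (\<lambda>r. norm (case (m, r) of (m, r) \<Rightarrow> f m * k r)) UNIV = norm (f m) * infsum (\<lambda>r. norm (k r)) UNIV" for m
        unfolding prod.case norm_mult by (rule infsum_cmult_right) (use smk in auto)
      moreover have "infsum (\<lambda>r. norm (k r)) UNIV \<ge> 0" by (rule infsum_nonneg) auto
      ultimately show "(\<lambda>m. norm (infsum (\<lambda>r. norm (case (m, r) of (m, r) \<Rightarrow> f m * k r)) UNIV)) summable_on ?A"
        using summable_on_cmult_left[OF smA, of "infsum (\<lambda>r. norm (k r)) UNIV"] by (simp add: abs_mult)
    qed
  qed
  also have "\<dots> = infsum (\<lambda>m. f m * infsum k UNIV) ?A"
    by (intro infsum_cong infsum_cmult_right) (use smk abs_summable_summable in auto)
  also have "\<dots> = infsum f ?A * infsum k UNIV"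
    by (intro infsum_cmult_left) (use smA abs_summable_summable in auto)
  also have "infsum k UNIV = 1 + c * (infsum (\<lambda>r. f (p ^ r)) UNIV - 1)"
  proof -
    have s: "(\<lambda>r. f (p ^ r)) summable_on UNIV" using smp by (rule abs_summable_summable)
    have s': "(\<lambda>r. f (p ^ r)) summable_on - {0}" by (rule summable_on_subset_banach[OF s]) auto
    have s'': "k summable_on - {0}" by (rule summable_on_subset_banach[OF abs_summable_summable[OF smk]]) auto
    have U: "(UNIV :: nat set) = insert 0 (- {0})" by auto
    have "infsum k UNIV = k 0 + infsum k (- {0})"
      by (subst U, subst infsum_insert) (use s'' in auto)
    also have "infsum k (- {0}) = infsum (\<lambda>r. c * f (p ^ r)) (- {0})"
      by (rule infsum_cong) (auto simp: k_def)
    also have "\<dots> = c * infsum (\<lambda>r. f (p ^ r)) (- {0})"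
      by (rule infsum_cmult_right) (use s' in auto)
    also have "infsum (\<lambda>r. f (p ^ r)) (- {0}) = infsum (\<lambda>r. f (p ^ r)) UNIV - f (p ^ 0)"
      by (subst U, subst infsum_insert) (use s' in auto)
    finally show ?thesis by (simp add: k_def[of 0] f1[unfolded One_nat_def])
  qed
  finally show ?thesis .
qed

section \<open>Multiplicative weights attached to sets of primes\<close>

definition prime_weight :: "(nat \<Rightarrow> real) \<Rightarrow> nat set \<Rightarrow> nat \<Rightarrow> real" where
  "prime_weight v P n = (\<Prod>p | p \<in> P \<and> p dvd n. 1 - v p)"

lemma prime_weight_bounds:
  assumes "\<And>p. 0 \<le> v p \<and> v p \<le> 1"
  shows "0 \<le> prime_weight v P n" "prime_weight v P n \<le> 1"
  unfolding prime_weight_def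
  using assms by (auto intro!: prod_nonneg prod_le_1)

lemma prime_weight_insert:
  assumes "finite P" "p \<notin> P"
  shows "prime_weight v (insert p P) n = prime_weight v P n * (if p dvd n then 1 - v p else 1)"
proof (cases "p dvd n")
  case True
  hence "{x \<in> insert p P. x dvd n} = insert p {x \<in> P. x dvd n}" by auto
  thus ?thesis using assms True by (simp add: prime_weight_def mult.commute)
next
  case False
  hence "{x \<in> insert p P. x dvd n} = {x \<in> P. x dvd n}" by auto
  thus ?thesis using False by (simp add: prime_weight_def)
qed

lemma prime_weight_mult:
  assumes "finite P" "\<And>p. p \<in> P \<Longrightarrow> prime p" "coprime m n"
  shows "prime_weight v P (m * n) = prime_weight v P m * prime_weight v P n"
proof -
  have "{p \<in> P. p dvd m * n} = {p \<in> P. p dvd m} \<union> {p \<in> P. p dvd n}"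
    using assms(2) by (auto simp: prime_dvd_mult_iff)
  moreover have "{p \<in> P. p dvd m} \<inter> {p \<in> P. p dvd n} = {}"
    using assms(2,3) coprime_common_divisor not_prime_unit by blast
  ultimately show ?thesis
    unfolding prime_weight_def using assms(1) by (simp add: prod.union_disjoint)
qed

text \<open>At p the weight turns the local factor E into 1 + (1 - v)(E - 1) = E (1 - v (1 - 1/E)).
  The primes are inserted one at a time.\<close>

lemma infsum_prime_weight:
  fixes f :: "nat \<Rightarrow> complex"
  assumes sm: "(\<lambda>n. norm (f n)) summable_on UNIV" and f0: "f 0 = 0" and f1: "f 1 = 1"
    and mult: "\<And>m n. coprime m n \<Longrightarrow> f (m * n) = f m * f n"
    and v: "\<And>p. 0 \<le> v p \<and> v p \<le> 1"
    and P: "finite P" "\<And>p. p \<in> P \<Longrightarrow> prime p"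
    and nz: "\<And>p. p \<in> P \<Longrightarrow> infsum (\<lambda>r. f (p ^ r)) UNIV \<noteq> 0"
  shows "infsum (\<lambda>n. f n * of_real (prime_weight v P n)) UNIV =
     infsum f UNIV * (\<Prod>p\<in>P. 1 - of_real (v p) * (1 - 1 / infsum (\<lambda>r. f (p ^ r)) UNIV))"
  using P nz
proof (induction P rule: finite_induct)
  case empty thus ?case by (simp add: prime_weight_def)
next
  case (insert p P)
  define g where "g n = f n * of_real (prime_weight v P n)" for n
  define E where "E = infsum (\<lambda>r. f (p ^ r)) UNIV"
  have pp: "prime p" and E0: "E \<noteq> 0" using insert.prems by (auto simp: E_def)
  have g_sm: "(\<lambda>n. norm (g n)) summable_on UNIV"
  proof (rule Infinite_Sum.abs_summable_on_comparison_test[OF sm])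
    fix n show "norm (g n) \<le> norm (f n)"
      using prime_weight_bounds[OF v, where P = P and n = n] by (simp add: g_def norm_mult mult_left_le)
  qed
  have g0: "g 0 = 0" by (simp add: g_def f0)
  have "\<not> q dvd 1" if "q \<in> P" for q using insert.prems(1)[of q] that not_prime_unit by blast
  hence "{q \<in> P. q dvd 1} = {}" by blast
  hence g1: "g 1 = 1" by (simp only: g_def prime_weight_def f1 prod.empty of_real_1 mult_1_right)
  have gm: "g (m * n) = g m * g n" if "coprime m n" for m n
    using that insert.hyps insert.prems by (simp add: g_def mult prime_weight_mult)
  have Eg: "infsum (\<lambda>r. g (p ^ r)) UNIV = E"
    unfolding E_def
  proof (rule infsum_cong)
    fix r
    have "{q \<in> P. q dvd p ^ r} = {}"
    proof -
      have False if "q \<in> P" "q dvd p ^ r" for q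
      proof -
        have "prime q" using that insert.prems by blast
        hence "q dvd p" using that(2) prime_dvd_power by blast
        hence "q = p" using pp \<open>prime q\<close> primes_dvd_imp_eq by blast
        thus False using that(1) insert.hyps by blast
      qed
      thus ?thesis by blast
    qed
    thus "g (p ^ r) = f (p ^ r)" by (simp only: g_def prime_weight_def prod.empty of_real_1 mult_1_right)
  qed
  have split: "infsum (\<lambda>n. g n * (if p dvd n then c else 1)) UNIV =
     infsum g {m. \<not> p dvd m} * (1 + c * (E - 1))" if "norm c \<le> 1" for c
    using infsum_prime_split[OF g_sm g0 g1 gm pp that] by (simp add: Eg)
  have "infsum g UNIV = infsum g {m. \<not> p dvd m} * E"
    using split[of 1] by simp
  hence A: "infsum g {m. \<not> p dvd m} = infsum g UNIV / E" using E0 by simp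
  have v': "norm (1 - of_real (v p) :: complex) \<le> 1"
  proof -
    have "(1 - of_real (v p) :: complex) = of_real (1 - v p)" by simp
    thus ?thesis using v[of p] by (simp only: norm_of_real) linarith
  qed
  have "infsum (\<lambda>n. f n * of_real (prime_weight v (insert p P) n)) UNIV =
      infsum (\<lambda>n. g n * (if p dvd n then 1 - of_real (v p) else 1)) UNIV"
    using insert.hyps by (intro infsum_cong) (simp add: prime_weight_insert g_def)
  also have "\<dots> = infsum g UNIV * (1 - of_real (v p) * (1 - 1 / E))"
    unfolding split[OF v'] A using E0 by (simp add: field_simps)
  also have "infsum g UNIV = infsum f UNIV * (\<Prod>p\<in>P. 1 - of_real (v p) * (1 - 1 / infsum (\<lambda>r. f (p ^ r)) UNIV))"
    unfolding g_def using insert by auto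
  finally show ?case using insert.hyps by (simp add: E_def mult_ac)
qed

text \<open>For each n > 0 the weight is constant once N \<ge> n, and it never exceeds 1, so
  dominated convergence in the form of Tannery's theorem applies.\<close>

lemma prime_weight_limit:
  fixes f :: "nat \<Rightarrow> complex"
  assumes sm: "(\<lambda>n. norm (f n)) summable_on UNIV" and f0: "f 0 = 0"
    and v: "\<And>p. 0 \<le> v p \<and> v p \<le> 1"
  shows "(\<lambda>N. infsum (\<lambda>n. f n * of_real (prime_weight v {p. prime p \<and> p \<le> N} n)) UNIV)
    \<longlonglongrightarrow> infsum (\<lambda>n. f n * of_real (prime_weight v {p. prime p} n)) UNIV"
proof -
  have suminf: "infsum (\<lambda>n. f n * of_real (prime_weight v P n)) UNIV = (\<Sum>n. f n * of_real (prime_weight v P n))" for P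
  proof -
    have "(\<lambda>n. norm (f n * of_real (prime_weight v P n))) summable_on UNIV"
    proof (rule Infinite_Sum.abs_summable_on_comparison_test[OF sm])
      fix n show "norm (f n * of_real (prime_weight v P n)) \<le> norm (f n)"
        using prime_weight_bounds[OF v, where P = P and n = n] by (simp add: norm_mult mult_left_le)
    qed
    hence "((\<lambda>n. f n * of_real (prime_weight v P n)) has_sum infsum (\<lambda>n. f n * of_real (prime_weight v P n)) UNIV) UNIV"
      by (rule has_sum_infsum[OF abs_summable_summable])
    from has_sum_imp_sums[OF this] show ?thesis by (simp add: sums_iff)
  qed
  have "summable (\<lambda>n. norm (f n))"
    using sm by (rule summable_on_imp_summable)
  show ?thesis
    unfolding suminf
  proof (rule conjunct2[OF conjunct2[OF tannerys_theorem]])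
    fix n
    show "(\<lambda>N. f n * of_real (prime_weight v {p. prime p \<and> p \<le> N} n)) \<longlonglongrightarrow> f n * of_real (prime_weight v {p. prime p} n)"
    proof (cases "n = 0")
      case False
      have eq: "{p \<in> {p. prime p \<and> p \<le> N}. p dvd n} = {p \<in> {p. prime p}. p dvd n}" if "N \<ge> n" for N
        using that False by (auto dest: dvd_imp_le)
      have "eventually (\<lambda>N. f n * of_real (prime_weight v {p. prime p \<and> p \<le> N} n) = f n * of_real (prime_weight v {p. prime p} n)) sequentially"
        using eventually_ge_at_top[of n] by eventually_elim (simp only: prime_weight_def eq)
      thus ?thesis by (rule tendsto_eventually)
    qed (simp add: f0)
    show "\<forall>\<^sub>F (n, N) in at_top \<times>\<^sub>F sequentially. norm (f n * of_real (prime_weight v {p. prime p \<and> p \<le> N} n)) \<le> norm (f n)"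
    proof (rule always_eventually, clarify)
      fix n N show "norm (f n * of_real (prime_weight v {p. prime p \<and> p \<le> N} n)) \<le> norm (f n)"
        using prime_weight_bounds[OF v, where P = "{p. prime p \<and> p \<le> N}" and n = n] by (simp add: norm_mult mult_left_le)
    qed
  qed (fact | simp)+
qed

section \<open>Local factors and finite differences\<close>

lemma power_le_fact_exp: "x ^ k \<le> fact k * exp x" if "x \<ge> 0" for x :: real
proof -
  have "(\<Sum>n\<in>{k}. inverse (fact n) *\<^sub>R x ^ n) \<le> (\<Sum>n. inverse (fact n) *\<^sub>R x ^ n)"
    using summable_exp_generic[of x] that by (intro sum_le_suminf) auto
  hence "x ^ k / fact k \<le> exp x" by (simp add: exp_def field_simps)
  thus ?thesis by (simp add: field_simps)
qed

lemma summable_power_over_two: "summable (\<lambda>n. real n ^ k * (1 / 2) ^ n)"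
proof -
  \<comment> \<open>With this rate the product with the powers of 1/2 is geometric of ratio
    2/3.\<close>
  define c where "c = ln (4 / 3 :: real)"
  have c: "c > 0" by (simp add: c_def)
  have le: "real n ^ k * (1 / 2) ^ n \<le> fact k / c ^ k * (2 / 3) ^ n" for n
  proof -
    have "(c * real n) ^ k \<le> fact k * exp (c * real n)" using c by (intro power_le_fact_exp) simp
    also have "exp (c * real n) = (4 / 3) ^ n"
      unfolding c_def by (metis exp_ln exp_of_nat2_mult zero_less_divide_iff zero_less_numeral)
    finally have "real n ^ k \<le> fact k / c ^ k * (4 / 3) ^ n"
      using c by (simp add: power_mult_distrib field_simps)
    hence "real n ^ k * (1 / 2) ^ n \<le> fact k / c ^ k * (4 / 3) ^ n * (1 / 2) ^ n" by (intro mult_right_mono) auto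
    also have "\<dots> = fact k / c ^ k * (2 / 3) ^ n" by (simp add: power_mult_distrib[symmetric])
    finally show ?thesis .
  qed
  have "summable (\<lambda>n. fact k / c ^ k * (2 / 3 :: real) ^ n)"
    by (rule summable_mult[OF summable_geometric]) simp
  thus ?thesis
  proof (rule summable_comparison_test'[where N = 0])
    fix n show "norm (real n ^ k * (1 / 2) ^ n) \<le> fact k / c ^ k * (2 / 3) ^ n"
      by (subst real_norm_def, subst abs_of_nonneg) (rule le | simp)+
  qed
qed

text \<open>The 4 comes from rewriting \<open>(1 / 2) ^ (n - 2)\<close> as
  \<open>4 * (1 / 2) ^ n\<close> in the tail of a logarithm series.\<close>

definition series_const :: "nat \<Rightarrow> real" where
  "series_const k = 4 * (\<Sum>n. real n ^ k * (1 / 2) ^ n)"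

lemma series_const_nonneg: "series_const k \<ge> 0"
  unfolding series_const_def by (intro mult_nonneg_nonneg suminf_nonneg summable_power_over_two) auto

text \<open>Taking the \<open>k\<close>-th difference with step \<open>h\<close> multiplies \<open>p powr (- s)\<close> by this factor.\<close>
definition prime_cutoff :: "real \<Rightarrow> nat \<Rightarrow> nat \<Rightarrow> real" where
  "prime_cutoff h k p = (1 - real p powr (- h)) ^ k"

lemma prime_cutoff_bounds:
  assumes "h \<ge> 0"
  shows "0 \<le> prime_cutoff h k p" "prime_cutoff h k p \<le> 1"
proof -
  have "real p powr (- h) \<le> 1"
    using assms powr_mono[of "- h" 0 "real p"] by (cases "p = 0") auto
  thus "0 \<le> prime_cutoff h k p" "prime_cutoff h k p \<le> 1"
    by (auto simp: prime_cutoff_def intro!: power_le_one)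
qed

lemma prime_cutoff_le:
  assumes "h \<ge> 0" "p \<ge> 1"
  shows "prime_cutoff h k p \<le> (h * ln (real p)) ^ k"
  unfolding prime_cutoff_def
proof (rule power_mono)
  have "real p powr (- h) = exp (- (h * ln (real p)))" using assms by (simp add: powr_def)
  moreover have "1 + - (h * ln (real p)) \<le> exp (- (h * ln (real p)))" by (rule exp_ge_add_one_self)
  ultimately show "1 - real p powr (- h) \<le> h * ln (real p)" by linarith
  show "0 \<le> 1 - real p powr (- h)"
    using assms powr_mono[of "- h" 0 "real p"] by auto
qed

text \<open>The k-th power of log p is traded for the square root of p and a factorial, which leaves
  the exponent -3/2 and the constant 1 + 2. What matters is the surviving \<open>h ^ k\<close>:
  terms of second order in 1/p contribute no more than that.\<close>

lemma sum_prime_cutoff_le: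
  assumes "h \<ge> 0"
  shows "(\<Sum>p | prime p \<and> p \<le> N. prime_cutoff h k p / (real p)\<^sup>2) \<le> 3 * fact k * (2 * h) ^ k"
proof -
  have "(\<Sum>p | prime p \<and> p \<le> N. prime_cutoff h k p / (real p)\<^sup>2) \<le> (\<Sum>p=1..N. prime_cutoff h k p / (real p)\<^sup>2)"
    by (intro sum_mono2) (auto simp: prime_gt_0_nat Suc_leI prime_cutoff_bounds assms)
  also have "\<dots> \<le> (\<Sum>p=1..N. fact k * (2 * h) ^ k * real p powr (- 1 - 1 / 2))"
  proof (rule sum_mono)
    fix p assume "p \<in> {1..N}"
    hence p: "p \<ge> 1" by simp
    have "prime_cutoff h k p \<le> (h * ln (real p)) ^ k" by (rule prime_cutoff_le[OF assms p])
    also have "\<dots> = (2 * h) ^ k * (ln (real p) / 2) ^ k"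
      by (subst power_mult_distrib[symmetric]) simp
    also have "\<dots> \<le> (2 * h) ^ k * (fact k * exp (ln (real p) / 2))"
      using p assms by (intro mult_left_mono power_le_fact_exp) auto
    also have "exp (ln (real p) / 2) = real p powr (1 / 2)" using p by (simp add: powr_def)
    finally have "prime_cutoff h k p / (real p)\<^sup>2 \<le> fact k * (2 * h) ^ k * (real p powr (1 / 2) / real p powr 2)"
      using p by (simp add: divide_right_mono mult_ac)
    also have "real p powr (1 / 2) / real p powr 2 = real p powr (- 1 - 1 / 2)"
      by (subst powr_diff[symmetric]) simp
    finally show "prime_cutoff h k p / (real p)\<^sup>2 \<le> fact k * (2 * h) ^ k * real p powr (- 1 - 1 / 2)" .
  qed
  also have "\<dots> = fact k * (2 * h) ^ k * (\<Sum>p=1..N. real p powr (- 1 - 1 / 2))" by (simp add: sum_distrib_left)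
  also have "\<dots> \<le> fact k * (2 * h) ^ k * (1 + 1 / (1 / 2))"
    using assms by (intro mult_left_mono sum_powr_minus_one_minus_le) auto
  finally show ?thesis by (simp add: mult_ac)
qed

text \<open>Replacing s by s + h multiplies p^(-ns) by p^(-nh), so each difference brings in one
  factor 1 - p^(-nh).\<close>

lemma fin_diff_power_series:
  fixes c :: "nat \<Rightarrow> complex" and p :: nat
  assumes p: "p \<ge> 1" and h: "h \<ge> 0"
    and f: "\<And>s. Re s > 0 \<Longrightarrow> (\<lambda>n. c n * (1 / of_nat p powr s) ^ n) sums f s" and s: "Re s > 0"
  shows "(\<lambda>n. c n * of_real ((1 - (real p powr (- h)) ^ n) ^ k) * (1 / of_nat p powr s) ^ n)
    sums fin_diff (of_real h) k f s"
  using f s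
proof (induction k arbitrary: c f)
  case (Suc k)
  have shift: "1 / of_nat p powr (w + of_real h) = (1 / of_nat p powr w) * of_real (real p powr (- h))" for w :: complex
  proof -
    have "complex_of_real (real p powr (- h)) = of_nat p powr (- of_real h)"
      using p powr_of_real[of "real p" "- h"] by simp
    thus ?thesis using p by (simp add: powr_add powr_minus field_simps)
  qed
  have "(\<lambda>n. (c n * of_real (1 - (real p powr (- h)) ^ n)) * of_real ((1 - (real p powr (- h)) ^ n) ^ k) * (1 / of_nat p powr s) ^ n)
    sums fin_diff (of_real h) k (\<lambda>w. f w - f (w + of_real h)) s"
  proof (rule Suc.IH[OF _ Suc.prems(2)])
    fix w :: complex assume w: "Re w > 0"
    have "(\<lambda>n. c n * (1 / of_nat p powr w) ^ n - c n * (1 / of_nat p powr (w + of_real h)) ^ n) sums (f w - f (w + of_real h))"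
      by (intro sums_diff Suc.prems) (use w h in auto)
    thus "(\<lambda>n. c n * of_real (1 - (real p powr (- h)) ^ n) * (1 / of_nat p powr w) ^ n) sums (f w - f (w + of_real h))"
      unfolding shift power_mult_distrib by (simp add: algebra_simps)
  qed
  thus ?case by (simp add: mult_ac)
qed auto

lemma neg_Ln_series:
  assumes "norm x < 1"
  shows "(\<lambda>n. 1 / of_nat n * x ^ n) sums (- Ln (1 - x))"
proof -
  have "(\<lambda>n. (-1) ^ Suc n / of_nat n * (- x) ^ n) sums ln (1 + - x)"
    by (rule Ln_series) (use assms in simp)
  hence "(\<lambda>n. - ((-1) ^ Suc n / of_nat n * (- x) ^ n)) sums (- ln (1 + - x))" by (rule sums_minus)
  moreover have "- ((-1) ^ Suc n / of_nat n * (- x) ^ n) = 1 / of_nat n * x ^ n" for n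
    by (cases "even n") auto
  ultimately have "(\<lambda>n. 1 / of_nat n * x ^ n) sums (- ln (1 + - x))" by (simp only:)
  thus ?thesis by simp
qed

lemma norm_inverse_prime_powr:
  "p \<ge> 1 \<Longrightarrow> norm (1 / of_nat p powr s :: complex) = real p powr (- Re s)"
  by (simp add: norm_divide norm_powr_real_powr powr_minus field_simps)

text \<open>The linear term of -log(1 - b p^(-s)) acquires exactly the multiplier v(p). For n \<ge>
  2 the inequality 1 - y^n \<le> n (1 - y) extracts the same v(p) at the price n^k, while p^(-n)
  leaves p^(-2) and a geometric factor.\<close>

lemma local_log_diff:
  fixes b s :: complex and p :: nat
  assumes p: "p \<ge> 2" and h: "h \<ge> 0" and b: "norm b \<le> 1" and s: "Re s \<ge> 1"
  shows "norm (fin_diff (of_real h) k (\<lambda>s. - Ln (1 - b * (1 / of_nat p powr s))) s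
           - of_real (prime_cutoff h k p) * (b * (1 / of_nat p powr s)))
         \<le> series_const k * (prime_cutoff h k p / (real p)\<^sup>2)"
proof -
  define v where "v = prime_cutoff h k p"
  define y where "y = real p powr (- h)"
  define P where "P = (1 / of_nat p powr s :: complex)"
  have v0: "v \<ge> 0" using prime_cutoff_bounds[OF h] by (simp add: v_def)
  have y: "0 \<le> y" "y \<le> 1" using h p powr_mono[of "- h" 0 "real p"] by (auto simp: y_def)
  have P: "norm P \<le> 1 / real p"
  proof -
    have "norm P = real p powr (- Re s)" unfolding P_def using p by (intro norm_inverse_prime_powr) simp
    also have "\<dots> \<le> real p powr (- 1)" using p s by (intro powr_mono) auto
    finally show ?thesis using p by (simp add: powr_minus field_simps)
  qed
  let ?t = "\<lambda>n. (b ^ n / of_nat n) * of_real ((1 - y ^ n) ^ k) * P ^ n"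
  have sums: "?t sums fin_diff (of_real h) k (\<lambda>s. - Ln (1 - b * (1 / of_nat p powr s))) s"
    unfolding y_def P_def
  proof (rule fin_diff_power_series)
    fix w :: complex assume w: "Re w > 0"
    define Q where "Q = (1 / of_nat p powr w :: complex)"
    have "norm Q < 1" unfolding Q_def
      using p w norm_inverse_prime_powr[of p w] powr_less_mono[of "- Re w" 0 "real p"] by simp
    hence "norm (b * Q) < 1"
      unfolding norm_mult using b by (metis le_less_trans mult_left_le_one_le norm_ge_zero)
    from neg_Ln_series[OF this] show "(\<lambda>n. b ^ n / of_nat n * (1 / of_nat p powr w) ^ n) sums - Ln (1 - b * (1 / of_nat p powr w))"
      unfolding Q_def[symmetric] by (simp add: power_mult_distrib mult.commute)
  qed (use p h s in auto)
  have t1: "?t (Suc 0) = of_real v * (b * P)" by (simp add: v_def prime_cutoff_def y_def)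
  have sums2: "(\<lambda>n. ?t (n + 2)) sums (fin_diff (of_real h) k (\<lambda>s. - Ln (1 - b * (1 / of_nat p powr s))) s - of_real v * (b * P))"
  proof -
    \<comment> \<open>The term n = 0 vanishes by the convention \<open>1 / 0 = 0\<close>.\<close>
    have "(\<Sum>i<2. ?t i) = of_real v * (b * P)" using t1 by (simp add: numeral_2_eq_2)
    with sums_split_initial_segment[OF sums, of 2] show ?thesis by (simp only:)
  qed
  define g where "g n = 4 * (v / (real p)\<^sup>2) * (real n ^ k * (1 / 2) ^ n)" for n
  have g: "g sums (series_const k * (v / (real p)\<^sup>2))"
    using sums_mult[OF summable_sums[OF summable_power_over_two], of "4 * (v / (real p)\<^sup>2)" k]
    unfolding g_def[abs_def] series_const_def by (simp add: mult_ac)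
  have bound: "norm (?t n) \<le> g n" if n: "n \<ge> 2" for n
  proof -
    have "1 - y ^ n \<le> real n * (1 - y)"
      using Bernoulli_inequality[of "y - 1" n] y by (simp add: algebra_simps)
    moreover have "y ^ n \<le> 1" using y by (simp add: power_le_one)
    ultimately have "(1 - y ^ n) ^ k \<le> (real n * (1 - y)) ^ k" by (intro power_mono) auto
    hence 1: "norm (of_real ((1 - y ^ n) ^ k) :: complex) \<le> real n ^ k * v"
    proof -
      have "norm (of_real ((1 - y ^ n) ^ k) :: complex) = (1 - y ^ n) ^ k"
        by (subst norm_of_real) (use \<open>y ^ n \<le> 1\<close> in simp)
      with \<open>(1 - y ^ n) ^ k \<le> (real n * (1 - y)) ^ k\<close> show ?thesis
        by (simp add: v_def prime_cutoff_def y_def power_mult_distrib)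
    qed
    have "norm (P ^ n) \<le> (1 / real p) ^ n" using P by (simp add: norm_power power_mono)
    also have "(1 / real p) ^ n = (1 / real p) ^ (2 + (n - 2))" by (simp only: le_add_diff_inverse[OF n])
    also have "\<dots> = (1 / real p)\<^sup>2 * (1 / real p) ^ (n - 2)" by (rule power_add)
    also have "\<dots> \<le> (1 / real p)\<^sup>2 * (1 / 2) ^ (n - 2)" using p by (intro mult_left_mono power_mono frac_le) auto
    also have "(1 / 2 :: real) ^ (n - 2) = 4 * (1 / 2) ^ n"
    proof -
      have "(1 / 2 :: real) ^ n = (1 / 2) ^ (n - 2 + 2)" by (simp only: le_add_diff_inverse2[OF n])
      also have "\<dots> = (1 / 2) ^ (n - 2) * (1 / 2)\<^sup>2" by (rule power_add)
      finally have "(1 / 2 :: real) ^ n = (1 / 2) ^ (n - 2) * (1 / 2)\<^sup>2" .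
      thus ?thesis by (simp add: power2_eq_square)
    qed
    finally have 2: "norm (P ^ n) \<le> (1 / real p)\<^sup>2 * (4 * (1 / 2) ^ n)" .
    have "norm (b ^ n) \<le> 1" using b by (simp add: norm_power power_le_one)
    hence 3: "norm (b ^ n / of_nat n) \<le> 1"
      using n by (simp add: norm_divide divide_le_eq)
    have "norm (?t n) \<le> 1 * (real n ^ k * v) * ((1 / real p)\<^sup>2 * (4 * (1 / 2) ^ n))"
      unfolding norm_mult by (intro mult_mono 3 1[unfolded] 2) (use v0 in auto)
    thus ?thesis by (simp add: g_def power_divide mult_ac)
  qed
  have gsum: "summable (\<lambda>n. g (n + 2))" using sums_summable[OF g] by (rule summable_ignore_initial_segment)
  have "norm (\<Sum>n. ?t (n + 2)) \<le> (\<Sum>n. g (n + 2))"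
    by (rule norm_suminf_le[OF _ gsum]) (rule bound, simp)
  also have "\<dots> \<le> (\<Sum>n. g n)"
  proof -
    have "sum g {..<2} \<ge> 0" by (intro sum_nonneg) (use v0 in \<open>auto simp: g_def\<close>)
    with suminf_split_initial_segment[OF sums_summable[OF g], of 2] show ?thesis by linarith
  qed
  finally show ?thesis using sums2 g by (simp add: sums_iff v_def P_def)
qed

lemma prod_one_minus_expand:
  fixes x :: "nat \<Rightarrow> complex"
  assumes "finite J" "\<And>j. j \<in> J \<Longrightarrow> norm (x j) \<le> e" "0 \<le> e" "e \<le> 1"
  shows "norm ((\<Prod>j\<in>J. 1 - x j) - 1) \<le> 3 ^ card J * e"
    and "norm ((\<Prod>j\<in>J. 1 - x j) - 1 + (\<Sum>j\<in>J. x j)) \<le> 4 ^ card J * e\<^sup>2"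
proof -
  have "norm ((\<Prod>j\<in>J. 1 - x j) - 1) \<le> 3 ^ card J * e \<and>
        norm ((\<Prod>j\<in>J. 1 - x j) - 1 + (\<Sum>j\<in>J. x j)) \<le> 4 ^ card J * e\<^sup>2"
    using assms(1,2)
  proof (induction J rule: finite_induct)
    case (insert i J)
    define Q where "Q = (\<Prod>j\<in>J. 1 - x j)"
    define S where "S = (\<Sum>j\<in>J. x j)"
    have xi: "norm (x i) \<le> e" and IH: "norm (Q - 1) \<le> 3 ^ card J * e" "norm (Q - 1 + S) \<le> 4 ^ card J * e\<^sup>2"
      using insert by (auto simp: Q_def S_def)
    have e1: "norm ((1 - x i) * Q - 1) \<le> norm (Q - 1) * norm (1 - x i) + norm (x i)"
    proof -
      have "(1 - x i) * Q - 1 = (Q - 1) * (1 - x i) - x i" by (simp add: algebra_simps)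
      thus ?thesis by (metis norm_mult norm_triangle_ineq4)
    qed
    also have "\<dots> \<le> (3 ^ card J * e) * 2 + e"
    proof (intro add_mono mult_mono IH xi)
      show "norm (1 - x i) \<le> 2" using norm_triangle_ineq4[of 1 "x i"] xi assms by simp
    qed (use assms in auto)
    also have "\<dots> \<le> 3 * 3 ^ card J * e"
      using mult_right_mono[of 1 "3 ^ card J" e] assms by (simp add: algebra_simps)
    finally have A: "norm ((1 - x i) * Q - 1) \<le> 3 * 3 ^ card J * e" .
    have "(1 - x i) * Q - 1 + (x i + S) = (Q - 1 + S) - x i * (Q - 1)" by (simp add: algebra_simps)
    hence "norm ((1 - x i) * Q - 1 + (x i + S)) \<le> norm (Q - 1 + S) + norm (x i) * norm (Q - 1)"
      by (metis norm_mult norm_triangle_ineq4)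
    also have "\<dots> \<le> 4 ^ card J * e\<^sup>2 + e * (3 ^ card J * e)"
      by (intro add_mono mult_mono IH xi) (use assms in auto)
    also have "\<dots> \<le> 4 ^ card J * e\<^sup>2 + 4 ^ card J * e\<^sup>2"
      using mult_right_mono[OF power_mono[of "3::real" 4 "card J"], of "e\<^sup>2"] by (simp add: power2_eq_square mult_ac)
    also have "\<dots> \<le> 4 * 4 ^ card J * e\<^sup>2" by simp
    finally show ?case using A insert.hyps by (simp add: Q_def S_def)
  qed (use assms in simp)
  thus "norm ((\<Prod>j\<in>J. 1 - x j) - 1) \<le> 3 ^ card J * e"
    and "norm ((\<Prod>j\<in>J. 1 - x j) - 1 + (\<Sum>j\<in>J. x j)) \<le> 4 ^ card J * e\<^sup>2" by auto
qed

text \<open>(1 - z) exp z is 1 + O(z^2), and a nearby D costs a further factor exp(D - z). In the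
  application z comes from the weight at a prime and D from the differences of the local
  logarithm.\<close>

lemma norm_one_minus_exp_le:
  fixes z D :: complex
  assumes "norm z \<le> M" "norm (D - z) \<le> B"
  shows "norm ((1 - z) * exp D - 1) \<le> 2 * exp M * exp B * (norm z)\<^sup>2 + exp B * norm (D - z)"
proof -
  have a: "norm (exp w - 1) \<le> exp (norm w) * norm w" for w :: complex
  proof -
    have "norm (exp w - 1) \<le> exp \<bar>Re w\<bar> * norm w" using Taylor_exp[of w 0] by simp
    also have "\<dots> \<le> exp (norm w) * norm w" by (intro mult_right_mono) (auto simp: abs_Re_le_cmod)
    finally show ?thesis .
  qed
  have b: "norm (exp w - 1 - w) \<le> exp (norm w) * (norm w)\<^sup>2" for w :: complex
  proof -
    have "norm (exp w - 1 - w) \<le> exp \<bar>Re w\<bar> * (norm w)\<^sup>2"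
      using Taylor_exp[of w 1] by (simp add: power2_eq_square algebra_simps)
    also have "\<dots> \<le> exp (norm w) * (norm w)\<^sup>2" by (intro mult_right_mono) (auto simp: abs_Re_le_cmod)
    finally show ?thesis .
  qed
  have "(1 - z) * exp z - 1 = (exp z - 1 - z) - z * (exp z - 1)" by (simp add: algebra_simps)
  hence "norm ((1 - z) * exp z - 1) \<le> norm (exp z - 1 - z) + norm z * norm (exp z - 1)"
    by (metis norm_mult norm_triangle_ineq4)
  also have "\<dots> \<le> exp (norm z) * (norm z)\<^sup>2 + norm z * (exp (norm z) * norm z)"
    by (intro add_mono mult_left_mono a b) auto
  also have "\<dots> = 2 * exp (norm z) * (norm z)\<^sup>2" by (simp add: power2_eq_square)
  also have "\<dots> \<le> 2 * exp M * (norm z)\<^sup>2" using assms by (intro mult_right_mono) auto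
  finally have 1: "norm ((1 - z) * exp z - 1) \<le> 2 * exp M * (norm z)\<^sup>2" .
  have "(1 - z) * exp D - 1 = ((1 - z) * exp z - 1) * exp (D - z) + (exp (D - z) - 1)"
    by (simp add: algebra_simps flip: exp_add)
  hence "norm ((1 - z) * exp D - 1) \<le> norm ((1 - z) * exp z - 1) * norm (exp (D - z)) + norm (exp (D - z) - 1)"
    by (metis norm_mult norm_triangle_ineq)
  also have "\<dots> \<le> 2 * exp M * (norm z)\<^sup>2 * exp B + exp B * norm (D - z)"
  proof (intro add_mono mult_mono 1)
    have "norm (exp (D - z)) \<le> exp (norm (D - z))" by (rule norm_exp)
    thus "norm (exp (D - z)) \<le> exp B" using assms by (meson exp_le_cancel_iff order_trans)
    have "norm (exp (D - z) - 1) \<le> exp (norm (D - z)) * norm (D - z)" by (rule a)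
    also have "\<dots> \<le> exp B * norm (D - z)" using assms by (intro mult_right_mono) auto
    finally show "norm (exp (D - z) - 1) \<le> exp B * norm (D - z)" .
  qed auto
  finally show ?thesis by (simp add: mult_ac)
qed

section \<open>Logarithms of Euler products\<close>

lemma of_nat_mult_powr: "of_nat (m * n) powr s = (of_nat m powr s * of_nat n powr s :: complex)"
  using powr_times_real[of "of_nat m :: complex" "of_nat n" s] by simp

lemma of_nat_power_powr: "of_nat (p ^ r) powr s = (of_nat p powr s :: complex) ^ r" if "p \<ge> 1"
proof (induction r)
  case (Suc r)
  show ?case by (simp only: power_Suc of_nat_mult_powr Suc)
qed simp

text \<open>By the conventions \<open>0 powr s = 0\<close> and \<open>x / 0 = 0\<close>, sums may run over all natural numbers.\<close>
lemma dirichlet_term_0 [simp]: "dirichlet_term a s 0 = 0"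
  by (simp add: dirichlet_term_def)

lemma norm_dirichlet_term: "norm (dirichlet_term a s n) = norm (a n) * real n powr (- Re s)"
  by (cases "n = 0") (simp_all add: dirichlet_term_def norm_divide norm_powr_real_powr powr_minus field_simps)

lemma dirichlet_term_abs_summable:
  assumes "summable (\<lambda>n. norm (dirichlet_term a s (Suc n)))"
  shows "(\<lambda>n. norm (dirichlet_term a s n)) summable_on UNIV"
proof -
  have "summable (\<lambda>n. norm (dirichlet_term a s n))" using assms by (subst (asm) summable_Suc_iff)
  thus ?thesis by (intro norm_summable_imp_summable_on) simp
qed

lemma dirichlet_series_eq_infsum:
  assumes "summable (\<lambda>n. norm (dirichlet_term a s (Suc n)))"
  shows "dirichlet_series a s = infsum (dirichlet_term a s) UNIV"
proof -
  have sm: "summable (\<lambda>n. dirichlet_term a s (Suc n))" using assms by (rule summable_norm_cancel)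
  have "(dirichlet_term a s has_sum infsum (dirichlet_term a s) UNIV) UNIV"
    by (rule has_sum_infsum[OF abs_summable_summable[OF dirichlet_term_abs_summable[OF assms]]])
  hence "dirichlet_term a s sums infsum (dirichlet_term a s) UNIV" by (rule has_sum_imp_sums)
  hence "(\<lambda>n. dirichlet_term a s (Suc n)) sums infsum (dirichlet_term a s) UNIV"
    using sums_Suc_iff[of "dirichlet_term a s"] by simp
  thus ?thesis by (simp add: dirichlet_series_def sums_iff)
qed

text \<open>On a closed disc inside the half-plane the terms are dominated by the bound at its
  leftmost abscissa, and the Weierstrass test applies.\<close>

lemma holomorphic_series_half_plane:
  fixes f :: "nat \<Rightarrow> complex \<Rightarrow> complex" and b :: "nat \<Rightarrow> real"
  assumes f: "\<And>n. f n holomorphic_on {s. Re s > 1}"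
    and bound: "\<And>n s. Re s > 1 \<Longrightarrow> norm (f n s) \<le> b n * real n powr (- Re s)"
    and sm: "\<And>x. x > 1 \<Longrightarrow> summable (\<lambda>n. b n * real n powr (- x))"
    and b: "\<And>n. b n \<ge> 0"
  shows "(\<lambda>s. \<Sum>n. f n s) holomorphic_on {s. Re s > 1}"
proof (rule holomorphic_uniform_sequence[where f = "\<lambda>N s. \<Sum>n<N. f n s"])
  show "open {s. Re s > 1}" by (rule open_halfspace_Re_gt)
  show "(\<lambda>s. \<Sum>n<N. f n s) holomorphic_on {s. Re s > 1}" for N
    by (intro holomorphic_intros f)
  fix z :: complex assume "z \<in> {s. Re s > 1}"
  hence z: "Re z > 1" by simp
  define r where "r = (Re z - 1) / 2"
  have r: "r > 0" "Re z - r > 1" using z by (simp_all add: r_def field_simps)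
  have ge: "Re w \<ge> Re z - r" if "w \<in> cball z r" for w
    using that abs_Re_le_cmod[of "z - w"] by (simp add: dist_norm)
  show "\<exists>d>0. cball z d \<subseteq> {s. Re s > 1} \<and> uniform_limit (cball z d) (\<lambda>N s. \<Sum>n<N. f n s) (\<lambda>s. \<Sum>n. f n s) sequentially"
  proof (intro exI[of _ r] conjI r subsetI)
    fix w assume "w \<in> cball z r"
    thus "w \<in> {s. Re s > 1}" using ge[of w] r by simp
  next
    show "uniform_limit (cball z r) (\<lambda>N s. \<Sum>n<N. f n s) (\<lambda>s. \<Sum>n. f n s) sequentially"
    proof (rule Weierstrass_m_test[OF _ sm[OF r(2)]])
      fix n w assume w: "w \<in> cball z r"
      have "norm (f n w) \<le> b n * real n powr (- Re w)" using ge[OF w] r by (intro bound) simp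
      also have "\<dots> \<le> b n * real n powr (- (Re z - r))"
        using ge[OF w] b[of n] by (cases "n = 0") (auto intro!: mult_left_mono powr_mono)
      finally show "norm (f n w) \<le> b n * real n powr (- (Re z - r))" .
    qed
  qed
qed

lemma holomorphic_dirichlet_term:
  "(\<lambda>s. dirichlet_term a s n) holomorphic_on A"
proof (cases "n = 0")
  case False
  thus ?thesis unfolding dirichlet_term_def by (intro holomorphic_intros) auto
qed simp

lemma holomorphic_dirichlet_series:
  assumes "\<And>s. Re s > 1 \<Longrightarrow> summable (\<lambda>n. norm (dirichlet_term a s (Suc n)))"
  shows "dirichlet_series a holomorphic_on {s. Re s > 1}"
proof -
  have hol: "(\<lambda>s. \<Sum>n. dirichlet_term a s n) holomorphic_on {s. Re s > 1}"
  proof (rule holomorphic_series_half_plane[where b = "\<lambda>n. norm (a n)"])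
    fix x :: real assume "x > 1"
    hence "summable (\<lambda>n. norm (dirichlet_term a (of_real x) (Suc n)))" by (intro assms) simp
    hence "summable (\<lambda>n. norm (dirichlet_term a (of_real x) n))" by (subst (asm) summable_Suc_iff)
    thus "summable (\<lambda>n. norm (a n) * real n powr (- x))" by (simp add: norm_dirichlet_term)
  qed (auto simp: norm_dirichlet_term intro: holomorphic_dirichlet_term)
  show ?thesis
  proof (rule holomorphic_transform[OF hol])
    fix s :: complex assume "s \<in> {s. Re s > 1}"
    hence "summable (\<lambda>n. norm (dirichlet_term a s (Suc n)))" by (intro assms) simp
    hence "summable (\<lambda>n. dirichlet_term a s (Suc n))" by (rule summable_norm_cancel)
    hence "summable (dirichlet_term a s)" by (subst (asm) summable_Suc_iff)
    thus "(\<Sum>n. dirichlet_term a s n) = dirichlet_series a s"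
      unfolding dirichlet_series_def using suminf_split_head[of "dirichlet_term a s"] by simp
  qed
qed

lemma fin_diff_tendsto:
  assumes "\<And>j. j \<le> k \<Longrightarrow> (\<lambda>N. f N (z + of_nat j * h)) \<longlonglongrightarrow> g (z + of_nat j * h)"
  shows "(\<lambda>N. fin_diff h k (f N) z) \<longlonglongrightarrow> fin_diff h k g z"
  using assms
proof (induction k arbitrary: f g)
  case 0 from this[of 0] show ?case by simp
next
  case (Suc k)
  show ?case
    unfolding fin_diff.simps
  proof (rule Suc.IH)
    fix j assume "j \<le> k"
    thus "(\<lambda>N. f N (z + of_nat j * h) - f N (z + of_nat j * h + h)) \<longlonglongrightarrow> g (z + of_nat j * h) - g (z + of_nat j * h + h)"
      using Suc.prems[of j] Suc.prems[of "Suc j"] by (intro tendsto_diff) (simp_all add: algebra_simps)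
  qed
qed

lemma fin_diff_sum: "fin_diff h k (\<lambda>s. \<Sum>i\<in>I. f i s) z = (\<Sum>i\<in>I. fin_diff h k (f i) z)"
proof (induction k arbitrary: f)
  case (Suc k)
  have "(\<lambda>w. (\<Sum>i\<in>I. f i w) - (\<Sum>i\<in>I. f i (w + h))) = (\<lambda>w. \<Sum>i\<in>I. f i w - f i (w + h))"
    by (simp add: sum_subtractf)
  thus ?case by (simp only: fin_diff.simps Suc.IH)
qed simp

abbreviation (input) sieve_weight :: "real \<Rightarrow> nat \<Rightarrow> nat \<Rightarrow> real" where
  "sieve_weight h k \<equiv> prime_weight (prime_cutoff h k) {p. prime p}"

text \<open>Collects what the comparison of U with L in the half-plane of absolute convergence draws
  on; continuation and functional equation stay outside. The local factors are stated in a free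
  variable x, to be evaluated at p^(-s).\<close>

locale euler_series =
  fixes d :: nat and a :: "nat \<Rightarrow> complex" and \<beta> :: "nat \<Rightarrow> nat \<Rightarrow> complex"
  assumes a_one: "a 1 = 1"
    and a_mult: "\<And>m n. coprime m n \<Longrightarrow> a (m * n) = a m * a n"
    and \<beta>_le: "\<And>p j. prime p \<Longrightarrow> j \<in> {1..d} \<Longrightarrow> norm (\<beta> p j) \<le> 1"
    and local_factor: "\<And>p x. prime p \<Longrightarrow> norm x < 1 \<Longrightarrow>
      ((\<lambda>r. a (p ^ r) * x ^ r) has_sum (\<Prod>j=1..d. inverse (1 - \<beta> p j * x))) UNIV"
    and summ: "\<And>s. Re s > 1 \<Longrightarrow> summable (\<lambda>n. norm (dirichlet_term a s (Suc n)))"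
begin

definition root_term :: "nat \<Rightarrow> complex \<Rightarrow> nat \<Rightarrow> complex" where
  "root_term p s j = \<beta> p j * (1 / of_nat p powr s)"

definition log_factor :: "nat \<Rightarrow> complex \<Rightarrow> complex" where
  "log_factor p s = (\<Sum>j=1..d. - Ln (1 - root_term p s j))"

text \<open>A branch of log L built from principal logarithms of the single linear factors; the sum
  need not be the principal logarithm of L.\<close>

definition log_series :: "complex \<Rightarrow> complex" where
  "log_series s = (\<Sum>n. if prime n then log_factor n s else 0)"

definition sieved_series :: "real \<Rightarrow> nat \<Rightarrow> complex \<Rightarrow> complex" where
  "sieved_series h k = dirichlet_series (\<lambda>n. a n * of_real (sieve_weight h k n))"

lemma norm_root_term_le:
  assumes "prime p" "j \<in> {1..d}"
  shows "norm (root_term p s j) \<le> real p powr (- Re s)"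
proof -
  have "norm (root_term p s j) = norm (\<beta> p j) * real p powr (- Re s)"
    unfolding root_term_def norm_mult using assms
    by (subst norm_inverse_prime_powr[OF prime_ge_1_nat]) auto
  also have "\<dots> \<le> 1 * real p powr (- Re s)" by (intro mult_right_mono \<beta>_le assms) auto
  finally show ?thesis by simp
qed

text \<open>The threshold 1/2 is what the estimate |Ln(1 + z)| \<le> 2|z| asks for.\<close>

lemma prime_powr_less_half:
  assumes "prime (p::nat)" "x > 1"
  shows "real p powr (- x) < 1 / 2"
proof -
  have p: "p \<ge> 2" using assms prime_ge_2_nat by blast
  have "real p powr (- x) < real p powr (- 1)" using p assms by (intro powr_less_mono) auto
  also have "\<dots> \<le> 1 / 2" using p by (simp add: powr_minus field_simps)
  finally show ?thesis .
qed

lemma norm_log_factor_le: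
  assumes "prime p" "Re s > 1"
  shows "norm (log_factor p s) \<le> 2 * real d * real p powr (- Re s)"
proof -
  have "norm (log_factor p s) \<le> (\<Sum>j=1..d. 2 * real p powr (- Re s))"
    unfolding log_factor_def
  proof (rule sum_norm_le)
    fix j assume j: "j \<in> {1..d}"
    have "norm (- root_term p s j) < 1 / 2"
      using norm_root_term_le[OF assms(1) j, of s] prime_powr_less_half[OF assms] by simp
    from norm_Ln_le[OF this] show "norm (- Ln (1 - root_term p s j)) \<le> 2 * real p powr (- Re s)"
      using norm_root_term_le[OF assms(1) j, of s] by simp
  qed
  thus ?thesis by simp
qed

lemma root_term_ne_1:
  assumes "prime p" "Re s > 1" "j \<in> {1..d}"
  shows "1 - root_term p s j \<noteq> 0"
  using norm_root_term_le[OF assms(1,3), of s] prime_powr_less_half[OF assms(1,2)] by auto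

lemma exp_log_factor:
  assumes "prime p" "Re s > 1"
  shows "exp (- log_factor p s) = (\<Prod>j=1..d. 1 - root_term p s j)"
proof -
  have "exp (- log_factor p s) = (\<Prod>j=1..d. exp (Ln (1 - root_term p s j)))"
    by (simp add: log_factor_def sum_negf exp_sum)
  also have "\<dots> = (\<Prod>j=1..d. 1 - root_term p s j)"
    using root_term_ne_1[OF assms] by (intro prod.cong) auto
  finally show ?thesis .
qed

lemma dirichlet_term_prime_power:
  assumes "prime p"
  shows "dirichlet_term a s (p ^ r) = a (p ^ r) * (1 / of_nat p powr s) ^ r"
  using assms of_nat_power_powr[of p r s] prime_ge_1_nat[OF assms]
  by (simp add: dirichlet_term_def power_one_over field_simps)

lemma infsum_prime_powers:
  assumes "prime p" "Re s > 1"
  shows "1 / infsum (\<lambda>r. dirichlet_term a s (p ^ r)) UNIV = (\<Prod>j=1..d. 1 - root_term p s j)"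
    and "infsum (\<lambda>r. dirichlet_term a s (p ^ r)) UNIV \<noteq> 0"
proof -
  have "norm (1 / of_nat p powr s :: complex) < 1"
    using prime_powr_less_half[OF assms] norm_inverse_prime_powr[of p s] assms(1) prime_ge_1_nat by auto
  from infsumI[OF local_factor[OF assms(1) this]]
  have eq: "infsum (\<lambda>r. dirichlet_term a s (p ^ r)) UNIV = (\<Prod>j=1..d. inverse (1 - root_term p s j))"
    by (simp add: dirichlet_term_prime_power[OF assms(1)] root_term_def)
  show "1 / infsum (\<lambda>r. dirichlet_term a s (p ^ r)) UNIV = (\<Prod>j=1..d. 1 - root_term p s j)"
    unfolding eq by (simp add: divide_inverse prod_inversef[symmetric] o_def)
  show "infsum (\<lambda>r. dirichlet_term a s (p ^ r)) UNIV \<noteq> 0"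
    unfolding eq using root_term_ne_1[OF assms] by (auto simp: prod_zero_iff)
qed

lemma dirichlet_term_mult:
  "coprime m n \<Longrightarrow> dirichlet_term a s (m * n) = dirichlet_term a s m * dirichlet_term a s n"
  unfolding dirichlet_term_def of_nat_mult_powr by (simp add: a_mult)

lemma dirichlet_term_1: "dirichlet_term a s 1 = 1"
  using a_one by (simp add: dirichlet_term_def)

text \<open>The explicit blow-up in \<open>Re s - 1\<close> is recorded because the bound will be
  used at a distance from the line proportional to the radius of a zero-free disc.\<close>

lemma summable_log_factor:
  assumes "Re s > 1"
  shows "summable (\<lambda>n. norm (if prime n then log_factor n s else 0))"
    and "norm (log_series s) \<le> 2 * real d * (1 + 1 / (Re s - 1))"
proof -
  have le: "norm (if prime n then log_factor n s else 0) \<le> 2 * real d * real n powr (- Re s)" for n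
    using norm_log_factor_le[OF _ assms, of n] by auto
  have part: "(\<Sum>n<N. norm (if prime n then log_factor n s else 0)) \<le> 2 * real d * (1 + 1 / (Re s - 1))" for N
  proof -
    have "(\<Sum>n<N. norm (if prime n then log_factor n s else 0)) \<le> (\<Sum>n<N. 2 * real d * real n powr (- Re s))"
      by (intro sum_mono le)
    also have "\<dots> = 2 * real d * (\<Sum>n<N. real n powr (- Re s))" by (simp add: sum_distrib_left)
    also have "(\<Sum>n<N. real n powr (- Re s)) \<le> (\<Sum>n\<in>insert 0 {1..N}. real n powr (- Re s))"
      by (intro sum_mono2) auto
    also have "\<dots> = (\<Sum>n=1..N. real n powr (- 1 - (Re s - 1)))" by simp
    also have "\<dots> \<le> 1 + 1 / (Re s - 1)" using assms by (intro sum_powr_minus_one_minus_le) auto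
    finally show ?thesis by (simp add: mult_left_mono)
  qed
  show sm: "summable (\<lambda>n. norm (if prime n then log_factor n s else 0))"
    by (rule bounded_imp_summable[where B = "2 * real d * (1 + 1 / (Re s - 1))"])
       (use part[of "Suc _"] in \<open>auto simp: lessThan_Suc_atMost\<close>)
  have "norm (log_series s) \<le> (\<Sum>n. norm (if prime n then log_factor n s else 0))"
    unfolding log_series_def by (rule summable_norm[OF sm])
  also have "\<dots> \<le> 2 * real d * (1 + 1 / (Re s - 1))"
    by (rule suminf_le_const[OF sm part])
  finally show "norm (log_series s) \<le> 2 * real d * (1 + 1 / (Re s - 1))" .
qed

lemma log_series_tendsto:
  assumes "Re s > 1"
  shows "(\<lambda>N. \<Sum>p | prime p \<and> p \<le> N. log_factor p s) \<longlonglongrightarrow> log_series s"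
proof -
  have "(\<lambda>N. \<Sum>n\<le>N. if prime n then log_factor n s else 0) \<longlonglongrightarrow> log_series s"
    using summable_norm_cancel[OF summable_log_factor(1)[OF assms]] unfolding log_series_def
    by (rule summable_LIMSEQ')
  moreover have "(\<Sum>n\<le>N. if prime n then log_factor n s else 0) = (\<Sum>p | prime p \<and> p \<le> N. log_factor p s)" for N
    by (rule sum.mono_neutral_cong_right) auto
  ultimately show ?thesis by simp
qed

lemma holomorphic_log_series: "log_series holomorphic_on {s. Re s > 1}"
  unfolding log_series_def[abs_def]
proof (rule holomorphic_series_half_plane[where b = "\<lambda>n. 2 * real d"])
  fix n show "(\<lambda>s. if prime n then log_factor n s else 0) holomorphic_on {s. Re s > 1}"
  proof (cases "prime n")
    case True
    have nonpos: "1 - \<beta> n j * (1 / of_nat n powr s) \<notin> \<real>\<^sub>\<le>\<^sub>0" if "Re s > 1" "j \<in> {1..d}" for s j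
    proof -
      have "norm (root_term n s j) < 1"
        using norm_root_term_le[OF True that(2), of s] prime_powr_less_half[OF True that(1)] by simp
      hence "Re (root_term n s j) < 1" using complex_Re_le_cmod[of "root_term n s j"] by linarith
      thus ?thesis unfolding root_term_def by (auto simp: complex_nonpos_Reals_iff)
    qed
    have "n \<noteq> 0" using True by auto
    thus ?thesis
      using nonpos unfolding log_factor_def root_term_def if_P[OF True]
      by (intro holomorphic_intros) auto
  qed simp
next
  fix n and s :: complex assume "Re s > 1"
  thus "norm (if prime n then log_factor n s else 0) \<le> 2 * real d * real n powr (- Re s)"
    using norm_log_factor_le[of n s] by auto
next
  fix x :: real assume "x > 1"
  thus "summable (\<lambda>n. 2 * real d * real n powr (- x))"
    by (intro summable_mult) (simp add: summable_real_powr_iff)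
qed simp

lemma exp_log_series:
  assumes s: "Re s > 1"
  shows "exp (log_series s) = dirichlet_series a s"
proof -
  note sm = dirichlet_term_abs_summable[OF summ[OF s]]
  \<comment> \<open>Sieving out all primes leaves only the term \<open>n = 1\<close>, which yields the Euler product.\<close>
  have eq: "infsum (\<lambda>n. dirichlet_term a s n * of_real (prime_weight (\<lambda>_. 1) {p. prime p \<and> p \<le> N} n)) UNIV
     = dirichlet_series a s * exp (- (\<Sum>p | prime p \<and> p \<le> N. log_factor p s))" for N
  proof -
    have "infsum (\<lambda>n. dirichlet_term a s n * of_real (prime_weight (\<lambda>_. 1) {p. prime p \<and> p \<le> N} n)) UNIV
     = infsum (dirichlet_term a s) UNIV * (\<Prod>p | prime p \<and> p \<le> N. 1 - of_real 1 * (1 - 1 / infsum (\<lambda>r. dirichlet_term a s (p ^ r)) UNIV))"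
      by (rule infsum_prime_weight[OF sm]) (use infsum_prime_powers(2) s dirichlet_term_mult dirichlet_term_1 in auto)
    also have "(\<Prod>p | prime p \<and> p \<le> N. 1 - of_real 1 * (1 - 1 / infsum (\<lambda>r. dirichlet_term a s (p ^ r)) UNIV))
       = (\<Prod>p | prime p \<and> p \<le> N. exp (- log_factor p s))"
      by (rule prod.cong) (auto simp: infsum_prime_powers(1) s exp_log_factor)
    also have "\<dots> = exp (- (\<Sum>p | prime p \<and> p \<le> N. log_factor p s))"
      by (simp add: exp_sum sum_negf[symmetric])
    finally show ?thesis by (simp add: dirichlet_series_eq_infsum[OF summ[OF s]])
  qed
  have "(\<lambda>N. dirichlet_series a s * exp (- (\<Sum>p | prime p \<and> p \<le> N. log_factor p s)))
    \<longlonglongrightarrow> dirichlet_series a s * exp (- log_series s)"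
    by (intro tendsto_intros log_series_tendsto s)
  moreover have "(\<lambda>N. dirichlet_series a s * exp (- (\<Sum>p | prime p \<and> p \<le> N. log_factor p s)))
    \<longlonglongrightarrow> infsum (\<lambda>n. dirichlet_term a s n * of_real (prime_weight (\<lambda>_. 1) {p. prime p} n)) UNIV"
    unfolding eq[symmetric] by (rule prime_weight_limit[OF sm]) auto
  moreover have "infsum (\<lambda>n. dirichlet_term a s n * of_real (prime_weight (\<lambda>_. 1) {p. prime p} n)) UNIV
    = infsum (dirichlet_term a s) {1}"
  proof (rule infsum_cong_neutral)
    fix n :: nat assume "n \<in> UNIV - {1}"
    hence n1: "n \<noteq> 1" by simp
    show "dirichlet_term a s n * of_real (prime_weight (\<lambda>_. 1) {p. prime p} n) = 0"
    proof (cases "n = 0")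
      case False
      obtain p where p: "prime p" "p dvd n" using n1 prime_factor_nat by blast
      have "finite {p \<in> {p. prime p}. p dvd n}"
        by (rule finite_subset[of _ "{..n}"]) (use False in \<open>auto dest: dvd_imp_le\<close>)
      hence "prime_weight (\<lambda>_. 1) {p. prime p} n = 0" unfolding prime_weight_def using p by (intro prod_zero) auto
      thus ?thesis by simp
    qed simp
  next
    fix n :: nat assume "n \<in> UNIV \<inter> {1}"
    hence "n = 1" by simp
    have "{p \<in> {p. prime p}. p dvd (1::nat)} = {}" by auto
    hence "prime_weight (\<lambda>_. 1) {p. prime p} 1 = 1" by (simp only: prime_weight_def prod.empty)
    thus "dirichlet_term a s n * of_real (prime_weight (\<lambda>_. 1) {p. prime p} n) = dirichlet_term a s n"
      unfolding \<open>n = 1\<close> by simp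
  qed auto
  ultimately have "dirichlet_series a s * exp (- log_series s) = 1"
    using LIMSEQ_unique dirichlet_term_1 by fastforce
  thus ?thesis by (simp add: exp_minus field_simps)
qed

end

section \<open>Comparison of the sieved series with the Euler product\<close>

definition sieve_const :: "nat \<Rightarrow> nat \<Rightarrow> real" where
  "sieve_const d k = (let B = 4 ^ d + real d * series_const k in
     2 * exp (3 ^ d) * exp B * (3 ^ d)\<^sup>2 + exp B * B)"

context euler_series
begin

lemma fin_diff_log_factor:
  assumes p: "prime p" and h: "h \<ge> 0" and s: "Re s > 1"
  shows "norm (fin_diff (of_real h) k (log_factor p) s - of_real (prime_cutoff h k p) * (\<Sum>j=1..d. root_term p s j))
     \<le> real d * series_const k * (prime_cutoff h k p / (real p)\<^sup>2)"
proof -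
  have "log_factor p = (\<lambda>s. \<Sum>j=1..d. - Ln (1 - \<beta> p j * (1 / of_nat p powr s)))"
    by (simp add: fun_eq_iff log_factor_def root_term_def)
  hence "fin_diff (of_real h) k (log_factor p) s - of_real (prime_cutoff h k p) * (\<Sum>j=1..d. root_term p s j)
    = (\<Sum>j=1..d. fin_diff (of_real h) k (\<lambda>s. - Ln (1 - \<beta> p j * (1 / of_nat p powr s))) s
        - of_real (prime_cutoff h k p) * (\<beta> p j * (1 / of_nat p powr s)))"
    by (simp only: fin_diff_sum sum_subtractf sum_distrib_left root_term_def)
  also have "norm \<dots> \<le> (\<Sum>j=1..d. series_const k * (prime_cutoff h k p / (real p)\<^sup>2))"
    by (rule sum_norm_le, rule local_log_diff)
       (use \<beta>_le[OF p] h s prime_ge_2_nat[OF p] in auto)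
  finally show ?thesis by simp
qed

text \<open>\<open>1 - z\<close> is the local factor of U/L at p, and the exponent is the difference
  of the local logarithm. Both z and that exponent equal v(p) times the sum of the
  \<open>root_term\<close> values up to O(v(p)/p^2), so the first-order terms cancel.\<close>

lemma sieve_factor_bound:
  fixes k :: nat
  assumes p: "prime p" and h: "h \<ge> 0" and s: "Re s > 1"
  defines "v \<equiv> prime_cutoff h k p"
  defines "z \<equiv> of_real v * (1 - (\<Prod>j=1..d. 1 - root_term p s j))"
  shows "norm ((1 - z) * exp (fin_diff (of_real h) k (log_factor p) s) - 1) \<le> sieve_const d k * (v / (real p)\<^sup>2)"
proof -
  \<comment> \<open>\<open>B\<close> will bound D - z and \<open>3 ^ d\<close> will bound z;
    inserting both in \<open>norm_one_minus_exp_le\<close> yields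
    \<open>sieve_const\<close>.\<close>
  define B where "B = 4 ^ d + real d * series_const k"
  define D where "D = fin_diff (of_real h) k (log_factor p) s"
  define e where "e = 1 / real p"
  have p2: "p \<ge> 2" using prime_ge_2_nat[OF p] .
  have e: "0 \<le> e" "e \<le> 1" using p2 by (auto simp: e_def)
  have v: "0 \<le> v" "v \<le> 1" unfolding v_def using prime_cutoff_bounds[OF h] by auto
  have B: "B \<ge> 0" unfolding B_def using series_const_nonneg[of k] by simp
  have root: "norm (root_term p s j) \<le> e" if j: "j \<in> {1..d}" for j
  proof -
    have "norm (root_term p s j) \<le> real p powr (- Re s)" by (rule norm_root_term_le[OF p j])
    also have "\<dots> \<le> real p powr (- 1)" using p2 s by (intro powr_mono) auto
    finally show ?thesis using p2 by (simp add: powr_minus e_def field_simps)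
  qed
  have ex: "norm ((\<Prod>j=1..d. 1 - root_term p s j) - 1) \<le> 3 ^ d * e"
    "norm ((\<Prod>j=1..d. 1 - root_term p s j) - 1 + (\<Sum>j=1..d. root_term p s j)) \<le> 4 ^ d * e\<^sup>2"
    using prod_one_minus_expand[of "{1..d}" "root_term p s" e] root e by simp_all
  have nz: "norm z \<le> 3 ^ d * (v * e)"
  proof -
    have "norm z = v * norm ((\<Prod>j=1..d. 1 - root_term p s j) - 1)"
      using v by (simp add: z_def norm_mult norm_minus_commute)
    also have "\<dots> \<le> v * (3 ^ d * e)" using ex(1) v by (intro mult_left_mono) auto
    finally show ?thesis by (simp add: mult_ac)
  qed
  have nz': "norm z \<le> 3 ^ d" 
  proof -
    have "v * e \<le> 1" using v e by (simp add: mult_le_one)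
    hence "3 ^ d * (v * e) \<le> 3 ^ d * 1" by (intro mult_left_mono) auto
    thus ?thesis using nz by linarith
  qed
  have "D - z = (D - of_real v * (\<Sum>j=1..d. root_term p s j)) + of_real v * ((\<Prod>j=1..d. 1 - root_term p s j) - 1 + (\<Sum>j=1..d. root_term p s j))"
    by (simp add: z_def algebra_simps)
  also have "norm \<dots> \<le> real d * series_const k * (v / (real p)\<^sup>2) + v * (4 ^ d * e\<^sup>2)"
  proof (rule norm_triangle_mono)
    show "norm (D - of_real v * (\<Sum>j=1..d. root_term p s j)) \<le> real d * series_const k * (v / (real p)\<^sup>2)"
      unfolding D_def v_def by (rule fin_diff_log_factor[OF p h s])
    show "norm (of_real v * ((\<Prod>j=1..d. 1 - root_term p s j) - 1 + (\<Sum>j=1..d. root_term p s j))) \<le> v * (4 ^ d * e\<^sup>2)"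
      unfolding norm_mult using ex(2) v by (auto intro!: mult_left_mono)
  qed
  also have "\<dots> = B * (v / (real p)\<^sup>2)" by (simp add: B_def e_def power_divide algebra_simps add_divide_distrib)
  finally have Dz: "norm (D - z) \<le> B * (v / (real p)\<^sup>2)" .
  have "v / (real p)\<^sup>2 \<le> 1" 
  proof -
    have "v / (real p)\<^sup>2 \<le> 1 / 1" by (rule frac_le) (use v p2 in \<open>auto intro: one_le_power\<close>)
    thus ?thesis by simp
  qed
  hence Dz': "norm (D - z) \<le> B" using Dz mult_left_mono[of "v / (real p)\<^sup>2" 1 B] B by linarith
  have "(norm z)\<^sup>2 \<le> (3 ^ d * (v * e))\<^sup>2" using nz by (intro power_mono) auto
  also have "\<dots> = (3 ^ d)\<^sup>2 * ((v * v) * e\<^sup>2)" by (simp add: power_mult_distrib power2_eq_square)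
  also have "\<dots> \<le> (3 ^ d)\<^sup>2 * ((v * 1) * e\<^sup>2)" using v by (intro mult_left_mono mult_right_mono) auto
  finally have z2: "(norm z)\<^sup>2 \<le> (3 ^ d)\<^sup>2 * (v / (real p)\<^sup>2)" by (simp add: e_def power_divide)
  have "norm ((1 - z) * exp D - 1) \<le> 2 * exp (3 ^ d) * exp B * (norm z)\<^sup>2 + exp B * norm (D - z)"
    by (rule norm_one_minus_exp_le[OF nz' Dz'])
  also have "\<dots> \<le> 2 * exp (3 ^ d) * exp B * ((3 ^ d)\<^sup>2 * (v / (real p)\<^sup>2)) + exp B * (B * (v / (real p)\<^sup>2))"
    by (intro add_mono mult_left_mono z2 Dz) auto
  also have "\<dots> = sieve_const d k * (v / (real p)\<^sup>2)"
    unfolding sieve_const_def Let_def B_def[symmetric] by (simp add: algebra_simps)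
  finally show ?thesis by (simp add: D_def)
qed

lemma sieve_const_nonneg: "sieve_const d k \<ge> 0"
  unfolding sieve_const_def Let_def using series_const_nonneg[of k] by simp

lemma summable_sieved:
  assumes "Re s > 1" "h \<ge> 0"
  shows "summable (\<lambda>n. norm (dirichlet_term (\<lambda>n. a n * of_real (prime_weight (prime_cutoff h k) P n)) s (Suc n)))"
proof (rule summable_comparison_test'[OF summ[OF assms(1)], where N = 0])
  fix n
  have "prime_weight (prime_cutoff h k) P (Suc n) \<le> 1" "prime_weight (prime_cutoff h k) P (Suc n) \<ge> 0"
    using prime_weight_bounds[of "prime_cutoff h k" P] prime_cutoff_bounds[OF assms(2)] by auto
  thus "norm (norm (dirichlet_term (\<lambda>n. a n * of_real (prime_weight (prime_cutoff h k) P n)) s (Suc n)))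
      \<le> norm (dirichlet_term a s (Suc n))"
    by (simp add: norm_dirichlet_term norm_mult mult_right_mono mult_left_le)
qed

text \<open>The local errors add up to a multiple of \<open>h ^ k\<close> by
  \<open>sum_prime_cutoff_le\<close>. Finite sets of primes are treated first, with a bound
  independent of the set, and then exhausted.\<close>

theorem sieved_series_approx:
  assumes h: "h \<ge> 0" and s: "Re s > 1"
  shows "norm (sieved_series h k s * exp (fin_diff (of_real h) k log_series s) - dirichlet_series a s)
    \<le> norm (dirichlet_series a s) * (exp (sieve_const d k * (3 * fact k * (2 * h) ^ k)) - 1)"
proof -
  define v where "v = prime_cutoff h k"
  define D where "D p = fin_diff (of_real h) k (log_factor p) s" for p
  define z where "z p = of_real (v p) * (1 - (\<Prod>j=1..d. 1 - root_term p s j))" for p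
  have v: "0 \<le> v p \<and> v p \<le> 1" for p unfolding v_def using prime_cutoff_bounds[OF h] by auto
  note sm = dirichlet_term_abs_summable[OF summ[OF s]]
  define U where "U N = infsum (\<lambda>n. dirichlet_term a s n * of_real (prime_weight v {p. prime p \<and> p \<le> N} n)) UNIV" for N
  have U_eq: "U N = dirichlet_series a s * (\<Prod>p | prime p \<and> p \<le> N. 1 - z p)" for N
  proof -
    have "U N = infsum (dirichlet_term a s) UNIV * (\<Prod>p | prime p \<and> p \<le> N. 1 - of_real (v p) * (1 - 1 / infsum (\<lambda>r. dirichlet_term a s (p ^ r)) UNIV))"
      unfolding U_def
      by (rule infsum_prime_weight[OF sm]) (use infsum_prime_powers(2) s dirichlet_term_mult dirichlet_term_1 v in auto)
    also have "(\<Prod>p | prime p \<and> p \<le> N. 1 - of_real (v p) * (1 - 1 / infsum (\<lambda>r. dirichlet_term a s (p ^ r)) UNIV)) = (\<Prod>p | prime p \<and> p \<le> N. 1 - z p)"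
      by (rule prod.cong) (auto simp: infsum_prime_powers(1) s z_def)
    finally show ?thesis by (simp add: dirichlet_series_eq_infsum[OF summ[OF s]])
  qed
  have U_lim: "U \<longlonglongrightarrow> sieved_series h k s"
  proof -
    have "sieved_series h k s = infsum (\<lambda>n. dirichlet_term a s n * of_real (prime_weight v {p. prime p} n)) UNIV"
    proof -
      have "dirichlet_term (\<lambda>n. a n * of_real (prime_weight v {p. prime p} n)) s
          = (\<lambda>n. dirichlet_term a s n * of_real (prime_weight v {p. prime p} n))"
        by (simp add: fun_eq_iff dirichlet_term_def)
      thus ?thesis unfolding sieved_series_def v_def
        using dirichlet_series_eq_infsum[OF summable_sieved[OF s h]] by metis
    qed
    thus ?thesis unfolding U_def[abs_def] using prime_weight_limit[OF sm _ v, simplified] by simp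
  qed
  have D_lim: "(\<lambda>N. \<Sum>p | prime p \<and> p \<le> N. D p) \<longlonglongrightarrow> fin_diff (of_real h) k log_series s"
  proof -
    have "(\<lambda>N. fin_diff (of_real h) k (\<lambda>w. \<Sum>p | prime p \<and> p \<le> N. log_factor p w) s) \<longlonglongrightarrow> fin_diff (of_real h) k log_series s"
    proof (rule fin_diff_tendsto)
      fix j :: nat
      have "real j * h \<ge> 0" using h by simp
      hence "Re (s + of_nat j * of_real h) > 1" using s by simp
      thus "(\<lambda>N. \<Sum>p | prime p \<and> p \<le> N. log_factor p (s + of_nat j * of_real h)) \<longlonglongrightarrow> log_series (s + of_nat j * of_real h)"
        by (rule log_series_tendsto)
    qed
    thus ?thesis by (simp add: fin_diff_sum D_def)
  qed
  define C where "C = sieve_const d k * (3 * fact k * (2 * h) ^ k)"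
  have bound: "norm ((\<Prod>p | prime p \<and> p \<le> N. 1 - z p) * exp (\<Sum>p | prime p \<and> p \<le> N. D p) - 1) \<le> exp C - 1" for N
  proof -
    let ?P = "{p. prime p \<and> p \<le> N}"
    define w where "w p = (1 - z p) * exp (D p) - 1" for p
    have "(\<Prod>p\<in>?P. 1 - z p) * exp (\<Sum>p\<in>?P. D p) = (\<Prod>p\<in>?P. 1 + w p)"
      by (simp add: exp_sum w_def flip: prod.distrib)
    hence "norm ((\<Prod>p\<in>?P. 1 - z p) * exp (\<Sum>p\<in>?P. D p) - 1) \<le> (\<Prod>p\<in>?P. 1 + norm (w p)) - 1"
      by (simp only: norm_prod_minus1_le_prod_minus1)
    also have "(\<Prod>p\<in>?P. 1 + norm (w p)) \<le> (\<Prod>p\<in>?P. exp (norm (w p)))"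
      by (intro prod_mono conjI add_nonneg_nonneg exp_ge_add_one_self) auto
    also have "\<dots> = exp (\<Sum>p\<in>?P. norm (w p))" by (simp add: exp_sum)
    also have "(\<Sum>p\<in>?P. norm (w p)) \<le> (\<Sum>p\<in>?P. sieve_const d k * (v p / (real p)\<^sup>2))"
    proof (rule sum_mono)
      fix p assume "p \<in> ?P"
      hence "prime p" by simp
      thus "norm (w p) \<le> sieve_const d k * (v p / (real p)\<^sup>2)"
        unfolding w_def z_def D_def v_def by (rule sieve_factor_bound[OF _ h s])
    qed
    also have "\<dots> = sieve_const d k * (\<Sum>p\<in>?P. v p / (real p)\<^sup>2)" by (simp add: sum_distrib_left)
    also have "\<dots> \<le> C" unfolding C_def v_def
      by (intro mult_left_mono sum_prime_cutoff_le h sieve_const_nonneg)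
    finally show ?thesis by simp
  qed
  have "norm (U N * exp (\<Sum>p | prime p \<and> p \<le> N. D p) - dirichlet_series a s) \<le> norm (dirichlet_series a s) * (exp C - 1)" for N
  proof -
    have "U N * exp (\<Sum>p | prime p \<and> p \<le> N. D p) - dirichlet_series a s
       = dirichlet_series a s * ((\<Prod>p | prime p \<and> p \<le> N. 1 - z p) * exp (\<Sum>p | prime p \<and> p \<le> N. D p) - 1)"
      by (simp add: U_eq algebra_simps)
    thus ?thesis using bound[of N] by (simp add: norm_mult mult_left_mono)
  qed
  moreover have "(\<lambda>N. norm (U N * exp (\<Sum>p | prime p \<and> p \<le> N. D p) - dirichlet_series a s))
     \<longlonglongrightarrow> norm (sieved_series h k s * exp (fin_diff (of_real h) k log_series s) - dirichlet_series a s)"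
    by (intro tendsto_intros U_lim D_lim)
  ultimately show ?thesis
    unfolding C_def by (intro tendsto_upperbound[OF _ always_eventually]) auto
qed

text \<open>Two logarithms of one function differ by a function whose exponential is 1, hence with
  derivative 0; agreement at one point settles the constant.\<close>

lemma log_series_unique:
  assumes "open S" "connected S" "S \<subseteq> {s. Re s > 1}" "z0 \<in> S"
    and g: "g holomorphic_on S" "\<And>z. z \<in> S \<Longrightarrow> exp (g z) = dirichlet_series a z"
    and z0: "g z0 = log_series z0" and z: "z \<in> S"
  shows "g z = log_series z"
proof -
  define f where "f w = g w - log_series w" for w
  have lh: "log_series holomorphic_on S" by (rule holomorphic_on_subset[OF holomorphic_log_series assms(3)])
  have f: "f holomorphic_on S" unfolding f_def by (intro holomorphic_intros g lh)
  have one: "exp (f w) = 1" if "w \<in> S" for w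
  proof -
    have "exp (log_series w) = dirichlet_series a w" using that assms(3) by (intro exp_log_series) auto
    thus ?thesis using g(2)[OF that] unfolding f_def exp_diff by (metis divide_self exp_not_eq_zero)
  qed
  have "deriv f w = 0" if w: "w \<in> S" for w
  proof -
    have "(f has_field_derivative deriv f w) (at w)" using f w assms(1) by (auto intro: holomorphic_derivI)
    hence "((\<lambda>w. exp (f w)) has_field_derivative exp (f w) * deriv f w) (at w)"
      by (auto intro!: derivative_eq_intros)
    moreover have "((\<lambda>w. exp (f w)) has_field_derivative 0) (at w)"
      by (rule has_field_derivative_transform_within_open[OF DERIV_const[of 1] assms(1) w]) (use one in auto)
    ultimately show ?thesis using DERIV_unique exp_not_eq_zero mult_eq_0_iff by blast
  qed
  hence "(f has_field_derivative 0) (at w)" if "w \<in> S" for w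
    using holomorphic_derivI[OF f assms(1) that] that by simp
  hence "f constant_on S" by (rule has_field_derivative_0_imp_constant_on[OF _ assms(2,1)])
  hence "f z = f z0" using z assms(4) unfolding constant_on_def by metis
  thus ?thesis by (simp add: f_def z0)
qed

end

section \<open>Analytic continuation and functional equation of twists\<close>

lemma dirichlet_character_1: "dirichlet_character q chi \<Longrightarrow> chi 1 = 1"
  unfolding dirichlet_character_def
  by (metis coprime_1_left mult.left_neutral mult_cancel_right1)

lemma dirichlet_character_minus_1:
  assumes "dirichlet_character q chi"
  shows "chi (- 1) \<in> {1, - 1}"
proof -
  have "chi (- 1) * chi (- 1) = chi ((- 1) * (- 1))" using assms unfolding dirichlet_character_def by metis
  hence "(chi (- 1))\<^sup>2 = 1" using dirichlet_character_1[OF assms] by (simp add: power2_eq_square)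
  thus ?thesis by (simp add: power2_eq_1_iff)
qed

text \<open>By periodicity only finitely many values occur, whereas a value of modulus above 1 would
  have infinitely many distinct powers, all of them values.\<close>

lemma norm_dirichlet_character_le:
  assumes "dirichlet_character q chi"
  shows "norm (chi n) \<le> 1"
proof (rule ccontr)
  assume "\<not> norm (chi n) \<le> 1"
  hence gt: "norm (chi n) > 1" by simp
  have q: "q > 0" and mult: "\<And>m n. chi (m * n) = chi m * chi n" and per: "\<And>n. chi (n + int q) = chi n"
    using assms unfolding dirichlet_character_def by auto
  have per': "chi (m + int k * int q) = chi m" for m k
  proof (induction k)
    case (Suc k)
    have "chi (m + int (Suc k) * int q) = chi ((m + int k * int q) + int q)" by (simp add: algebra_simps)
    thus ?case using Suc per by simp
  qed simp
  have red: "chi m = chi (m mod int q)" for m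
  proof (cases "m \<ge> 0")
    case True
    have "m = m mod int q + int (nat (m div int q)) * int q"
      using True q by (simp add: pos_imp_zdiv_nonneg_iff)
    thus ?thesis using per' by metis
  next
    case False
    hence "m div int q \<le> 0" using q by (simp add: div_nonpos_pos_le0)
    hence "m mod int q = m + int (nat (- (m div int q))) * int q"
      by (simp add: minus_div_mult_eq_mod[symmetric])
    thus ?thesis using per' by metis
  qed
  have "range chi \<subseteq> chi ` {0..<int q}"
  proof
    fix x assume "x \<in> range chi"
    then obtain m where "x = chi m" by auto
    thus "x \<in> chi ` {0..<int q}" using red[of m] q by (intro image_eqI[of _ _ "m mod int q"]) auto
  qed
  hence fin: "finite (range chi)" by (rule finite_subset) simp
  have pow: "chi (n ^ k) = chi n ^ k" for k
    by (induction k) (simp_all add: mult dirichlet_character_1[OF assms])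
  have "inj (\<lambda>k. chi n ^ k)"
  proof (rule injI)
    fix i j assume "chi n ^ i = chi n ^ j"
    hence "norm (chi n) ^ i = norm (chi n) ^ j" by (metis norm_power)
    thus "i = j" using gt by simp
  qed
  hence "infinite (range (\<lambda>k. chi n ^ k))" by (simp add: finite_image_iff)
  moreover have "range (\<lambda>k. chi n ^ k) \<subseteq> range chi" using pow by (metis image_subset_iff rangeI)
  ultimately show False using fin finite_subset by blast
qed

text \<open>The 3/2 stands for any exponent strictly between the order 1 and the Gaussian exponent
  2.\<close>

lemma entire_order_1_bound:
  assumes hol: "f holomorphic_on UNIV" and ord: "entire_order f = 1"
  shows "\<exists>C\<ge>0. \<forall>z. norm (f z) \<le> C * exp (norm z powr (3 / 2))"
proof -
  have "Inf (ereal ` {\<rho>. \<rho> \<ge> 0 \<and> (\<lambda>z. norm (f z)) \<in> O[at_infinity](\<lambda>z. exp (norm z powr \<rho>))}) < ereal (3 / 2)"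
    using ord unfolding entire_order_def by (simp add: one_ereal_def)
  then obtain \<rho> where \<rho>: "\<rho> \<ge> 0" "(\<lambda>z. norm (f z)) \<in> O[at_infinity](\<lambda>z. exp (norm z powr \<rho>))" "\<rho> < 3 / 2"
    unfolding Inf_less_iff by auto
  from \<rho>(2) obtain c where c: "c > 0" "eventually (\<lambda>z. norm (norm (f z)) \<le> c * norm (exp (norm z powr \<rho>))) at_infinity"
    by (elim landau_o.bigE)
  then obtain b where b: "\<And>z. b \<le> norm z \<Longrightarrow> norm (f z) \<le> c * exp (norm z powr \<rho>)"
    by (auto simp: eventually_at_infinity)
  have "bounded (f ` cball 0 (max b 1))"
    by (intro compact_imp_bounded compact_continuous_image holomorphic_on_imp_continuous_on holomorphic_on_subset[OF hol]) auto
  then obtain D where "\<forall>z\<in>cball 0 (max b 1). norm (f z) \<le> D" unfolding bounded_iff by blast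
  hence D: "\<And>z. norm z \<le> max b 1 \<Longrightarrow> norm (f z) \<le> D" by simp
  show ?thesis
  proof (intro exI[of _ "max c D"] conjI allI)
    show "max c D \<ge> 0" using c by simp
    fix z
    show "norm (f z) \<le> max c D * exp (norm z powr (3 / 2))"
    proof (cases "norm z \<le> max b 1")
      case True
      have "norm (f z) \<le> max c D * 1" using D[OF True] by simp
      also have "\<dots> \<le> max c D * exp (norm z powr (3 / 2))" using c by (intro mult_left_mono) auto
      finally show ?thesis .
    next
      case False
      have "norm (f z) \<le> c * exp (norm z powr \<rho>)" by (rule b) (use False in simp)
      also have "\<dots> \<le> max c D * exp (norm z powr (3 / 2))"
        using False \<rho> c by (intro mult_mono) (auto intro: powr_mono)
      finally show ?thesis .
    qed
  qed
qed

definition gamma_ratio :: "L_datum \<Rightarrow> complex \<Rightarrow> complex \<Rightarrow> complex" where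
  "gamma_ratio F \<epsilon> w = (\<Prod>j=1..degree_of F. gamma_factor (arch_param F \<epsilon> j) w)"

locale twisted_L =
  fixes F :: L_datum and q :: nat and chi :: "int \<Rightarrow> complex"
  assumes framework: "L_framework F" and q2: "q \<ge> 2" and prim: "primitive_character q chi"
begin

definition \<mu> :: "nat \<Rightarrow> complex" where "\<mu> j = arch_param F (chi (-1)) j"

abbreviation N :: nat where "N \<equiv> conductor F q"

text \<open>An entire inverse of the archimedean factor; division by \<open>L_infty\<close> would
  fail at its poles.\<close>

definition recip_L_infty :: "complex \<Rightarrow> complex" where
  "recip_L_infty s = of_nat N powr (- s / 2) *
      (\<Prod>j=1..degree_of F. of_real pi powr ((s + \<mu> j) / 2) * rGamma ((s + \<mu> j) / 2))"

lemma character: "dirichlet_character q chi"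
  using prim by (simp add: primitive_character_def)

lemma N_pos: "N > 0"
  using framework q2 unfolding L_framework_def by simp

lemma \<mu>_bound: "\<exists>\<theta>. 0 < \<theta> \<and> \<theta> < 1 / 2 \<and> (\<forall>j\<in>{1..degree_of F}. Re (\<mu> j) \<ge> -1 + \<theta>)"
proof -
  obtain \<theta> where \<theta>: "1 / (2 * real (degree_of F)) < \<theta>" "\<theta> < 1 / 2"
     "(\<forall>q\<ge>2. \<forall>chi. primitive_character q chi \<longrightarrow>
           (\<forall>j\<in>{1..degree_of F}. Re (arch_param F (chi (-1)) j) \<ge> -1 + \<theta>))"
    using framework unfolding L_framework_def by blast
  have "1 / (2 * real (degree_of F)) \<ge> 0" by simp
  hence "\<theta> > 0" using \<theta>(1) by linarith
  thus ?thesis using \<theta> q2 prim unfolding \<mu>_def by blast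
qed

lemma L_holo: "L_twist F chi holomorphic_on UNIV"
  and L_series: "Re s > 1 \<Longrightarrow> L_twist F chi s = dirichlet_series (twist_coeff F chi) s"
  using L_twist_is_continuation[OF framework q2 prim] unfolding is_entire_continuation_def by auto

lemma Lambda_continuation: "is_entire_continuation (completed_series F q chi) (Lambda_twist F q chi)"
proof -
  obtain g where "is_entire_continuation (completed_series F q chi) g"
    using framework q2 prim unfolding L_framework_def by blast
  thus ?thesis unfolding Lambda_twist_def by (simp add: entire_continuation_eq)
qed

lemma Lambda_holo: "Lambda_twist F q chi holomorphic_on UNIV"
  and Lambda_series: "Re s > 1 \<Longrightarrow> Lambda_twist F q chi s = L_twist F chi s * L_infty F q chi s"
  using Lambda_continuation L_series unfolding is_entire_continuation_def completed_series_def by auto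

lemma recip_L_infty_holo: "recip_L_infty holomorphic_on UNIV"
  unfolding recip_L_infty_def[abs_def] using N_pos by (intro holomorphic_intros) auto

lemma recip_L_infty: "L_infty F q chi s * recip_L_infty s = 1" if s: "Re s > 1"
proof -
  have 1: "Gamma_R (s + \<mu> j) * (of_real pi powr ((s + \<mu> j) / 2) * rGamma ((s + \<mu> j) / 2)) = 1"
    if j: "j \<in> {1..degree_of F}" for j
  proof -
    have "Re ((s + \<mu> j) / 2) > 0" using \<mu>_bound j s by fastforce
    hence "(s + \<mu> j) / 2 \<notin> \<int>\<^sub>\<le>\<^sub>0" by (rule Re_pos_not_nonpos_Int)
    hence "Gamma ((s + \<mu> j) / 2) * rGamma ((s + \<mu> j) / 2) = 1"
      by (simp add: Gamma_def rGamma_eq_zero_iff)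
    moreover have "of_real pi powr (- (s + \<mu> j) / 2) * of_real pi powr ((s + \<mu> j) / 2) = (1::complex)"
      by (simp add: add_divide_distrib diff_divide_distrib flip: powr_add)
    ultimately show ?thesis
      by (simp add: Gamma_R_def mult.assoc mult.left_commute [of "Gamma _"])
  qed
  have 2: "(of_nat N :: complex) powr (s / 2) * of_nat N powr (- s / 2) = 1"
    using N_pos by (simp flip: powr_add)
  have 3: "(\<Prod>j=1..degree_of F. Gamma_R (s + \<mu> j)) *
    (\<Prod>j=1..degree_of F. of_real pi powr ((s + \<mu> j) / 2) * rGamma ((s + \<mu> j) / 2)) = 1"
    unfolding prod.distrib [symmetric] using 1 by (intro prod.neutral) auto
  have "L_infty F q chi s * recip_L_infty s = ((of_nat N :: complex) powr (s / 2) * of_nat N powr (- s / 2)) *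
    ((\<Prod>j=1..degree_of F. Gamma_R (s + \<mu> j)) *
    (\<Prod>j=1..degree_of F. of_real pi powr ((s + \<mu> j) / 2) * rGamma ((s + \<mu> j) / 2)))"
    unfolding L_infty_def recip_L_infty_def \<mu>_def by (simp only: mult_ac)
  thus ?thesis unfolding 2 3 by simp
qed

lemma L_eq: "L_twist F chi s = Lambda_twist F q chi s * recip_L_infty s"
proof -
  let ?U = "{s::complex. Re s > 1}"
  have "(\<lambda>s. L_twist F chi s - Lambda_twist F q chi s * recip_L_infty s) s = 0"
  proof (rule analytic_continuation_open[where s = "?U" and s' = UNIV and
      f = "\<lambda>s. L_twist F chi s - Lambda_twist F q chi s * recip_L_infty s" and g = "\<lambda>_. 0"])
    show "open ?U" by (rule open_halfspace_Re_gt)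
    show "?U \<noteq> {}" by (auto intro!: exI[of _ 2])
    show "(\<lambda>s. L_twist F chi s - Lambda_twist F q chi s * recip_L_infty s) holomorphic_on UNIV"
      by (intro holomorphic_intros L_holo Lambda_holo recip_L_infty_holo)
    fix z :: complex assume "z \<in> ?U"
    thus "L_twist F chi z - Lambda_twist F q chi z * recip_L_infty z = 0"
      using recip_L_infty[of z] Lambda_series[of z] by (simp add: mult.assoc)
  qed auto
  thus ?thesis by simp
qed

text \<open>All data of the dual are conjugates, and \<chi>(-1) is real, being 1 or -1. Hence the
  dual function is the conjugate reflection of the original one.\<close>

lemma Lambda_dual: "Lambda_twist (dual F) q (\<lambda>n. cnj (chi n)) s = cnj (Lambda_twist F q chi (cnj s))"
proof -
  define g where "g = (\<lambda>s. cnj (Lambda_twist F q chi (cnj s)))"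
  have "is_entire_continuation (completed_series (dual F) q (\<lambda>n. cnj (chi n))) g"
    unfolding is_entire_continuation_def
  proof (intro conjI allI impI)
    have "cnj \<circ> Lambda_twist F q chi \<circ> cnj holomorphic_on UNIV"
      by (rule holomorphic_on_compose_cnj_cnj) (auto intro: holomorphic_on_subset[OF Lambda_holo])
    thus "g holomorphic_on UNIV" by (simp add: g_def o_def)
    fix s :: complex assume s: "Re s > 1"
    have e: "cnj (chi (- 1)) = chi (- 1)" using dirichlet_character_minus_1[OF character] by auto
    have sm: "summable (\<lambda>n. norm (dirichlet_term (twist_coeff F chi) (cnj s) (Suc n)))"
      using framework q2 prim s unfolding L_framework_def has_euler_product_def by simp
    have t: "cnj (dirichlet_term (twist_coeff F chi) (cnj s) n) = dirichlet_term (twist_coeff (dual F) (\<lambda>n. cnj (chi n))) s n" for n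
    proof (cases "n = 0")
      case False
      thus ?thesis
        by (simp add: dirichlet_term_def twist_coeff_def dual_def cnj_powr)
    qed simp
    have D: "cnj (dirichlet_series (twist_coeff F chi) (cnj s)) = dirichlet_series (twist_coeff (dual F) (\<lambda>n. cnj (chi n))) s"
    proof -
      have "(\<lambda>n. dirichlet_term (twist_coeff F chi) (cnj s) (Suc n)) sums dirichlet_series (twist_coeff F chi) (cnj s)"
        unfolding dirichlet_series_def by (rule summable_sums[OF summable_norm_cancel[OF sm]])
      hence "(\<lambda>n. cnj (dirichlet_term (twist_coeff F chi) (cnj s) (Suc n))) sums cnj (dirichlet_series (twist_coeff F chi) (cnj s))"
        by (simp add: sums_cnj)
      thus ?thesis unfolding t dirichlet_series_def by (simp add: sums_iff)
    qed
    have G: "cnj (Gamma_R z) = Gamma_R (cnj z)" for z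
      by (simp add: Gamma_R_def cnj_Gamma cnj_powr)
    have "cnj (of_nat N powr (cnj s / 2)) = (of_nat N powr (s / 2) :: complex)"
      using N_pos by (simp add: cnj_powr)
    hence I: "cnj (L_infty F q chi (cnj s)) = L_infty (dual F) q (\<lambda>n. cnj (chi n)) s"
      unfolding L_infty_def by (simp add: dual_def G e)
    show "g s = completed_series (dual F) q (\<lambda>n. cnj (chi n)) s"
      using Lambda_series[of "cnj s"] L_series[of "cnj s"] s D I by (simp add: g_def completed_series_def)
  qed
  thus ?thesis unfolding Lambda_twist_def[of "dual F"] by (simp add: entire_continuation_eq g_def)
qed

text \<open>With \<open>Lambda_dual\<close>, the functional equation relates values of one and the
  same function at w and 1 - cnj w, and all gamma factors are gathered in
  \<open>gamma_ratio\<close>.\<close>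

lemma functional_equation:
  obtains \<kappa> where "norm \<kappa> = 1"
    "\<And>w. Re w > 1 \<Longrightarrow> L_twist F chi (1 - cnj w) = \<kappa> * cnj (L_twist F chi w * of_nat N powr (w - 1 / 2) * gamma_ratio F (chi (-1)) w)"
proof -
  have "\<exists>\<kappa>. norm \<kappa> = 1 \<and> (\<forall>s. Lambda_twist F q chi s = \<kappa> * Lambda_twist (dual F) q (\<lambda>n. cnj (chi n)) (1 - s))"
    using framework q2 prim unfolding L_framework_def by blast
  then obtain \<kappa> where \<kappa>: "norm \<kappa> = 1" "\<And>s. Lambda_twist F q chi s = \<kappa> * cnj (Lambda_twist F q chi (1 - cnj s))"
    unfolding Lambda_dual by auto
  show ?thesis
  proof (rule that[OF \<kappa>(1)])
    fix w :: complex assume w: "Re w > 1"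
    have pc: "cnj (of_real pi powr z) = (of_real pi powr cnj z :: complex)" for z by (simp add: cnj_powr)
    have c: "cnj (recip_L_infty (1 - cnj w)) = of_nat N powr (- (1 - w) / 2) *
       (\<Prod>j=1..degree_of F. of_real pi powr ((1 - w + cnj (\<mu> j)) / 2) * rGamma ((1 - w + cnj (\<mu> j)) / 2))"
      using N_pos unfolding recip_L_infty_def by (simp add: cnj_powr cnj_rGamma pc)
    have n: "of_nat N powr (w / 2) * of_nat N powr (- (1 - w) / 2) = (of_nat N powr (w - 1 / 2) :: complex)"
      using N_pos by (simp add: field_simps flip: powr_add)
    have "L_infty F q chi w * cnj (recip_L_infty (1 - cnj w)) =
      (of_nat N powr (w / 2) * of_nat N powr (- (1 - w) / 2)) * ((\<Prod>j=1..degree_of F. Gamma_R (w + \<mu> j)) *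
       (\<Prod>j=1..degree_of F. of_real pi powr ((1 - w + cnj (\<mu> j)) / 2) * rGamma ((1 - w + cnj (\<mu> j)) / 2)))"
      unfolding c L_infty_def \<mu>_def by (simp only: mult_ac)
    also have "\<dots> = of_nat N powr (w - 1 / 2) * gamma_ratio F (chi (-1)) w"
      unfolding n gamma_ratio_def gamma_factor_def \<mu>_def prod.distrib by (simp only: mult_ac)
    finally have g: "L_infty F q chi w * cnj (recip_L_infty (1 - cnj w)) = of_nat N powr (w - 1 / 2) * gamma_ratio F (chi (-1)) w" .
    have "L_twist F chi (1 - cnj w) = \<kappa> * cnj (Lambda_twist F q chi w) * recip_L_infty (1 - cnj w)"
      by (subst L_eq, subst \<kappa>(2)) simp
    also have "\<dots> = \<kappa> * cnj (L_twist F chi w * (L_infty F q chi w * cnj (recip_L_infty (1 - cnj w))))"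
      by (simp add: Lambda_series[OF w] mult_ac)
    finally show "L_twist F chi (1 - cnj w) = \<kappa> * cnj (L_twist F chi w * of_nat N powr (w - 1 / 2) * gamma_ratio F (chi (-1)) w)"
      unfolding g by (simp add: mult_ac)
  qed
qed

lemma recip_L_infty_strip:
  "\<exists>C A. C \<ge> 0 \<and> (\<forall>s. \<bar>Re s\<bar> \<le> B \<longrightarrow> norm (recip_L_infty s) \<le> C * exp (A * \<bar>Im s\<bar>))"
proof -
  have fac: "\<exists>C\<ge>0. \<forall>s. \<bar>Re s\<bar> \<le> B \<longrightarrow> norm (of_real pi powr ((s + m) / 2) * rGamma ((s + m) / 2)) \<le> C * exp (2 * \<bar>Im s\<bar>)" for m
  proof -
    obtain D where D: "D \<ge> 0" "\<And>z. (- B + Re m) / 2 \<le> Re z \<and> Re z \<le> (B + Re m) / 2 \<Longrightarrow> norm (rGamma z) \<le> D * exp (pi * \<bar>Im z\<bar>)"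
      using rGamma_strip[of "(- B + Re m) / 2" "(B + Re m) / 2"] by blast
    show ?thesis
    proof (intro exI[of _ "pi powr ((B + Re m) / 2) * (D * exp (2 * \<bar>Im m\<bar>))"] conjI allI impI)
      show "0 \<le> pi powr ((B + Re m) / 2) * (D * exp (2 * \<bar>Im m\<bar>))" using D by simp
      fix s assume s: "\<bar>Re s\<bar> \<le> B"
      have "norm (rGamma ((s + m) / 2)) \<le> D * exp (pi * \<bar>Im ((s + m) / 2)\<bar>)" by (rule D) (use s in auto)
      also have "pi * \<bar>Im ((s + m) / 2)\<bar> \<le> 4 * ((\<bar>Im s\<bar> + \<bar>Im m\<bar>) / 2)"
        using pi_less_4 by (intro mult_mono) auto
      hence "D * exp (pi * \<bar>Im ((s + m) / 2)\<bar>) \<le> D * (exp (2 * \<bar>Im m\<bar>) * exp (2 * \<bar>Im s\<bar>))"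
        using D by (intro mult_left_mono) (auto simp flip: exp_add)
      finally have 1: "norm (rGamma ((s + m) / 2)) \<le> D * (exp (2 * \<bar>Im m\<bar>) * exp (2 * \<bar>Im s\<bar>))" .
      have 2: "norm (of_real pi powr ((s + m) / 2) :: complex) \<le> pi powr ((B + Re m) / 2)"
        unfolding norm_pi_powr using s pi_ge_two by (intro powr_mono) auto
      show "norm (of_real pi powr ((s + m) / 2) * rGamma ((s + m) / 2)) \<le> pi powr ((B + Re m) / 2) * (D * exp (2 * \<bar>Im m\<bar>)) * exp (2 * \<bar>Im s\<bar>)"
        unfolding norm_mult using mult_mono[OF 2 1] by (simp add: mult_ac)
    qed
  qed
  then obtain C where C: "\<And>m. C m \<ge> 0" "\<And>m s. \<bar>Re s\<bar> \<le> B \<Longrightarrow> norm (of_real pi powr ((s + m) / 2) * rGamma ((s + m) / 2)) \<le> C m * exp (2 * \<bar>Im s\<bar>)"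
    by metis
  show ?thesis
  proof (rule exI[of _ "real N powr (B / 2) * (\<Prod>j=1..degree_of F. C (\<mu> j))"],
      rule exI[of _ "2 * real (degree_of F)"], intro conjI allI impI)
    show "0 \<le> real N powr (B / 2) * (\<Prod>j=1..degree_of F. C (\<mu> j))" using C by (intro mult_nonneg_nonneg prod_nonneg) auto
    fix s assume s: "\<bar>Re s\<bar> \<le> B"
    have "norm (\<Prod>j=1..degree_of F. of_real pi powr ((s + \<mu> j) / 2) * rGamma ((s + \<mu> j) / 2)) \<le> (\<Prod>j=1..degree_of F. C (\<mu> j) * exp (2 * \<bar>Im s\<bar>))"
      unfolding prod_norm[symmetric] by (intro prod_mono) (use C(2)[OF s] in auto)
    also have "\<dots> = (\<Prod>j=1..degree_of F. C (\<mu> j)) * exp (2 * real (degree_of F) * \<bar>Im s\<bar>)"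
      by (simp add: prod.distrib mult_ac flip: exp_of_nat_mult)
    finally have 1: "norm (\<Prod>j=1..degree_of F. of_real pi powr ((s + \<mu> j) / 2) * rGamma ((s + \<mu> j) / 2)) \<le> (\<Prod>j=1..degree_of F. C (\<mu> j)) * exp (2 * real (degree_of F) * \<bar>Im s\<bar>)" .
    have "norm (of_nat N powr (- s / 2) :: complex) = real N powr (- Re s / 2)"
      using N_pos norm_powr_real_powr[of "of_nat N" "- s / 2"] by simp
    also have "\<dots> \<le> real N powr (B / 2)" using N_pos s by (intro powr_mono) auto
    finally have 2: "norm (of_nat N powr (- s / 2) :: complex) \<le> real N powr (B / 2)" .
    show "norm (recip_L_infty s) \<le> real N powr (B / 2) * (\<Prod>j=1..degree_of F. C (\<mu> j)) * exp (2 * real (degree_of F) * \<bar>Im s\<bar>)"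
      unfolding recip_L_infty_def norm_mult using mult_mono[OF 2 1] by (simp add: mult_ac)
  qed
qed

text \<open>Purely qualitative: the constants depend on q and \<chi> and serve to justify moving
  lines of integration. The growth of \<open>Lambda_twist\<close> is transferred through
  \<open>recip_L_infty\<close>.\<close>

lemma L_strip_growth:
  "\<exists>C A. C \<ge> 0 \<and> (\<forall>s. \<bar>Re s\<bar> \<le> B \<longrightarrow> norm (L_twist F chi s) \<le> C * exp (norm s powr (3 / 2) + A * \<bar>Im s\<bar>))"
proof -
  have "entire_order (Lambda_twist F q chi) = 1"
    using framework q2 prim unfolding L_framework_def by blast
  from entire_order_1_bound[OF Lambda_holo this]
  obtain C where C: "C \<ge> 0" "\<And>z. norm (Lambda_twist F q chi z) \<le> C * exp (norm z powr (3 / 2))" by blast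
  obtain D A where D: "D \<ge> 0" "\<And>s. \<bar>Re s\<bar> \<le> B \<Longrightarrow> norm (recip_L_infty s) \<le> D * exp (A * \<bar>Im s\<bar>)"
    using recip_L_infty_strip[of B] by blast
  show ?thesis
  proof (rule exI[of _ "C * D"], rule exI[of _ A], intro conjI allI impI)
    show "C * D \<ge> 0" using C D by simp
    fix s assume s: "\<bar>Re s\<bar> \<le> B"
    have "norm (L_twist F chi s) \<le> (C * exp (norm s powr (3 / 2))) * (D * exp (A * \<bar>Im s\<bar>))"
      unfolding L_eq norm_mult by (intro mult_mono C D s mult_nonneg_nonneg) auto
    also have "\<dots> = C * D * exp (norm s powr (3 / 2) + A * \<bar>Im s\<bar>)" by (simp add: exp_add)
    finally show "norm (L_twist F chi s) \<le> C * D * exp (norm s powr (3 / 2) + A * \<bar>Im s\<bar>)" .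
  qed
qed

lemma contour_bound:
  assumes "b \<ge> 0" "X > 0"
  shows "\<exists>C. \<forall>s. \<bar>Re s\<bar> \<le> b \<longrightarrow> norm (L_twist F chi (z0 + s) * exp (s\<^sup>2) * of_real X powr s) \<le> C / (1 + (Im s)\<^sup>2)"
proof -
  obtain C A where C: "C \<ge> 0" "\<And>s. \<bar>Re s\<bar> \<le> norm z0 + b \<Longrightarrow> norm (L_twist F chi s) \<le> C * exp (norm s powr (3 / 2) + A * \<bar>Im s\<bar>)"
    using L_strip_growth[of "norm z0 + b"] by blast
  define M where "M = max (X powr b) (X powr (- b))"
  define E where "E = exp (\<bar>A\<bar> * \<bar>Im z0\<bar> + b\<^sup>2)"
  show ?thesis
  proof (intro exI allI impI)
    fix s assume s: "\<bar>Re s\<bar> \<le> b"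
    have re: "\<bar>Re (z0 + s)\<bar> \<le> norm z0 + b" using s abs_Re_le_cmod[of z0] by simp
    have X: "norm (of_real X powr s :: complex) \<le> M"
    proof -
      have "norm (of_real X powr s :: complex) = X powr Re s" using assms by (simp add: norm_powr_real_powr)
      also have "\<dots> \<le> M"
      proof (cases "X \<ge> 1")
        case True thus ?thesis using abs_le_D1[OF s] powr_mono[of "Re s" b X] by (simp add: M_def)
      next
        case False
        hence "X powr Re s \<le> X powr (- b)" using s assms by (intro powr_mono') auto
        thus ?thesis by (simp add: M_def)
      qed
      finally show ?thesis .
    qed
    have e: "norm (exp (s\<^sup>2)) \<le> exp (b\<^sup>2 - (Im s)\<^sup>2)"
      unfolding norm_exp_square using s assms power_mono[of "\<bar>Re s\<bar>" b 2] by simp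
    have A: "A * \<bar>Im (z0 + s)\<bar> \<le> \<bar>A\<bar> * \<bar>Im z0\<bar> + \<bar>A\<bar> * \<bar>Im s\<bar>"
    proof -
      have "A * \<bar>Im (z0 + s)\<bar> \<le> \<bar>A\<bar> * (\<bar>Im z0\<bar> + \<bar>Im s\<bar>)" by (intro mult_mono) auto
      thus ?thesis by (simp add: algebra_simps)
    qed
    have nz: "norm (z0 + s) \<le> (norm z0 + b) + \<bar>Im s\<bar>"
      using norm_triangle_ineq[of z0 s] cmod_le[of s] s by linarith
    have "norm (L_twist F chi (z0 + s) * exp (s\<^sup>2) * of_real X powr s)
      \<le> (C * exp (norm (z0 + s) powr (3 / 2) + A * \<bar>Im (z0 + s)\<bar>)) * exp (b\<^sup>2 - (Im s)\<^sup>2) * M"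
      unfolding norm_mult by (intro mult_mono C re X e mult_nonneg_nonneg) auto
    also have "\<dots> \<le> (C * exp (norm (z0 + s) powr (3 / 2) + (\<bar>A\<bar> * \<bar>Im z0\<bar> + \<bar>A\<bar> * \<bar>Im s\<bar>))) * exp (b\<^sup>2 - (Im s)\<^sup>2) * M"
      using A C(1) X by (intro mult_right_mono mult_left_mono) (auto simp: M_def le_max_iff_disj)
    also have "\<dots> = C * M * E * exp (norm (z0 + s) powr (3 / 2) + \<bar>A\<bar> * \<bar>Im s\<bar> - (Im s)\<^sup>2)"
      by (simp add: E_def mult_ac flip: exp_add)
    also have "\<dots> \<le> C * M * E * (2 * exp (512 + (norm z0 + b)\<^sup>2 / 4 + \<bar>A\<bar>\<^sup>2) / (1 + (Im s)\<^sup>2))"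
      by (intro mult_left_mono subgaussian_decay nz) (use assms C in \<open>auto simp: E_def M_def le_max_iff_disj\<close>)
    also have "\<dots> = (C * M * E * (2 * exp (512 + (norm z0 + b)\<^sup>2 / 4 + \<bar>A\<bar>\<^sup>2))) / (1 + (Im s)\<^sup>2)" by simp
    finally show "norm (L_twist F chi (z0 + s) * exp (s\<^sup>2) * of_real X powr s)
      \<le> (C * M * E * (2 * exp (512 + (norm z0 + b)\<^sup>2 / 4 + \<bar>A\<bar>\<^sup>2))) / (1 + (Im s)\<^sup>2)" .
  qed
qed

text \<open>A smooth form of the approximate functional equation: the residue at 0 of the integrand
  with kernel exp(s^2) X^s / s, read off from the two lines.\<close>

lemma contour_formula:
  assumes "b > 0" "X > 0"
  shows "2 * pi * L_twist F chi z0 =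
    vertical_integral b (\<lambda>s. L_twist F chi (z0 + s) * exp (s\<^sup>2) * of_real X powr s / s) -
    vertical_integral (- b) (\<lambda>s. L_twist F chi (z0 + s) * exp (s\<^sup>2) * of_real X powr s / s)"
proof -
  obtain C where C: "\<And>s. \<bar>Re s\<bar> \<le> b \<Longrightarrow> norm (L_twist F chi (z0 + s) * exp (s\<^sup>2) * of_real X powr s) \<le> C / (1 + (Im s)\<^sup>2)"
    using contour_bound[of b X z0] assms by auto
  have "(\<lambda>s. L_twist F chi (z0 + s)) holomorphic_on UNIV"
    by (rule holomorphic_on_compose_gen[OF _ L_holo, unfolded o_def]) (auto intro!: holomorphic_intros)
  hence "(\<lambda>s. L_twist F chi (z0 + s) * exp (s\<^sup>2) * of_real X powr s) holomorphic_on UNIV"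
    using assms by (intro holomorphic_intros) auto
  from vertical_integral_residue[OF assms(1) this C] show ?thesis using assms by simp
qed

end

section \<open>Satake parameters and sieved coefficients\<close>

definition tuples_with_sum :: "nat set \<Rightarrow> nat \<Rightarrow> (nat \<Rightarrow> nat) set" where
  "tuples_with_sum J r = {e \<in> J \<rightarrow>\<^sub>E UNIV. (\<Sum>j\<in>J. e j) = r}"

lemma finite_tuples_with_sum: "finite J \<Longrightarrow> finite (tuples_with_sum J r)"
proof (rule finite_subset)
  assume J: "finite J"
  show "tuples_with_sum J r \<subseteq> (\<Pi>\<^sub>E j\<in>J. {..r})"
  proof
    fix e assume e: "e \<in> tuples_with_sum J r"
    hence "e j \<le> r" if "j \<in> J" for j
      using that J member_le_sum[of j J e] by (auto simp: tuples_with_sum_def)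
    thus "e \<in> (\<Pi>\<^sub>E j\<in>J. {..r})" using e by (auto simp: tuples_with_sum_def PiE_iff)
  qed
  show "finite (\<Pi>\<^sub>E j\<in>J. {..r})" using J by (intro finite_PiE) auto
qed

text \<open>Splitting off the exponent of j makes the complete homogeneous sum in one more variable
  a Cauchy product. The tuples are extensional functions, hence the reset to
  \<open>undefined\<close>.\<close>

lemma sum_tuples_insert:
  fixes \<alpha> :: "nat \<Rightarrow> complex"
  assumes J: "finite J" "j \<notin> J"
  shows "(\<Sum>e\<in>tuples_with_sum (insert j J) r. \<Prod>i\<in>insert j J. \<alpha> i ^ e i) =
    (\<Sum>k\<le>r. \<alpha> j ^ k * (\<Sum>e\<in>tuples_with_sum J (r - k). \<Prod>i\<in>J. \<alpha> i ^ e i))"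
proof -
  have "(\<Sum>k\<le>r. \<alpha> j ^ k * (\<Sum>e\<in>tuples_with_sum J (r - k). \<Prod>i\<in>J. \<alpha> i ^ e i)) =
    (\<Sum>(k, e)\<in>(SIGMA k:{..r}. tuples_with_sum J (r - k)). \<alpha> j ^ k * (\<Prod>i\<in>J. \<alpha> i ^ e i))"
    using J by (simp add: sum_distrib_left sum.Sigma finite_tuples_with_sum)
  also have "\<dots> = (\<Sum>e\<in>tuples_with_sum (insert j J) r. \<Prod>i\<in>insert j J. \<alpha> i ^ e i)"
  proof (rule sum.reindex_bij_witness[where i = "\<lambda>e. (e j, e(j := undefined))" and j = "\<lambda>(k, e). e(j := k)"])
    fix x assume "x \<in> (SIGMA k:{..r}. tuples_with_sum J (r - k))"
    then obtain k e where x: "x = (k, e)" "k \<le> r" "e \<in> J \<rightarrow>\<^sub>E UNIV" "(\<Sum>i\<in>J. e i) = r - k"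
      by (auto simp: tuples_with_sum_def)
    have ej: "e j = undefined" by (rule PiE_arb[OF x(3) J(2)])
    show "(((case x of (k, e) \<Rightarrow> e(j := k)) j), (case x of (k, e) \<Rightarrow> e(j := k))(j := undefined)) = x"
      unfolding x prod.case using ej by (simp add: fun_upd_idem)
    have "(\<Sum>i\<in>J. (e(j := k)) i) = (\<Sum>i\<in>J. e i)" using J(2) by (intro sum.cong) auto
    hence "(\<Sum>i\<in>J. (e(j := k)) i) = r - k" using x(4) by simp
    thus "(case x of (k, e) \<Rightarrow> e(j := k)) \<in> tuples_with_sum (insert j J) r"
      using x J by (auto simp: tuples_with_sum_def PiE_iff extensional_def)
    have "(\<Prod>i\<in>J. \<alpha> i ^ (e(j := k)) i) = (\<Prod>i\<in>J. \<alpha> i ^ e i)" using J(2) by (intro prod.cong) auto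
    thus "(\<Prod>i\<in>insert j J. \<alpha> i ^ (case x of (k, e) \<Rightarrow> e(j := k)) i) = (case x of (k, e) \<Rightarrow> \<alpha> j ^ k * (\<Prod>i\<in>J. \<alpha> i ^ e i))"
      using J by (simp add: x)
  next
    fix e assume e: "e \<in> tuples_with_sum (insert j J) r"
    show "(case (e j, e(j := undefined)) of (k, e) \<Rightarrow> e(j := k)) = e" by auto
    have s: "e j + (\<Sum>i\<in>J. e i) = r" using e J by (simp add: tuples_with_sum_def)
    moreover have "(\<Sum>i\<in>J. (e(j := undefined)) i) = (\<Sum>i\<in>J. e i)" using J(2) by (intro sum.cong) auto
    ultimately have "(\<Sum>i\<in>J. (e(j := undefined)) i) = r - e j" by simp
    thus "(e j, e(j := undefined)) \<in> (SIGMA k:{..r}. tuples_with_sum J (r - k))"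
      using e s by (auto simp: tuples_with_sum_def PiE_iff extensional_def)
  qed
  finally show ?thesis ..
qed

lemma fps_geometric: "(1 - fps_const c * fps_X) * Abs_fps (\<lambda>k. c ^ k) = (1 :: complex fps)"
proof (rule fps_ext)
  fix n show "((1 - fps_const c * fps_X) * Abs_fps (\<lambda>k. c ^ k)) $ n = (1 :: complex fps) $ n"
    by (cases n) (simp_all add: left_diff_distrib mult.assoc fps_X_mult_nth)
qed

text \<open>The generating function of the complete homogeneous symmetric polynomials, as a formal
  identity so that no convergence is involved.\<close>

lemma complete_symmetric_fps:
  fixes \<alpha> :: "nat \<Rightarrow> complex"
  assumes "finite J"
  shows "(\<Prod>j\<in>J. 1 - fps_const (\<alpha> j) * fps_X) *
    Abs_fps (\<lambda>r. \<Sum>e\<in>tuples_with_sum J r. \<Prod>j\<in>J. \<alpha> j ^ e j) = 1"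
  using assms
proof (induction J rule: finite_induct)
  case empty
  have "tuples_with_sum {} r = (if r = 0 then {\<lambda>_. undefined} else {})" for r
    by (auto simp: tuples_with_sum_def)
  thus ?case by (simp add: fps_eq_iff)
next
  case (insert j J)
  have "Abs_fps (\<lambda>r. \<Sum>e\<in>tuples_with_sum (insert j J) r. \<Prod>i\<in>insert j J. \<alpha> i ^ e i) =
     Abs_fps (\<lambda>k. \<alpha> j ^ k) * Abs_fps (\<lambda>r. \<Sum>e\<in>tuples_with_sum J r. \<Prod>i\<in>J. \<alpha> i ^ e i)"
    by (rule fps_ext) (simp add: fps_mult_nth sum_tuples_insert[OF insert.hyps] atLeast0AtMost)
  hence "(\<Prod>i\<in>insert j J. 1 - fps_const (\<alpha> i) * fps_X) *
      Abs_fps (\<lambda>r. \<Sum>e\<in>tuples_with_sum (insert j J) r. \<Prod>i\<in>insert j J. \<alpha> i ^ e i) =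
    ((1 - fps_const (\<alpha> j) * fps_X) * Abs_fps (\<lambda>k. \<alpha> j ^ k)) *
    ((\<Prod>i\<in>J. 1 - fps_const (\<alpha> i) * fps_X) * Abs_fps (\<lambda>r. \<Sum>e\<in>tuples_with_sum J r. \<Prod>i\<in>J. \<alpha> i ^ e i))"
    by (simp only: prod.insert[OF insert.hyps] mult_ac)
  thus ?case by (simp only: fps_geometric insert.IH mult_1)
qed

lemma fps_linear_factor_sums:
  fixes f :: "complex fps"
  assumes "(\<lambda>n. f $ n * x ^ n) sums S"
  shows "(\<lambda>n. ((1 - fps_const c * fps_X) * f) $ n * x ^ n) sums ((1 - c * x) * S)"
proof -
  have eq: "((1 - fps_const c * fps_X) * f) $ n * x ^ n = f $ n * x ^ n - c * x * (if n = 0 then 0 else f $ (n - 1) * x ^ (n - 1))" for n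
    by (cases n) (simp_all add: left_diff_distrib mult.assoc fps_X_mult_nth algebra_simps)
  have "(\<lambda>n. if Suc n = 0 then 0 else f $ (Suc n - 1) * x ^ (Suc n - 1)) sums S" using assms by simp
  hence "(\<lambda>n. if n = 0 then 0 else f $ (n - 1) * x ^ (n - 1)) sums (S + 0)"
    using sums_Suc_iff[of "\<lambda>n. if n = 0 then 0 else f $ (n - 1) * x ^ (n - 1)" S] by simp
  hence "(\<lambda>n. f $ n * x ^ n - c * x * (if n = 0 then 0 else f $ (n - 1) * x ^ (n - 1))) sums (S - c * x * S)"
    by (intro sums_diff sums_mult assms) simp
  thus ?thesis unfolding eq by (simp add: algebra_simps)
qed

text \<open>The linear factors are multiplied onto the convergent series one by one. This asks for
  no bound on the \<open>\<alpha> j\<close>, which is essential because such a bound will be derived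
  from it.\<close>

lemma complete_symmetric_sums:
  fixes \<alpha> :: "nat \<Rightarrow> complex"
  assumes J: "finite J" and S: "(\<lambda>r. (\<Sum>e\<in>tuples_with_sum J r. \<Prod>j\<in>J. \<alpha> j ^ e j) * x ^ r) sums S"
  shows "(\<Prod>j\<in>J. 1 - \<alpha> j * x) * S = 1"
proof -
  define H where "H = Abs_fps (\<lambda>r. \<Sum>e\<in>tuples_with_sum J r. \<Prod>j\<in>J. \<alpha> j ^ e j)"
  have "(\<lambda>n. ((\<Prod>j\<in>K. 1 - fps_const (\<alpha> j) * fps_X) * H) $ n * x ^ n) sums ((\<Prod>j\<in>K. 1 - \<alpha> j * x) * S)" if "finite K" for K
    using that
  proof (induction K rule: finite_induct)
    case empty thus ?case using S by (simp add: H_def)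
  next
    case (insert j K)
    from fps_linear_factor_sums[OF insert.IH, of "\<alpha> j"] show ?case
      using insert.hyps by (simp add: mult.assoc)
  qed
  from this[OF J] have "(\<lambda>n. (1 :: complex fps) $ n * x ^ n) sums ((\<Prod>j\<in>J. 1 - \<alpha> j * x) * S)"
    unfolding H_def complete_symmetric_fps[OF J] .
  moreover have "(\<lambda>n. (1 :: complex fps) $ n * x ^ n) sums 1"
    using sums_single[of 0 "\<lambda>_. 1 :: complex"] by (rule sums_cong[THEN iffD1, rotated]) auto
  ultimately show ?thesis using sums_unique2 by blast
qed

text \<open>In a factorisation of p^r each of the d entries is one of r + 1 powers of p.\<close>

lemma divisor_tau_prime_power:
  assumes "prime p"
  shows "divisor_tau d (p ^ r) \<le> (r + 1) ^ d"
proof -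
  let ?A = "\<Pi>\<^sub>E j\<in>{1..d}. (\<lambda>e. p ^ e) ` {..r}"
  have sub: "{f \<in> {1..d} \<rightarrow>\<^sub>E UNIV. (\<Prod>j=1..d. f j) = p ^ r} \<subseteq> ?A"
  proof
    fix f assume f: "f \<in> {f \<in> {1..d} \<rightarrow>\<^sub>E UNIV. (\<Prod>j=1..d. f j) = p ^ r}"
    have "f j \<in> (\<lambda>e. p ^ e) ` {..r}" if "j \<in> {1..d}" for j
    proof -
      have "f j dvd p ^ r" using f that by (metis (mono_tags, lifting) dvd_prodI finite_atLeastAtMost mem_Collect_eq)
      then obtain e where "e \<le> r" "f j = p ^ e" using assms divides_primepow_nat by blast
      thus ?thesis by auto
    qed
    thus "f \<in> ?A" using f by (auto simp: PiE_iff)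
  qed
  have "card ?A = (\<Prod>j\<in>{1..d}. card ((\<lambda>e. p ^ e) ` {..r}))" by (rule card_PiE) simp
  also have "\<dots> \<le> (\<Prod>j\<in>{1..d}. r + 1)"
    using card_image_le[of "{..r}" "\<lambda>e. p ^ e"] by (intro prod_mono) simp
  finally have "card ?A \<le> (r + 1) ^ d" by simp
  moreover have "divisor_tau d (p ^ r) \<le> card ?A"
    unfolding divisor_tau_def by (rule card_mono[OF _ sub]) (intro finite_PiE; simp)
  ultimately show ?thesis by linarith
qed

lemma summable_poly_geometric:
  fixes x :: real
  assumes "0 \<le> x" "x < 1"
  shows "summable (\<lambda>r. (real r + 1) ^ d * x ^ r)"
proof (cases "x = 0")
  case True
  show ?thesis by (rule summable_finite[of "{0}"]) (use True in auto)
next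
  case False
  define c where "c = - ln x / 2"
  have x: "x > 0" using False assms by simp
  have c: "c > 0" using x assms by (simp add: c_def)
  have le: "(real r + 1) ^ d * x ^ r \<le> fact d / c ^ d * exp c * exp (- c) ^ r" for r
  proof -
    have 0: "(c * (real r + 1)) ^ d \<le> fact d * exp (c * (real r + 1))" using c by (intro power_le_fact_exp) simp
    have 1: "(real r + 1) ^ d \<le> fact d / c ^ d * exp (c * (real r + 1))"
    proof -
      have "(real r + 1) ^ d * c ^ d \<le> fact d * exp (c * (real r + 1))"
        using 0 by (simp only: power_mult_distrib mult.commute[of "c ^ d"])
      from mult_imp_le_div_pos[OF _ this] c show ?thesis by simp
    qed
    have "x ^ r = exp (- (2 * c) * real r)" using x by (simp add: c_def exp_of_nat2_mult)
    hence "(real r + 1) ^ d * x ^ r \<le> fact d / c ^ d * exp (c * (real r + 1)) * exp (- (2 * c) * real r)"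
      using mult_right_mono[OF 1, of "x ^ r"] x by simp
    also have "\<dots> = fact d / c ^ d * exp c * exp (- c) ^ r"
      by (simp add: algebra_simps flip: exp_add exp_of_nat_mult)
    finally show ?thesis .
  qed
  have "summable (\<lambda>r. fact d / c ^ d * exp c * exp (- c) ^ r)"
    using c by (intro summable_mult summable_geometric) simp
  thus ?thesis
  proof (rule summable_comparison_test'[where N = 0])
    fix r show "norm ((real r + 1) ^ d * x ^ r) \<le> fact d / c ^ d * exp c * exp (- c) ^ r"
      using le[of r] x by (subst real_norm_def, subst abs_of_nonneg) auto
  qed
qed

text \<open>Polynomially bounded coefficients let the series converge for |x| < 1, where its product
  with the local polynomial is 1. A parameter \<alpha> of modulus above 1 would put the root
  1/\<alpha> of that polynomial inside the unit disc.\<close>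

lemma satake_bounds:
  fixes \<alpha> :: "nat \<Rightarrow> complex"
  assumes bound: "\<And>r. norm (\<Sum>e\<in>tuples_with_sum {1..d} r. \<Prod>j=1..d. \<alpha> j ^ e j) \<le> real ((r + 1) ^ d)"
  shows "j \<in> {1..d} \<Longrightarrow> norm (\<alpha> j) \<le> 1"
    and "norm x < 1 \<Longrightarrow> ((\<lambda>r. (\<Sum>e\<in>tuples_with_sum {1..d} r. \<Prod>j=1..d. \<alpha> j ^ e j) * x ^ r)
      has_sum (\<Prod>j=1..d. inverse (1 - \<alpha> j * x))) UNIV"
proof -
  let ?h = "\<lambda>r. \<Sum>e\<in>tuples_with_sum {1..d} r. \<Prod>j=1..d. \<alpha> j ^ e j"
  have sm: "summable (\<lambda>r. norm (?h r * x ^ r))" if "norm x < 1" for x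
  proof (rule summable_comparison_test'[OF summable_poly_geometric[of "norm x" d], where N = 0])
    fix r
    have "norm (?h r * x ^ r) \<le> real ((r + 1) ^ d) * norm x ^ r"
      unfolding norm_mult norm_power by (intro mult_right_mono bound) auto
    thus "norm (norm (?h r * x ^ r)) \<le> (real r + 1) ^ d * norm x ^ r" by (simp add: add.commute)
  qed (use that in auto)
  have prod1: "(\<Prod>j=1..d. 1 - \<alpha> j * x) * (\<Sum>r. ?h r * x ^ r) = 1" if "norm x < 1" for x
    by (rule complete_symmetric_sums) (use summable_sums[OF summable_norm_cancel[OF sm[OF that]]] in auto)
  show "norm (\<alpha> j) \<le> 1" if j: "j \<in> {1..d}" for j
  proof (rule ccontr)
    assume "\<not> norm (\<alpha> j) \<le> 1"
    hence gt: "norm (\<alpha> j) > 1" by simp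
    hence "norm (1 / \<alpha> j) < 1" by (simp add: norm_divide divide_less_eq)
    from prod1[OF this] have "(\<Prod>i=1..d. 1 - \<alpha> i * (1 / \<alpha> j)) \<noteq> 0" by (metis mult_zero_left zero_neq_one)
    moreover have "(\<Prod>i=1..d. 1 - \<alpha> i * (1 / \<alpha> j)) = 0"
    proof (rule prod_zero[OF finite_atLeastAtMost bexI[OF _ j]])
      show "1 - \<alpha> j * (1 / \<alpha> j) = 0" using gt by auto
    qed
    ultimately show False by simp
  qed
  show "((\<lambda>r. ?h r * x ^ r) has_sum (\<Prod>j=1..d. inverse (1 - \<alpha> j * x))) UNIV" if "norm x < 1"
  proof -
    have "(\<Sum>r. ?h r * x ^ r) = inverse (\<Prod>j=1..d. 1 - \<alpha> j * x)"
      using prod1[OF that] inverse_unique by metis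
    also have "\<dots> = (\<Prod>j=1..d. inverse (1 - \<alpha> j * x))" by (simp add: prod_inversef[symmetric] o_def)
    finally show ?thesis
      using norm_summable_imp_has_sum[OF sm[OF that] summable_sums[OF summable_norm_cancel[OF sm[OF that]]]] by simp
  qed
qed

text \<open>(A1) at prime powers, where the divisor function is polynomial in the exponent, is what
  forces the Satake parameters into the closed unit disc.\<close>

lemma twisted_euler_series:
  assumes F: "L_framework F" and q: "q \<ge> 2" and prim: "primitive_character q chi"
    and A1: "\<And>n. n \<ge> 1 \<Longrightarrow> norm (coeff_of F n) \<le> real (divisor_tau (degree_of F) n)"
  shows "euler_series (degree_of F) (twist_coeff F chi) (twist_satake F chi)"
proof
  have char: "dirichlet_character q chi" using prim by (simp add: primitive_character_def)
  have chi_mult: "chi (m * n) = chi m * chi n" for m n using char by (simp add: dirichlet_character_def)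
  have chi1: "chi 1 = 1" by (rule dirichlet_character_1[OF char])
  have mult: "multiplicative_fn (coeff_of F)" using F by (simp add: L_framework_def)
  have pp: "coeff_of F (p ^ r) = (\<Sum>e\<in>tuples_with_sum {1..degree_of F} r. \<Prod>j=1..degree_of F. satake F p j ^ e j)" if "prime p" for p r
    using F that unfolding L_framework_def tuples_with_sum_def by blast
  have b: "norm (\<Sum>e\<in>tuples_with_sum {1..degree_of F} r. \<Prod>j=1..degree_of F. satake F p j ^ e j) \<le> real ((r + 1) ^ degree_of F)" if p: "prime p" for p r
  proof -
    have "norm (coeff_of F (p ^ r)) \<le> real (divisor_tau (degree_of F) (p ^ r))"
      by (rule A1) (use p in \<open>simp add: prime_gt_0_nat Suc_leI\<close>)
    also have "\<dots> \<le> real ((r + 1) ^ degree_of F)" using divisor_tau_prime_power[OF p] of_nat_le_iff by blast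
    finally show ?thesis unfolding pp[OF p] .
  qed
  show "twist_coeff F chi 1 = 1" using mult chi1 by (simp add: twist_coeff_def multiplicative_fn_def)
  show "twist_coeff F chi (m * n) = twist_coeff F chi m * twist_coeff F chi n" if "coprime m n" for m n
    using mult that by (simp add: twist_coeff_def multiplicative_fn_def chi_mult)
  have chi_le: "norm (chi n) \<le> 1" for n by (rule norm_dirichlet_character_le[OF char])
  show "norm (twist_satake F chi p j) \<le> 1" if "prime p" "j \<in> {1..degree_of F}" for p j
    unfolding twist_satake_def norm_mult
    using satake_bounds(1)[OF b[OF that(1)] that(2)] chi_le[of "int p"] by (simp add: mult_le_one)
  show "((\<lambda>r. twist_coeff F chi (p ^ r) * x ^ r) has_sum (\<Prod>j=1..degree_of F. inverse (1 - twist_satake F chi p j * x))) UNIV"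
    if p: "prime p" and x: "norm x < 1" for p x
  proof -
    have "norm (chi (int p) * x) \<le> 1 * norm x" unfolding norm_mult by (intro mult_right_mono chi_le) simp
    hence "norm (chi (int p) * x) < 1" using x by simp
    from satake_bounds(2)[OF b[OF p] this] have
      "((\<lambda>r. coeff_of F (p ^ r) * (chi (int p) * x) ^ r) has_sum (\<Prod>j=1..degree_of F. inverse (1 - satake F p j * (chi (int p) * x)))) UNIV"
      by (simp add: pp[OF p])
    moreover have "chi (int p ^ r) = chi (int p) ^ r" for r
      by (induction r) (simp_all add: chi_mult chi1)
    ultimately show ?thesis by (simp add: twist_coeff_def twist_satake_def power_mult_distrib mult_ac)
  qed
  show "summable (\<lambda>n. norm (dirichlet_term (twist_coeff F chi) s (Suc n)))" if "Re s > 1" for s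
    using F q prim that unfolding L_framework_def has_euler_product_def by blast
qed

section \<open>Mean values of sieved coefficients\<close>

abbreviation (input) sifted_sum :: "(nat \<Rightarrow> real) \<Rightarrow> real \<Rightarrow> real \<Rightarrow> real \<Rightarrow> real" where
  "sifted_sum l P1 P2 X \<equiv>
     (\<Sum>n | 1 \<le> n \<and> real n \<le> X \<and> coprime n (\<Prod>p | prime p \<and> P1 \<le> real p \<and> real p \<le> P2. p). (l n)\<^sup>2)"

lemma sum_le_of_L2:
  fixes l :: "nat \<Rightarrow> real"
  assumes nn: "\<And>n. l n \<ge> 0" and tot: "(\<Sum>n=1..m. (l n)\<^sup>2) \<le> K' * real m"
  shows "(\<Sum>n=1..m. l n) \<le> sqrt K' * real m"
proof -
  have "(\<Sum>n=1..m. l n)\<^sup>2 \<le> (\<Sum>n=1..m. (l n)\<^sup>2) * real (card {1..m})" by (rule sum_squared_le_sum_of_squares)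
  also have "\<dots> \<le> (K' * real m) * real m" using tot by (intro mult_mono) (auto intro: order_trans[OF sum_nonneg tot])
  finally have "(\<Sum>n=1..m. l n)\<^sup>2 \<le> K' * (real m)\<^sup>2" by (simp add: power2_eq_square mult_ac)
  hence "sqrt ((\<Sum>n=1..m. l n)\<^sup>2) \<le> sqrt (K' * (real m)\<^sup>2)" by (rule real_sqrt_le_mono)
  thus ?thesis by (simp only: real_sqrt_mult real_sqrt_abs abs_of_nat abs_of_nonneg[OF sum_nonneg, OF nn])
qed

text \<open>Integers without prime factors in [P1, P2] are rare in mean square by
  \<open>sift\<close>, and Cauchy-Schwarz applies. Any other integer has a prime factor p \<ge> P1,
  and its weight is at most 1 - v(p) \<le> k P1^(-h).\<close>

lemma sum_sieved_le:
  fixes l :: "nat \<Rightarrow> real"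
  assumes nn: "\<And>n. l n \<ge> 0" and h: "h \<ge> 0"
    and P: "2 \<le> P1" "P1 \<le> P2" "P2 \<le> real m"
    and tot: "(\<Sum>n=1..m. (l n)\<^sup>2) \<le> K' * real m"
    and sift: "sifted_sum l P1 P2 (real m)
        \<le> K * (real m * (ln P1 / ln P2))"
  shows "(\<Sum>n=1..m. l n * sieve_weight h k n)
    \<le> (sqrt (K * (ln P1 / ln P2)) + sqrt K' * (real k * P1 powr (- h))) * real m"
proof -
  let ?w = "sieve_weight h k"
  define Q where "Q = {p. prime p \<and> P1 \<le> real p \<and> real p \<le> P2}"
  define S where "S = {n. 1 \<le> n \<and> real n \<le> real m \<and> coprime n (\<Prod>p\<in>Q. p)}"
  have v: "0 \<le> prime_cutoff h k p \<and> prime_cutoff h k p \<le> 1" for p using prime_cutoff_bounds[OF h] by auto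
  have w: "0 \<le> ?w n" "?w n \<le> 1" for n using prime_weight_bounds[OF v, where P = "{p. prime p}"] by auto
  have small: "?w n \<le> real k * P1 powr (- h)" if n: "n \<ge> 1" "\<not> coprime n (\<Prod>p\<in>Q. p)" for n
  proof -
    obtain p where p: "p \<in> Q" "\<not> coprime n p" using n(2) by (meson prod_coprime_right)
    hence pr: "prime p" "P1 \<le> real p" by (auto simp: Q_def)
    hence "p dvd n" using p(2) prime_imp_coprime[of p n] coprime_commute by blast
    have fin: "finite {p \<in> {p. prime p}. p dvd n}"
      by (rule finite_subset[of _ "{..n}"]) (use n in \<open>auto dest: dvd_imp_le\<close>)
    have mem: "p \<in> {p \<in> {p. prime p}. p dvd n}" using pr \<open>p dvd n\<close> by simp
    have "?w n = (1 - prime_cutoff h k p) * (\<Prod>p\<in>{p \<in> {p. prime p}. p dvd n} - {p}. 1 - prime_cutoff h k p)"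
      unfolding prime_weight_def by (rule prod.remove[OF fin mem])
    also have "\<dots> \<le> (1 - prime_cutoff h k p) * 1"
      using v by (intro mult_left_mono prod_le_1) auto
    also have "\<dots> \<le> real k * real p powr (- h)"
    proof -
      have "real p powr (- h) \<le> 1" using h pr prime_ge_1_nat[OF pr(1)] powr_mono[of "- h" 0 "real p"] by auto
      hence "1 + real k * (- (real p powr (- h))) \<le> (1 + - (real p powr (- h))) ^ k"
        by (intro Bernoulli_inequality) simp
      thus ?thesis by (simp add: prime_cutoff_def)
    qed
    also have "\<dots> \<le> real k * P1 powr (- h)"
      using pr P h by (intro mult_left_mono powr_mono2') auto
    finally show ?thesis .
  qed
  have sub: "S \<subseteq> {1..m}" by (auto simp: S_def)
  have fS: "finite S" by (rule finite_subset[OF sub]) simp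
  have cS: "card S \<le> m" using card_mono[OF _ sub] by simp
  have c0: "real k * P1 powr (- h) \<ge> 0" by simp
  have "(\<Sum>n=1..m. l n * ?w n) \<le> (\<Sum>n=1..m. (if n \<in> S then l n else 0) + (real k * P1 powr (- h)) * l n)"
  proof (rule sum_mono)
    fix n assume n: "n \<in> {1..m}"
    show "l n * ?w n \<le> (if n \<in> S then l n else 0) + (real k * P1 powr (- h)) * l n"
    proof (cases "n \<in> S")
      case True
      have "l n * ?w n \<le> l n" using w nn by (simp add: mult_left_le)
      moreover have "(real k * P1 powr (- h)) * l n \<ge> 0" using c0 nn by (rule mult_nonneg_nonneg)
      ultimately show ?thesis using True by simp
    next
      case False
      hence "\<not> coprime n (\<Prod>p\<in>Q. p)" using n by (auto simp: S_def)
      hence "l n * ?w n \<le> l n * (real k * P1 powr (- h))" using small[of n] n nn by (intro mult_left_mono) auto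
      thus ?thesis using False by (simp add: mult.commute)
    qed
  qed
  also have "\<dots> = (\<Sum>n\<in>S. l n) + (real k * P1 powr (- h)) * (\<Sum>n=1..m. l n)"
    using sub by (simp add: sum.distrib sum_distrib_left sum.If_cases Int_absorb1)
  also have "\<dots> \<le> sqrt (K * (ln P1 / ln P2)) * real m + (real k * P1 powr (- h)) * (sqrt K' * real m)"
  proof (rule add_mono[OF _ mult_left_mono[OF sum_le_of_L2[OF nn tot] c0]])
    have "(\<Sum>n\<in>S. l n)\<^sup>2 \<le> (\<Sum>n\<in>S. (l n)\<^sup>2) * real (card S)" by (rule sum_squared_le_sum_of_squares)
    also have "\<dots> \<le> (K * (real m * (ln P1 / ln P2))) * real m"
    proof (intro mult_mono)
      show le: "(\<Sum>n\<in>S. (l n)\<^sup>2) \<le> K * (real m * (ln P1 / ln P2))" using sift unfolding S_def Q_def .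
      show "0 \<le> K * (real m * (ln P1 / ln P2))" by (rule order_trans[OF _ le]) (simp add: sum_nonneg)
    qed (use cS in auto)
    finally have "(\<Sum>n\<in>S. l n)\<^sup>2 \<le> (K * (ln P1 / ln P2)) * (real m)\<^sup>2" by (simp add: power2_eq_square mult_ac)
    hence "sqrt ((\<Sum>n\<in>S. l n)\<^sup>2) \<le> sqrt ((K * (ln P1 / ln P2)) * (real m)\<^sup>2)" by (rule real_sqrt_le_mono)
    thus "(\<Sum>n\<in>S. l n) \<le> sqrt (K * (ln P1 / ln P2)) * real m"
      by (simp only: real_sqrt_mult real_sqrt_abs abs_of_nat abs_of_nonneg[OF sum_nonneg, OF nn])
  qed
  finally show ?thesis by (simp add: algebra_simps)
qed

text \<open>The good bound for partial sums starts only at Q. The majorant \<open>\<phi>\<close>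
  adds \<open>C0\<close> on the first Q integers, so that the loss is governed by Q alone.\<close>

lemma weighted_sums_le:
  fixes f :: "nat \<Rightarrow> real"
  assumes small: "\<And>m. (\<Sum>n=1..m. f n) \<le> C0 * real m"
    and large: "\<And>m. m \<ge> Q \<Longrightarrow> (\<Sum>n=1..m. f n) \<le> \<kappa> * real m"
    and pos: "C0 \<ge> 0" "\<kappa> \<ge> 0" and QM: "1 \<le> Q" "Q \<le> M"
  shows "0 < a \<Longrightarrow> a < 1 \<Longrightarrow> (\<Sum>n=1..M. f n * real n powr (- a))
      \<le> (\<kappa> * real M powr (1 - a) + C0 * real Q powr (1 - a)) / (1 - a)"
    and "(\<And>n. f n \<ge> 0) \<Longrightarrow> (\<Sum>n\<in>{M<..B}. f n * (1 / (real n)\<^sup>2)) \<le> 2 * \<kappa> / real M + C0 * real Q / (real M)\<^sup>2"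
proof -
  define \<phi> where "\<phi> n = \<kappa> + (if n \<le> Q then C0 else 0)" for n
  have phi_sum: "(\<Sum>n=1..m. \<phi> n * g n) = \<kappa> * (\<Sum>n=1..m. g n) + C0 * (\<Sum>n=1..min m Q. g n)" for m and g :: "nat \<Rightarrow> real"
  proof -
    have "(\<Sum>n=1..m. (if n \<le> Q then C0 else 0) * g n) = (\<Sum>n=1..min m Q. C0 * g n)"
      by (rule sum.mono_neutral_cong_right) auto
    thus ?thesis by (simp add: \<phi>_def distrib_right sum.distrib sum_distrib_left)
  qed
  have maj: "(\<Sum>n=1..m. f n) \<le> (\<Sum>n=1..m. \<phi> n)" for m
  proof -
    have "(\<Sum>n=1..m. \<phi> n) = \<kappa> * real m + C0 * real (min m Q)" using phi_sum[of "\<lambda>_. 1" m] by simp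
    thus ?thesis using small[of m] large[of m] pos
      by (cases "m \<ge> Q") (auto simp: min_def intro: add_increasing add_increasing2)
  qed
  show "(\<Sum>n=1..M. f n * real n powr (- a)) \<le> (\<kappa> * real M powr (1 - a) + C0 * real Q powr (1 - a)) / (1 - a)"
    if a: "0 < a" "a < 1"
  proof -
    have "(\<Sum>n=1..M. f n * real n powr (- a)) \<le> (\<Sum>n=1..M. \<phi> n * real n powr (- a))"
      by (rule sum_majorize, rule maj) (use a in \<open>auto intro!: powr_mono2'\<close>)
    also have "\<dots> \<le> \<kappa> * (real M powr (1 - a) / (1 - a)) + C0 * (real Q powr (1 - a) / (1 - a))"
      unfolding phi_sum using sum_powr_le[OF a, of M] sum_powr_le[OF a, of Q] QM pos
      by (intro add_mono mult_left_mono) (auto simp: min_absorb2)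
    finally show ?thesis by (simp add: add_divide_distrib)
  qed
  show "(\<Sum>n\<in>{M<..B}. f n * (1 / (real n)\<^sup>2)) \<le> 2 * \<kappa> / real M + C0 * real Q / (real M)\<^sup>2" if f: "\<And>n. f n \<ge> 0"
  proof (cases "B \<ge> M")
    case True
    define g where "g n = (if n \<le> M then 1 / (real M)\<^sup>2 else 1 / (real n)\<^sup>2)" for n
    have M: "M \<ge> 1" using QM by simp
    have dec: "g (Suc n) \<le> g n" if "n \<ge> 1" for n
      using that M by (auto simp: g_def intro!: frac_le power_mono)
    have "(\<Sum>n\<in>{M<..B}. f n * (1 / (real n)\<^sup>2)) = (\<Sum>n\<in>{M<..B}. f n * g n)" by (simp add: g_def)
    also have "\<dots> \<le> (\<Sum>n=1..B. f n * g n)"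
      by (intro sum_mono2) (use f in \<open>auto simp: g_def\<close>)
    also have "\<dots> \<le> (\<Sum>n=1..B. \<phi> n * g n)"
      by (rule sum_majorize, rule maj, rule dec) (auto simp: g_def)
    also have "\<dots> = \<kappa> * (\<Sum>n=1..B. g n) + C0 * (\<Sum>n=1..Q. g n)"
      unfolding phi_sum using True QM by (simp add: min_absorb2)
    also have "\<dots> \<le> \<kappa> * (2 / real M) + C0 * (\<Sum>n=1..Q. g n)"
    proof (rule add_right_mono, rule mult_left_mono[OF _ pos(2)])
      have "{1..B} = {1..M} \<union> {M<..B}" using True M by auto
      hence "(\<Sum>n=1..B. g n) = (\<Sum>n=1..M. g n) + (\<Sum>n\<in>{M<..B}. g n)"
        by (simp add: sum.union_disjoint disjoint_iff)
      also have "(\<Sum>n=1..M. g n) = 1 / real M" using M by (simp add: g_def power2_eq_square)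
      also have "(\<Sum>n\<in>{M<..B}. g n) = (\<Sum>n\<in>{M<..B}. 1 / (real n)\<^sup>2)" by (simp add: g_def)
      also have "\<dots> \<le> 1 / real M - 1 / real B" by (rule sum_inverse_squares_tail[OF M True])
      also have "1 / real M + (1 / real M - 1 / real B) \<le> 2 / real M" by simp
      finally show "(\<Sum>n=1..B. g n) \<le> 2 / real M" by simp
    qed
    also have "(\<Sum>n=1..Q. g n) = real Q / (real M)\<^sup>2" using QM by (simp add: g_def)
    finally show ?thesis by (simp add: mult.commute)
  next
    case False
    thus ?thesis using pos by simp
  qed
qed

section \<open>Cancellation near the edge of the zero-free region\<close>

context euler_series
begin

text \<open>The disc around 1 + r/4 reaches left only to 1 - 3r/4, and at its centre the Euler
  product bounds the logarithm. Borel-Caratheodory costs half the radius. The evaluation point is at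
  most r/4 from the centre, and k differences with \<rho> = r/(16k) use up another r/8.\<close>

theorem fin_diff_log_bound:
  assumes r: "0 < r" "r \<le> 1" and holo: "f holomorphic_on ball (Complex (1 + r / 4) t) r"
    and nz: "\<And>z. z \<in> ball (Complex (1 + r / 4) t) r \<Longrightarrow> f z \<noteq> 0"
    and bound: "\<And>z. z \<in> ball (Complex (1 + r / 4) t) r \<Longrightarrow> norm (f z) \<le> exp M"
    and series: "\<And>s. Re s > 1 \<Longrightarrow> f s = dirichlet_series a s"
    and M: "M \<ge> 0" and k: "k \<ge> 1" and h: "0 \<le> h" "h \<le> r / (16 * real k)" and \<delta>: "0 < \<delta>" "\<delta> \<le> r / 4"
  shows "norm (fin_diff (of_real h) k log_series (Complex (1 + \<delta>) t))
    \<le> (16 * real k * h / r) ^ k * (2 * (M + 1) + 6 * real d * (1 + 4 / r))"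
proof -
  define c where "c = Complex (1 + r / 4) t"
  define s where "s = Complex (1 + \<delta>) t"
  have c1: "Re c > 1" using r by (simp add: c_def)
  obtain g0 where g0: "g0 holomorphic_on ball c r" "\<And>z. z \<in> ball c r \<Longrightarrow> exp (g0 z) = f z"
    using holomorphic_logarithm_exists[of "ball c r" f c] holo nz r unfolding c_def by (auto simp: convex_ball)
  \<comment> \<open>The additive constant has exponential 1 and makes the branch agree with
    \<open>log_series\<close> at the centre.\<close>
  define g where "g z = g0 z + (log_series c - g0 c)" for z
  have "exp (log_series c - g0 c) = 1"
    using exp_log_series[OF c1] g0(2)[of c] series[OF c1] nz[of c] r by (simp add: exp_diff c_def)
  hence eg: "exp (g z) = f z" if "z \<in> ball c r" for z
    using g0(2)[OF that] by (simp add: g_def exp_add)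
  have hg: "g holomorphic_on ball c r" unfolding g_def by (intro holomorphic_intros g0)
  define E where "E = 2 * real d * (1 + 4 / r)"
  have E: "E \<ge> 0" using r by (simp add: E_def)
  have gc: "norm (g c) \<le> E"
    using summable_log_factor(2)[OF c1] by (simp add: g_def E_def c_def)
  have Re_g: "Re (g z) < M + 1" if z: "z \<in> ball c r" for z
  proof -
    have "exp (Re (g z)) = norm (f z)" using eg[OF z] by (metis norm_exp_eq_Re)
    also have "\<dots> \<le> exp M" using bound z by (simp add: c_def)
    finally show ?thesis by simp
  qed
  have gb: "norm (g z) \<le> 2 * (M + 1) + 3 * E" if z: "z \<in> ball c (r / 2)" for z
  proof -
    have "norm (g z - g c) \<le> 2 * (r / 2) / (r - r / 2) * (M + 1 - Re (g c))"
      by (rule Borel_Caratheodory[OF hg r(1) Re_g]) (use z r in \<open>auto simp: dist_norm norm_minus_commute\<close>)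
    also have "\<dots> = 2 * (M + 1 - Re (g c))" using r by (simp add: field_simps)
    also have "\<dots> \<le> 2 * (M + 1 + E)" using gc abs_Re_le_cmod[of "g c"] by simp
    finally show ?thesis using norm_triangle_sub[of "g z" "g c"] gc by simp
  qed
  define \<rho> where "\<rho> = r / (16 * real k)"
  have \<rho>: "\<rho> > 0" using r k by (simp add: \<rho>_def)
  have \<rho>k: "\<rho> * real k = r / 16" using k by (simp add: \<rho>_def field_simps)
  have dcs: "dist c s \<le> r / 4"
  proof -
    have "dist c s = \<bar>r / 4 - \<delta>\<bar>" by (simp add: c_def s_def dist_norm cmod_def)
    thus ?thesis using \<delta> by simp
  qed
  have "norm (fin_diff (of_real h) k g s) \<le> (norm (of_real h :: complex) / \<rho>) ^ k * (2 * (M + 1) + 3 * E)"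
  proof (rule norm_fin_diff_le)
    show "g holomorphic_on ball c (r / 2)" by (rule holomorphic_on_subset[OF hg]) (use r in auto)
    show "norm (of_real h :: complex) \<le> \<rho>" using h by (simp add: \<rho>_def)
    have "dist c s + 2 * \<rho> * real k \<le> r / 4 + 2 * (r / 16)" using dcs \<rho>k by simp
    also have "\<dots> < r / 2" using r by simp
    finally show "dist c s + 2 * \<rho> * real k < r / 2" .
  qed (use gb \<rho> in auto)
  also have "norm (of_real h :: complex) / \<rho> = 16 * real k * h / r" using h k by (simp add: \<rho>_def field_simps)
  also have "fin_diff (of_real h) k g s = fin_diff (of_real h) k log_series s"
  proof (rule fin_diff_cong)
    fix j assume j: "j \<le> k"
    \<comment> \<open>All sample points lie in this convex set, on which the two branches of the
      logarithm agree.\<close>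
    let ?S = "ball c r \<inter> {z. Re z > 1}"
    have "real j * h \<le> real k * \<rho>" using j h \<rho> unfolding \<rho>_def[symmetric] by (intro mult_mono) auto
    hence jh: "real j * h \<le> r / 16" using \<rho>k by (simp add: mult.commute)
    have "dist c (s + of_nat j * of_real h) \<le> dist c s + norm (of_nat j * of_real h :: complex)"
      by (metis dist_norm dist_triangle add_diff_cancel_left' dist_commute)
    also have "norm (of_nat j * of_real h :: complex) = real j * h" using h by (simp add: norm_mult)
    finally have mem: "s + of_nat j * of_real h \<in> ?S" using dcs jh r \<delta> h by (simp add: s_def add_pos_nonneg)
    show "g (s + of_nat j * of_real h) = log_series (s + of_nat j * of_real h)"
    proof (rule log_series_unique[where S = ?S and ?z0.0 = c and g = g and z = "s + of_nat j * of_real h"])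
      show "open ?S" by (intro open_Int open_halfspace_Re_gt) auto
      show "connected ?S" by (intro convex_connected convex_Int convex_halfspace_Re_gt) auto
      show "g holomorphic_on ?S" by (rule holomorphic_on_subset[OF hg]) auto
      show "exp (g z) = dirichlet_series a z" if "z \<in> ?S" for z using eg[of z] series[of z] that by simp
    qed (use mem c1 r in \<open>auto simp: g_def\<close>)
  qed
  finally show ?thesis by (simp add: s_def E_def mult.assoc)
qed

text \<open>U exp(\<Delta>) equals L up to a relative error, and exp(-\<Delta>) is within 3
  \<epsilon> of 1. The contributions 3 and 3 * 2 give 9, rounded up to 12.\<close>

lemma log_diff_to_sieved_error:
  assumes h: "h \<ge> 0" and s: "Re s > 1"
    and D: "norm (fin_diff (of_real h) k log_series s) \<le> \<epsilon>" "\<epsilon> \<le> 1"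
    and C: "sieve_const d k * (3 * fact k * (2 * h) ^ k) \<le> \<epsilon>"
  shows "norm (dirichlet_series a s - sieved_series h k s) \<le> norm (dirichlet_series a s) * (12 * \<epsilon>)"
proof -
  define \<Delta> where "\<Delta> = fin_diff (of_real h) k log_series s"
  define L where "L = dirichlet_series a s"
  define U where "U = sieved_series h k s"
  have e0: "\<epsilon> \<ge> 0" using D(1) norm_ge_zero order_trans by blast
  have ex: "exp \<epsilon> - 1 \<le> 2 * \<epsilon>"
    using exp_bound[of \<epsilon>] e0 D(2) mult_left_mono[of \<epsilon> 1 \<epsilon>] by (simp add: power2_eq_square)
  have "norm (U * exp \<Delta> - L) \<le> norm L * (exp (sieve_const d k * (3 * fact k * (2 * h) ^ k)) - 1)"
    unfolding U_def L_def \<Delta>_def by (rule sieved_series_approx[OF h s])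
  also have "\<dots> \<le> norm L * (2 * \<epsilon>)" using C ex by (intro mult_left_mono) (auto intro: order_trans[OF _ ex])
  finally have 1: "norm (U * exp \<Delta> - L) \<le> norm L * (2 * \<epsilon>)" .
  have e3: "exp \<epsilon> \<le> 3" using ex D(2) by linarith
  have ne: "norm (exp (- \<Delta>)) \<le> 3"
  proof -
    have "norm (exp (- \<Delta>)) \<le> exp (norm (- \<Delta>))" by (rule norm_exp)
    also have "\<dots> \<le> exp \<epsilon>" using D(1) by (simp add: \<Delta>_def)
    finally show ?thesis using e3 by linarith
  qed
  have n1: "norm (1 - exp (- \<Delta>)) \<le> 3 * \<epsilon>"
  proof -
    have "norm (exp (- \<Delta>) - 1) \<le> exp \<bar>Re (- \<Delta>)\<bar> * norm (- \<Delta>)" using Taylor_exp[of "- \<Delta>" 0] by simp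
    also have "\<dots> \<le> exp \<epsilon> * \<epsilon>"
      using D(1) abs_Re_le_cmod[of \<Delta>] unfolding \<Delta>_def[symmetric] by (intro mult_mono) auto
    also have "\<dots> \<le> 3 * \<epsilon>" using e3 e0 by (rule mult_right_mono)
    finally show ?thesis by (simp add: norm_minus_commute)
  qed
  have "L - U = L * (1 - exp (- \<Delta>)) - exp (- \<Delta>) * (U * exp \<Delta> - L)"
    by (simp add: algebra_simps flip: exp_add)
  hence "norm (L - U) \<le> norm L * norm (1 - exp (- \<Delta>)) + norm (exp (- \<Delta>)) * norm (U * exp \<Delta> - L)"
    by (metis norm_mult norm_triangle_ineq4)
  also have "\<dots> \<le> norm L * (3 * \<epsilon>) + 3 * (norm L * (2 * \<epsilon>))"
    by (intro add_mono mult_mono mult_left_mono n1 ne 1) auto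
  also have "\<dots> \<le> norm L * (12 * \<epsilon>)" using mult_nonneg_nonneg[OF norm_ge_zero[of L] e0] by (simp add: algebra_simps)
  finally show ?thesis by (simp add: L_def U_def)
qed

end

lemma norm_suminf_le_of_partial:
  fixes f :: "nat \<Rightarrow> complex"
  assumes "summable (\<lambda>n. norm (f n))" "\<And>N. (\<Sum>n<N. norm (f n)) \<le> B"
  shows "norm (\<Sum>n. f n) \<le> B"
  by (rule order_trans[OF summable_norm[OF assms(1)] suminf_le_const[OF assms]])

text \<open>Only averages of the majorant are controlled, so summation by parts replaces it by the
  constant \<open>C0\<close> and leaves a zeta sum.\<close>

lemma norm_dirichlet_series_le:
  assumes a: "\<And>n. norm (a n) \<le> l n" and l: "\<And>n. l n \<ge> 0"
    and part: "\<And>m. (\<Sum>n=1..m. l n) \<le> C0 * real m" and C0: "C0 \<ge> 0"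
    and sm: "summable (\<lambda>n. norm (dirichlet_term a s (Suc n)))" and s: "Re s \<ge> 1 + x" "x > 0"
  shows "norm (dirichlet_series a s) \<le> C0 * (1 + 1 / x)"
  unfolding dirichlet_series_def
proof (rule norm_suminf_le_of_partial[OF sm])
  fix N
  have "(\<Sum>n<N. norm (dirichlet_term a s (Suc n))) = (\<Sum>n=1..N. norm (dirichlet_term a s n))"
    by (rule sum.reindex_bij_witness[where i = "\<lambda>n. n - 1" and j = Suc]) auto
  also have "\<dots> \<le> (\<Sum>n=1..N. l n * real n powr (- 1 - x))"
    unfolding norm_dirichlet_term using s by (intro sum_mono mult_mono a l powr_mono) auto
  also have "\<dots> \<le> (\<Sum>n=1..N. C0 * real n powr (- 1 - x))"
  proof (rule sum_majorize)
    show "(\<Sum>n=1..m. l n) \<le> (\<Sum>n=1..m. C0)" for m using part[of m] by (simp add: mult.commute)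
  qed (use s in \<open>auto intro!: powr_mono2'\<close>)
  also have "\<dots> = C0 * (\<Sum>n=1..N. real n powr (- 1 - x))" by (simp add: sum_distrib_left)
  also have "\<dots> \<le> C0 * (1 + 1 / x)" by (intro mult_left_mono sum_powr_minus_one_minus_le s C0)
  finally show "(\<Sum>n<N. norm (dirichlet_term a s (Suc n))) \<le> C0 * (1 + 1 / x)" .
qed

lemma vertical_integral_sum3:
  assumes "\<And>i. i < (3::nat) \<Longrightarrow> continuous_on {z. Re z = b} (f i)"
    and "\<And>i y. i < 3 \<Longrightarrow> norm (f i (Complex b y)) \<le> C i / (1 + y\<^sup>2)"
  shows "vertical_integral b (\<lambda>z. f 0 z + f 1 z + f 2 z) = vertical_integral b (f 0) + vertical_integral b (f 1) + vertical_integral b (f 2)"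
proof -
  have c: "continuous_on {z. Re z = b} (\<lambda>z. f 0 z + f 1 z)" by (intro continuous_intros assms) auto
  have n: "norm (f 0 (Complex b y) + f 1 (Complex b y)) \<le> (C 0 + C 1) / (1 + y\<^sup>2)" for y
    using norm_triangle_mono[OF assms(2)[of 0 y] assms(2)[of 1 y]] by (simp add: add_divide_distrib)
  have "vertical_integral b (\<lambda>z. (f 0 z + f 1 z) + f 2 z) = vertical_integral b (\<lambda>z. f 0 z + f 1 z) + vertical_integral b (f 2)"
    by (rule vertical_integral_add[OF c _ n assms(2)]) (use assms in auto)
  also have "vertical_integral b (\<lambda>z. f 0 z + f 1 z) = vertical_integral b (f 0) + vertical_integral b (f 1)"
    by (rule vertical_integral_add[OF _ _ assms(2) assms(2)]) (use assms in auto)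
  finally show ?thesis .
qed

context euler_series
begin

text \<open>Three pieces, each on its own line. The head of U is a Dirichlet polynomial and moves to
  \<open>\<sigma>1\<close> < 1/2, where its largest n dominate; the tail stays at 3/2, where it
  converges absolutely; L - U moves to 1/2 + \<delta>, where \<open>near\<close> holds. For M about
  X, head and tail both come out as \<kappa> times X^(1/2), apart from the terms with Q.\<close>

theorem kernel_integral_bound:
  fixes K :: "complex \<Rightarrow> complex" and l :: "nat \<Rightarrow> real" and M Q :: nat
  assumes \<sigma>: "0 \<le> \<sigma>0" "\<sigma>0 < \<sigma>1" "\<sigma>1 < 1 / 2"
    and Kh: "K holomorphic_on {s. Re s > \<sigma>0}"
    and Kb: "\<And>s. \<sigma>1 \<le> Re s \<Longrightarrow> Re s \<le> 3 / 2 \<Longrightarrow> norm (K s) \<le> A * X powr (Re s) * exp (- \<bar>Im s\<bar>) / (1 + (Im s)\<^sup>2)"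
    and A: "A \<ge> 0" and X: "X \<ge> 1" and h: "h \<ge> 0"
    and al: "\<And>n. norm (a n) \<le> l n"
    and small: "\<And>m. (\<Sum>n=1..m. l n * sieve_weight h k n) \<le> C0 * real m"
    and large: "\<And>m. m \<ge> Q \<Longrightarrow> (\<Sum>n=1..m. l n * sieve_weight h k n) \<le> \<kappa> * real m"
    and pos: "C0 \<ge> 0" "\<kappa> \<ge> 0" and QM: "1 \<le> Q" "Q \<le> M"
    and \<delta>: "0 < \<delta>" "\<delta> \<le> 1"
    and near: "\<And>t. norm (dirichlet_series a (Complex (1 + \<delta>) t) - sieved_series h k (Complex (1 + \<delta>) t)) * exp (- \<bar>t\<bar>) \<le> \<epsilon>"
  shows "norm (vertical_integral (3 / 2) (\<lambda>s. dirichlet_series a (1 / 2 + s) * K s)) \<le>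
    cauchy_weight * A *
      (X powr \<sigma>1 * ((\<kappa> * real M powr (1 / 2 - \<sigma>1) + C0 * real Q powr (1 / 2 - \<sigma>1)) / (1 / 2 - \<sigma>1))
       + X powr (3 / 2) * (2 * \<kappa> / real M + C0 * real Q / (real M)\<^sup>2)
       + X powr (1 / 2 + \<delta>) * \<epsilon>)"
proof -
  define u where "u n = a n * of_real (sieve_weight h k n)" for n
  define f where "f n = l n * sieve_weight h k n" for n
  have v: "0 \<le> prime_cutoff h k p \<and> prime_cutoff h k p \<le> 1" for p using prime_cutoff_bounds[OF h] by auto
  have w: "0 \<le> sieve_weight h k n" for n using prime_weight_bounds[OF v] by auto
  have l0: "l n \<ge> 0" for n using al[of n] norm_ge_zero order_trans by blast
  have uf: "norm (u n) \<le> f n" for n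
    unfolding u_def f_def norm_mult using al[of n] w[of n] by (simp add: mult_right_mono)
  have f0: "f n \<ge> 0" for n unfolding f_def using l0 w by simp
  have usm: "summable (\<lambda>n. norm (dirichlet_term u s (Suc n)))" if "Re s > 1" for s
    using summable_sieved[OF that h] unfolding u_def .
  have U: "sieved_series h k = dirichlet_series u" unfolding sieved_series_def u_def ..
  define U1 where "U1 s = (\<Sum>n=1..M. dirichlet_term u s n)" for s
  define U2 where "U2 s = dirichlet_series u s - U1 s" for s
  define S1 where "S1 = (\<kappa> * real M powr (1 / 2 - \<sigma>1) + C0 * real Q powr (1 / 2 - \<sigma>1)) / (1 / 2 - \<sigma>1)"
  define S2 where "S2 = 2 * \<kappa> / real M + C0 * real Q / (real M)\<^sup>2"
  have U1_holo: "(\<lambda>s. U1 (1 / 2 + s)) holomorphic_on S" for S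
  proof -
    have "U1 holomorphic_on UNIV" unfolding U1_def[abs_def] by (intro holomorphic_intros holomorphic_dirichlet_term)
    thus ?thesis by (intro holomorphic_on_compose_gen[of "\<lambda>s. 1 / 2 + s" S U1 UNIV, unfolded o_def] holomorphic_intros) auto
  qed
  have U1_le: "norm (U1 (1 / 2 + s)) \<le> S1" if "Re s \<ge> \<sigma>1" for s
  proof -
    have "norm (U1 (1 / 2 + s)) \<le> (\<Sum>n=1..M. f n * real n powr (- (1 / 2 + \<sigma>1)))"
      unfolding U1_def
    proof (rule sum_norm_le)
      fix n assume n: "n \<in> {1..M}"
      show "norm (dirichlet_term u (1 / 2 + s) n) \<le> f n * real n powr (- (1 / 2 + \<sigma>1))"
        unfolding norm_dirichlet_term using n that by (intro mult_mono uf f0 powr_mono) auto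
    qed
    also have "\<dots> \<le> (\<kappa> * real M powr (1 - (1 / 2 + \<sigma>1)) + C0 * real Q powr (1 - (1 / 2 + \<sigma>1))) / (1 - (1 / 2 + \<sigma>1))"
      by (rule weighted_sums_le(1)[of f C0 Q \<kappa> M]) (use small large pos QM \<sigma> in \<open>auto simp: f_def\<close>)
    also have "1 - (1 / 2 + \<sigma>1) = 1 / 2 - \<sigma>1" by simp
    finally show ?thesis by (simp add: S1_def)
  qed
  have S1_0: "S1 \<ge> 0" using order_trans[OF norm_ge_zero U1_le[of "of_real \<sigma>1"]] by simp
  have U2_le: "norm (U2 (1 / 2 + s)) \<le> S2" if s: "Re s = 3 / 2" for s
  proof -
    let ?z = "1 / 2 + s"
    have z: "Re ?z = 2" using s by simp
    have sm: "summable (\<lambda>n. norm (dirichlet_term u ?z (Suc n)))" by (rule usm) (use z in simp)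
    have "(\<Sum>n. dirichlet_term u ?z (Suc n)) = (\<Sum>n. dirichlet_term u ?z (Suc (n + M))) + (\<Sum>n<M. dirichlet_term u ?z (Suc n))"
      by (rule suminf_split_initial_segment[OF summable_norm_cancel[OF sm]])
    moreover have "(\<Sum>n<M. dirichlet_term u ?z (Suc n)) = U1 ?z"
      unfolding U1_def by (rule sum.reindex_bij_witness[where i = "\<lambda>n. n - 1" and j = Suc]) auto
    ultimately have "U2 ?z = (\<Sum>n. dirichlet_term u ?z (Suc (n + M)))"
      unfolding U2_def dirichlet_series_def by simp
    also have "norm \<dots> \<le> S2"
    proof (rule norm_suminf_le_of_partial)
      show "summable (\<lambda>n. norm (dirichlet_term u ?z (Suc (n + M))))"
        using summable_ignore_initial_segment[OF sm, of M] by simp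
      fix B
      have "(\<Sum>n<B. norm (dirichlet_term u ?z (Suc (n + M)))) = (\<Sum>n\<in>{M<..M + B}. norm (dirichlet_term u ?z n))"
        by (rule sum.reindex_bij_witness[where i = "\<lambda>n. n - M - 1" and j = "\<lambda>n. Suc (n + M)"]) auto
      also have "\<dots> \<le> (\<Sum>n\<in>{M<..M + B}. f n * (1 / (real n)\<^sup>2))"
      proof (rule sum_mono)
        fix n assume "n \<in> {M<..M + B}"
        hence n: "n > 0" by simp
        have "real n powr (- 2) = 1 / (real n)\<^sup>2" using n by (simp add: powr_minus field_simps)
        thus "norm (dirichlet_term u ?z n) \<le> f n * (1 / (real n)\<^sup>2)"
          unfolding norm_dirichlet_term z using uf[of n] by (simp add: divide_right_mono)
      qed
      also have "\<dots> \<le> S2" unfolding S2_def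
        by (rule weighted_sums_le(2)[of f C0 Q \<kappa> M]) (use small large pos QM f0 in \<open>auto simp: f_def\<close>)
      finally show "(\<Sum>n<B. norm (dirichlet_term u ?z (Suc (n + M)))) \<le> S2" .
    qed
    finally show ?thesis .
  qed
  have S2_0: "S2 \<ge> 0" using pos by (simp add: S2_def)
  have shift_holo: "(\<lambda>s. dirichlet_series b (1 / 2 + s)) holomorphic_on {s. 1 / 2 < Re s \<and> Re s < 2}"
    if "\<And>s. Re s > 1 \<Longrightarrow> summable (\<lambda>n. norm (dirichlet_term b s (Suc n)))" for b
    by (rule holomorphic_on_compose_gen[OF _ holomorphic_dirichlet_series[OF that], unfolded o_def])
       (auto intro!: holomorphic_intros)
  have Kholo: "K holomorphic_on S" if "\<And>s. s \<in> S \<Longrightarrow> Re s > \<sigma>0" for S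
    using that by (intro holomorphic_on_subset[OF Kh]) auto
  \<comment> \<open>A wasteful bound with X^(3/2) on the whole strip: it only licenses the shifts,
    while \<open>line\<close> below keeps the true power of X.\<close>
  define bnd where "bnd C = C * A * X powr (3 / 2)" for C
  have Kb': "norm (g * K s) \<le> bnd C / (1 + (Im s)\<^sup>2)" if "norm g \<le> C" "\<sigma>1 \<le> Re s" "Re s \<le> 3 / 2" for g s C
  proof -
    have C: "C \<ge> 0" using that(1) norm_ge_zero order_trans by blast
    have "norm (K s) \<le> A * X powr (Re s) * exp (- \<bar>Im s\<bar>) / (1 + (Im s)\<^sup>2)" by (rule Kb) fact+
    also have "\<dots> \<le> A * X powr (3 / 2) * 1 / (1 + (Im s)\<^sup>2)"
      using A X that by (intro divide_right_mono mult_mono powr_mono) auto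
    finally have "norm g * norm (K s) \<le> C * (A * X powr (3 / 2) * 1 / (1 + (Im s)\<^sup>2))"
      using that(1) C by (intro mult_mono) auto
    thus ?thesis by (simp add: norm_mult bnd_def mult.assoc)
  qed
  have series_bd: "\<exists>C. \<forall>s. Re s \<ge> 1 / 2 + \<delta> \<longrightarrow> norm (dirichlet_series b (1 / 2 + s)) \<le> C"
    if "\<And>s. Re s > 1 \<Longrightarrow> summable (\<lambda>n. norm (dirichlet_term b s (Suc n)))" for b
  proof (intro exI allI impI)
    fix s assume s: "Re s \<ge> 1 / 2 + \<delta>"
    let ?x = "of_real (1 + \<delta>) :: complex"
    have sm: "summable (\<lambda>n. norm (dirichlet_term b ?x (Suc n)))" by (rule that) (use \<delta> in simp)
    have "norm (dirichlet_series b (1 / 2 + s)) \<le> (\<Sum>n. norm (dirichlet_term b ?x (Suc n)))"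
      unfolding dirichlet_series_def
    proof (rule norm_suminf_le[OF _ sm])
      fix n show "norm (dirichlet_term b (1 / 2 + s) (Suc n)) \<le> norm (dirichlet_term b ?x (Suc n))"
        unfolding norm_dirichlet_term using s by (intro mult_left_mono powr_mono) auto
    qed
    thus "norm (dirichlet_series b (1 / 2 + s)) \<le> (\<Sum>n. norm (dirichlet_term b ?x (Suc n)))" .
  qed
  obtain CL where CL: "\<And>s. Re s \<ge> 1 / 2 + \<delta> \<Longrightarrow> norm (dirichlet_series a (1 / 2 + s)) \<le> CL"
    using series_bd[of a] summ by blast
  obtain CU where CU: "\<And>s. Re s \<ge> 1 / 2 + \<delta> \<Longrightarrow> norm (dirichlet_series u (1 / 2 + s)) \<le> CU"
    using series_bd[of u] usm by blast
  define D where "D s = dirichlet_series a s - dirichlet_series u s" for s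
  have D_le: "norm (D (1 / 2 + s)) \<le> CL + CU" if "Re s \<ge> 1 / 2 + \<delta>" for s
    unfolding D_def using norm_triangle_mono[OF CL[OF that], of "- dirichlet_series u (1 / 2 + s)" CU] CU[OF that] by simp
  have hU1: "(\<lambda>s. U1 (1 / 2 + s) * K s) holomorphic_on {s. \<sigma>0 < Re s \<and> Re s < 2}"
    by (intro holomorphic_intros U1_holo Kholo) auto
  have hD: "(\<lambda>s. D (1 / 2 + s) * K s) holomorphic_on {s. 1 / 2 < Re s \<and> Re s < 2}"
    unfolding D_def by (intro holomorphic_intros shift_holo Kholo) (use summ usm \<sigma> in auto)
  have hU2: "(\<lambda>s. U2 (1 / 2 + s) * K s) holomorphic_on {s. 1 / 2 < Re s \<and> Re s < 2}"
    unfolding U2_def by (intro holomorphic_intros shift_holo Kholo U1_holo) (use usm \<sigma> in auto)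
  have cont: "continuous_on {s. Re s = c} g" if "g holomorphic_on {s. x < Re s \<and> Re s < 2}" "x < c" "c < 2" for g :: "complex \<Rightarrow> complex" and x c
    by (rule continuous_on_subset[OF holomorphic_on_imp_continuous_on[OF that(1)]]) (use that in auto)
  define G where "G i = (if i = (0::nat) then (\<lambda>s. U1 (1 / 2 + s) * K s) else if i = 1 then (\<lambda>s. U2 (1 / 2 + s) * K s) else (\<lambda>s. D (1 / 2 + s) * K s))" for i
  define B where "B i = (if i = (0::nat) then bnd S1 else if i = 1 then bnd S2 else bnd (CL + CU))" for i
  have "vertical_integral (3 / 2) (\<lambda>s. G 0 s + G 1 s + G 2 s) = vertical_integral (3 / 2) (G 0) + vertical_integral (3 / 2) (G 1) + vertical_integral (3 / 2) (G 2)"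
  proof (rule vertical_integral_sum3[where C = B])
    fix i :: nat assume "i < 3"
    show "continuous_on {z. Re z = 3 / 2} (G i)"
      unfolding G_def using cont[OF hU1, of "3 / 2"] cont[OF hU2, of "3 / 2"] cont[OF hD, of "3 / 2"] \<sigma> by simp
    fix y
    show "norm (G i (Complex (3 / 2) y)) \<le> B i / (1 + y\<^sup>2)"
      using Kb'[OF U1_le, of "Complex (3 / 2) y" "Complex (3 / 2) y"] Kb'[OF U2_le, of "Complex (3 / 2) y" "Complex (3 / 2) y"] Kb'[OF D_le, of "Complex (3 / 2) y" "Complex (3 / 2) y"] \<sigma> \<delta>
      by (simp add: G_def B_def)
  qed
  moreover have "(\<lambda>s. G 0 s + G 1 s + G 2 s) = (\<lambda>s. dirichlet_series a (1 / 2 + s) * K s)"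
    by (simp add: G_def D_def U2_def fun_eq_iff algebra_simps)
  ultimately have eq: "vertical_integral (3 / 2) (\<lambda>s. dirichlet_series a (1 / 2 + s) * K s) =
     vertical_integral (3 / 2) (\<lambda>s. U1 (1 / 2 + s) * K s) + vertical_integral (3 / 2) (\<lambda>s. U2 (1 / 2 + s) * K s)
     + vertical_integral (3 / 2) (\<lambda>s. D (1 / 2 + s) * K s)"
    by (simp add: G_def)
  have line: "norm (g * K s) \<le> (C * A * X powr c) / (1 + (Im s)\<^sup>2)" if "norm g \<le> C" "Re s = c" "\<sigma>1 \<le> c" "c \<le> 3 / 2" for g s C c
  proof -
    have C: "C \<ge> 0" using that(1) norm_ge_zero order_trans by blast
    have "norm (K s) \<le> A * X powr (Re s) * exp (- \<bar>Im s\<bar>) / (1 + (Im s)\<^sup>2)" by (rule Kb) (use that in auto)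
    also have "\<dots> \<le> A * X powr c * 1 / (1 + (Im s)\<^sup>2)"
      using A that by (intro divide_right_mono mult_mono) auto
    finally have "norm g * norm (K s) \<le> C * (A * X powr c * 1 / (1 + (Im s)\<^sup>2))"
      using that(1) C by (intro mult_mono) auto
    thus ?thesis by (simp add: norm_mult mult.assoc)
  qed
  have I1: "norm (vertical_integral (3 / 2) (\<lambda>s. U1 (1 / 2 + s) * K s)) \<le> (S1 * A * X powr \<sigma>1) * cauchy_weight"
  proof -
    have "vertical_integral \<sigma>1 (\<lambda>s. U1 (1 / 2 + s) * K s) = vertical_integral (3 / 2) (\<lambda>s. U1 (1 / 2 + s) * K s)"
      by (rule vertical_integral_shift[OF _ _ _ hU1, where C = "bnd S1"]) (use \<sigma> Kb' U1_le in auto)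
    moreover have "norm (vertical_integral \<sigma>1 (\<lambda>s. U1 (1 / 2 + s) * K s)) \<le> (S1 * A * X powr \<sigma>1) * cauchy_weight"
    proof (rule norm_vertical_integral_le[OF cont[OF hU1]])
      fix y show "norm (U1 (1 / 2 + Complex \<sigma>1 y) * K (Complex \<sigma>1 y)) \<le> (S1 * A * X powr \<sigma>1) / (1 + y\<^sup>2)"
        using \<sigma> line[OF U1_le, of "Complex \<sigma>1 y" "Complex \<sigma>1 y" \<sigma>1] by simp
    qed (use \<sigma> in auto)
    ultimately show ?thesis by simp
  qed
  have I2: "norm (vertical_integral (3 / 2) (\<lambda>s. U2 (1 / 2 + s) * K s)) \<le> (S2 * A * X powr (3 / 2)) * cauchy_weight"
  proof (rule norm_vertical_integral_le[OF cont[OF hU2]])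
    fix y show "norm (U2 (1 / 2 + Complex (3 / 2) y) * K (Complex (3 / 2) y)) \<le> (S2 * A * X powr (3 / 2)) / (1 + y\<^sup>2)"
      using \<sigma> line[OF U2_le, of "Complex (3 / 2) y" "Complex (3 / 2) y" "3 / 2"] by simp
  qed (use \<sigma> in auto)
  have I3: "norm (vertical_integral (3 / 2) (\<lambda>s. D (1 / 2 + s) * K s)) \<le> (\<epsilon> * A * X powr (1 / 2 + \<delta>)) * cauchy_weight"
  proof -
    have "vertical_integral (1 / 2 + \<delta>) (\<lambda>s. D (1 / 2 + s) * K s) = vertical_integral (3 / 2) (\<lambda>s. D (1 / 2 + s) * K s)"
      by (rule vertical_integral_shift[OF _ _ _ hD, where C = "bnd (CL + CU)"]) (use \<delta> \<sigma> Kb' D_le in auto)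
    moreover have "norm (vertical_integral (1 / 2 + \<delta>) (\<lambda>s. D (1 / 2 + s) * K s)) \<le> (\<epsilon> * A * X powr (1 / 2 + \<delta>)) * cauchy_weight"
    proof (rule norm_vertical_integral_le[OF cont[OF hD]])
      fix y
      let ?s = "Complex (1 / 2 + \<delta>) y"
      have s': "1 / 2 + ?s = Complex (1 + \<delta>) y" by (simp add: complex_eq_iff)
      have "norm (D (1 / 2 + ?s) * K ?s) \<le> norm (D (1 / 2 + ?s)) * (A * X powr (1 / 2 + \<delta>) * exp (- \<bar>y\<bar>) / (1 + y\<^sup>2))"
        unfolding norm_mult using Kb[of ?s] \<sigma> \<delta> by (intro mult_left_mono) auto
      \<comment> \<open>The exponential factor of the kernel is handed over to \<open>near\<close>,
        and the integrable weight remains.\<close>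
      also have "\<dots> = (norm (D (1 / 2 + ?s)) * exp (- \<bar>y\<bar>)) * (A * X powr (1 / 2 + \<delta>) / (1 + y\<^sup>2))" by simp
      also have "\<dots> \<le> \<epsilon> * (A * X powr (1 / 2 + \<delta>) / (1 + y\<^sup>2))"
        using near[of y] A unfolding s' D_def U by (intro mult_right_mono) auto
      finally show "norm (D (1 / 2 + ?s) * K ?s) \<le> (\<epsilon> * A * X powr (1 / 2 + \<delta>)) / (1 + y\<^sup>2)" by simp
    qed (use \<delta> in auto)
    ultimately show ?thesis by simp
  qed
  have "norm (vertical_integral (3 / 2) (\<lambda>s. dirichlet_series a (1 / 2 + s) * K s)) \<le>
    (S1 * A * X powr \<sigma>1) * cauchy_weight + (S2 * A * X powr (3 / 2)) * cauchy_weight + (\<epsilon> * A * X powr (1 / 2 + \<delta>)) * cauchy_weight"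
    unfolding eq by (intro norm_triangle_mono I1 I2 I3)
  also have "\<dots> = cauchy_weight * A * (X powr \<sigma>1 * S1 + X powr (3 / 2) * S2 + X powr (1 / 2 + \<delta>) * \<epsilon>)"
    by (simp add: algebra_simps)
  finally show ?thesis unfolding S1_def S2_def .
qed

end

section \<open>Reduction of the central value to kernel integrals\<close>

lemma framework_theta:
  assumes F: "L_framework F"
  obtains \<theta> where "0 < \<theta>" "\<theta> < 1 / 2"
     "\<forall>q\<ge>2. \<forall>chi. primitive_character q chi \<longrightarrow>
           (\<forall>j\<in>{1..degree_of F}. Re (arch_param F (chi (-1)) j) \<ge> -1 + \<theta>)"
proof -
  obtain \<theta> where \<theta>: "1 / (2 * real (degree_of F)) < \<theta>" "\<theta> < 1 / 2"
     "\<forall>q\<ge>2. \<forall>chi. primitive_character q chi \<longrightarrow>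
           (\<forall>j\<in>{1..degree_of F}. Re (arch_param F (chi (-1)) j) \<ge> -1 + \<theta>)"
    using F unfolding L_framework_def by blast
  have "1 / (2 * real (degree_of F)) \<ge> 0" by simp
  hence "0 < \<theta>" using \<theta>(1) by linarith
  from that[OF this \<theta>(2,3)] show ?thesis .
qed

text \<open>The parameters depend on the character only through \<chi>(-1), which is 1 or -1, so the
  sum of two constants serves all q and \<chi>.\<close>

lemma gamma_ratio_uniform:
  assumes \<theta>: "\<forall>q\<ge>2. \<forall>chi. primitive_character q chi \<longrightarrow>
           (\<forall>j\<in>{1..degree_of F}. Re (arch_param F (chi (-1)) j) \<ge> -1 + \<theta>)"
    and c1: "c1 > 1 - \<theta>"
  shows "\<exists>C\<ge>0. \<forall>q\<ge>2. \<forall>chi. primitive_character q chi \<longrightarrow> (\<forall>w. c1 \<le> Re w \<and> Re w \<le> c2 \<longrightarrow>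
    norm (gamma_ratio F (chi (-1)) w) \<le> C * exp (2 * real (degree_of F) * \<bar>Im w\<bar>))"
proof -
  \<comment> \<open>The condition on the parameters is part of the claim because the framework gives
    it only for signs that occur as \<chi>(-1).\<close>
  have "\<exists>C\<ge>0. (\<forall>j\<in>{1..degree_of F}. Re (arch_param F \<epsilon> j) \<ge> -1 + \<theta>) \<longrightarrow>
      (\<forall>w. c1 \<le> Re w \<and> Re w \<le> c2 \<longrightarrow> norm (gamma_ratio F \<epsilon> w) \<le> C * exp (2 * real (degree_of F) * \<bar>Im w\<bar>))" for \<epsilon>
  proof (cases "\<forall>j\<in>{1..degree_of F}. Re (arch_param F \<epsilon> j) \<ge> -1 + \<theta>")
    case True
    have "c1 + Re (arch_param F \<epsilon> j) > 0" if "j \<in> {1..degree_of F}" for j using True that c1 by fastforce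
    with gamma_factor_prod_bound[of "{1..degree_of F}" c1 "arch_param F \<epsilon>" c2]
    have "\<exists>C\<ge>0. \<forall>w. c1 \<le> Re w \<and> Re w \<le> c2 \<longrightarrow>
        norm (gamma_ratio F \<epsilon> w) \<le> C * exp (2 * real (degree_of F) * \<bar>Im w\<bar>)"
      unfolding gamma_ratio_def by simp
    thus ?thesis by blast
  qed auto
  then obtain C where C: "\<And>\<epsilon>. C \<epsilon> \<ge> 0" "\<And>\<epsilon> w. (\<forall>j\<in>{1..degree_of F}. Re (arch_param F \<epsilon> j) \<ge> -1 + \<theta>) \<Longrightarrow>
      c1 \<le> Re w \<and> Re w \<le> c2 \<Longrightarrow> norm (gamma_ratio F \<epsilon> w) \<le> C \<epsilon> * exp (2 * real (degree_of F) * \<bar>Im w\<bar>)"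
    by metis
  show ?thesis
  proof (intro exI[of _ "C 1 + C (-1)"] conjI allI impI)
    show "C 1 + C (-1) \<ge> 0" using C(1)[of 1] C(1)[of "-1"] by simp
    fix q chi w assume q: "(2::nat) \<le> q" and prim: "primitive_character q chi" and w: "c1 \<le> Re w \<and> Re w \<le> c2"
    have "chi (-1) \<in> {1, -1}"
      using prim dirichlet_character_minus_1 unfolding primitive_character_def by blast
    hence "C (chi (-1)) \<le> C 1 + C (-1)" using C(1)[of 1] C(1)[of "-1"] by auto
    hence "C (chi (-1)) * exp (2 * real (degree_of F) * \<bar>Im w\<bar>) \<le> (C 1 + C (-1)) * exp (2 * real (degree_of F) * \<bar>Im w\<bar>)"
      by (intro mult_right_mono) auto
    moreover have "norm (gamma_ratio F (chi (-1)) w) \<le> C (chi (-1)) * exp (2 * real (degree_of F) * \<bar>Im w\<bar>)"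
      by (rule C(2)[OF _ w]) (use \<theta> q prim in blast)
    ultimately show "norm (gamma_ratio F (chi (-1)) w) \<le> (C 1 + C (-1)) * exp (2 * real (degree_of F) * \<bar>Im w\<bar>)" by linarith
  qed
qed

lemma gamma_ratio_holo:
  assumes "\<forall>j\<in>{1..degree_of F}. Re (arch_param F \<epsilon> j) \<ge> -1 + \<theta>"
  shows "gamma_ratio F \<epsilon> holomorphic_on {w. Re w > 1 - \<theta>}"
  unfolding gamma_ratio_def[abs_def]
proof (intro holomorphic_intros)
  fix j assume "j \<in> {1..degree_of F}"
  hence "Re (arch_param F \<epsilon> j) \<ge> -1 + \<theta>" using assms by blast
  thus "gamma_factor (arch_param F \<epsilon> j) holomorphic_on {w. Re w > 1 - \<theta>}"
    by (intro holomorphic_on_subset[OF holomorphic_gamma_factor]) auto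
qed

lemma L_bounded_right:
  assumes F: "L_framework F"
  shows "\<exists>C\<ge>0. \<forall>q\<ge>2. \<forall>chi. primitive_character q chi \<longrightarrow> (\<forall>s. Re s \<ge> 2 \<longrightarrow> norm (L_twist F chi s) \<le> C)"
proof -
  have sm: "summable (\<lambda>n. norm (dirichlet_term (coeff_of F) 2 (Suc n)))"
    using F unfolding L_framework_def has_euler_product_def by simp
  show ?thesis
  proof (intro exI[of _ "\<Sum>n. norm (dirichlet_term (coeff_of F) 2 (Suc n))"] conjI allI impI)
    show "0 \<le> (\<Sum>n. norm (dirichlet_term (coeff_of F) 2 (Suc n)))" by (rule suminf_nonneg[OF sm]) simp
    fix q chi s assume q: "(2::nat) \<le> q" and prim: "primitive_character q chi" and s: "2 \<le> Re s"
    interpret twisted_L F q chi by unfold_locales fact+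
    have "L_twist F chi s = dirichlet_series (twist_coeff F chi) s" by (rule L_series) (use s in simp)
    also have "norm \<dots> \<le> (\<Sum>n. norm (dirichlet_term (coeff_of F) 2 (Suc n)))"
      unfolding dirichlet_series_def
    proof (rule norm_suminf_le[OF _ sm])
      fix n
      have "norm (twist_coeff F chi (Suc n)) \<le> norm (coeff_of F (Suc n))"
        unfolding twist_coeff_def norm_mult using norm_dirichlet_character_le[OF character] by (simp add: mult_left_le)
      thus "norm (dirichlet_term (twist_coeff F chi) s (Suc n)) \<le> norm (dirichlet_term (coeff_of F) 2 (Suc n))"
        unfolding norm_dirichlet_term using s by (intro mult_mono powr_mono) auto
    qed
    finally show "norm (L_twist F chi s) \<le> (\<Sum>n. norm (dirichlet_term (coeff_of F) 2 (Suc n)))" .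
  qed
qed

lemma norm_ge_abs_Re: "\<bar>Re s\<bar> = b \<Longrightarrow> b \<le> norm s"
  using abs_Re_le_cmod[of s] by simp

lemma (in twisted_L) contour_continuous:
  assumes "b \<noteq> 0" "X > 0"
  shows "continuous_on {z. Re z = b} (\<lambda>s. L_twist F chi (z0 + s) * exp (s\<^sup>2) * of_real X powr s / s)"
proof -
  have "(\<lambda>s. L_twist F chi (z0 + s)) holomorphic_on UNIV"
    by (rule holomorphic_on_compose_gen[OF _ L_holo, unfolded o_def]) (auto intro!: holomorphic_intros)
  hence "(\<lambda>s. L_twist F chi (z0 + s) * exp (s\<^sup>2) * of_real X powr s / s) holomorphic_on {z. z \<noteq> 0}"
    using assms by (intro holomorphic_intros) (auto intro: holomorphic_on_subset)
  hence "continuous_on {z. z \<noteq> 0} (\<lambda>s. L_twist F chi (z0 + s) * exp (s\<^sup>2) * of_real X powr s / s)"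
    by (rule holomorphic_on_imp_continuous_on)
  thus ?thesis by (rule continuous_on_subset) (use assms in auto)
qed

text \<open>A bound polynomial in the conductor is good enough, since Borel-Caratheodory sees only
  its logarithm. With X = 1 and lines at distance 3, both sides involve L at real part at least 2,
  and reflection gives the conductor an exponent of at most 7/2 - 1/2 = 3.\<close>

theorem L_growth_uniform:
  assumes F: "L_framework F"
  shows "\<exists>C\<ge>0. \<forall>q\<ge>2. \<forall>chi. primitive_character q chi \<longrightarrow> (\<forall>z0. 1 / 2 \<le> Re z0 \<and> Re z0 \<le> 2 \<longrightarrow>
    norm (L_twist F chi z0) \<le> C * real (conductor F q) ^ 3 * exp (2 * real (degree_of F) * \<bar>Im z0\<bar>))"
proof -
  obtain \<theta> where \<theta>: "0 < \<theta>" "\<theta> < 1 / 2"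
     "\<forall>q\<ge>2. \<forall>chi. primitive_character q chi \<longrightarrow>
           (\<forall>j\<in>{1..degree_of F}. Re (arch_param F (chi (-1)) j) \<ge> -1 + \<theta>)"
    by (rule framework_theta[OF F])
  define d where "d = real (degree_of F)"
  obtain C1 where C1: "C1 \<ge> 0" "\<And>q chi s. q \<ge> 2 \<Longrightarrow> primitive_character q chi \<Longrightarrow> Re s \<ge> 2 \<Longrightarrow> norm (L_twist F chi s) \<le> C1"
    using L_bounded_right[OF F] by blast
  obtain C2 where C2: "C2 \<ge> 0" "\<And>q chi w. q \<ge> 2 \<Longrightarrow> primitive_character q chi \<Longrightarrow> 2 \<le> Re w \<and> Re w \<le> 7 / 2 \<Longrightarrow>
      norm (gamma_ratio F (chi (-1)) w) \<le> C2 * exp (2 * d * \<bar>Im w\<bar>)"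
    using gamma_ratio_uniform[OF \<theta>(3), of 2 "7 / 2"] \<theta>(1) unfolding d_def by fastforce
  define B where "B = 2 * exp ((2 * d + 1)\<^sup>2 / 2)"
  have d0: "d \<ge> 0" by (simp add: d_def)
  have B0: "B \<ge> 0" by (simp add: B_def)
  have gd: "exp (2 * d * \<bar>y\<bar> - y\<^sup>2) \<le> B / (1 + y\<^sup>2)" for y
  proof -
    have "exp (2 * d * \<bar>y\<bar> - y\<^sup>2) \<le> B * exp (- \<bar>y\<bar>) / (1 + y\<^sup>2)" unfolding B_def by (rule gaussian_decay)
    also have "\<dots> \<le> B * 1 / (1 + y\<^sup>2)" by (intro divide_right_mono mult_left_mono) (auto simp: B_def)
    finally show ?thesis by simp
  qed
  have dec: "exp (9 - y\<^sup>2) \<le> exp 9 * B / (1 + y\<^sup>2)" for y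
  proof -
    have "exp (9 - y\<^sup>2) \<le> exp (9 + (2 * d * \<bar>y\<bar> - y\<^sup>2))" using d0 by simp
    also have "\<dots> = exp 9 * exp (2 * d * \<bar>y\<bar> - y\<^sup>2)" by (simp only: exp_add)
    also have "\<dots> \<le> exp 9 * (B / (1 + y\<^sup>2))" by (intro mult_left_mono gd) auto
    finally show ?thesis by simp
  qed
  define C where "C = (C1 * exp 9 * B + C1 * C2 * exp 9 * B) * cauchy_weight"
  have C0: "C \<ge> 0" using C1 C2 B0 cauchy_weight_nonneg by (simp add: C_def)
  show ?thesis
  proof (intro exI[of _ C] conjI allI impI C0)
    fix q chi z0 assume q: "(2::nat) \<le> q" and prim: "primitive_character q chi" and z0: "1 / 2 \<le> Re z0 \<and> Re z0 \<le> 2"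
    interpret twisted_L F q chi by unfold_locales fact+
    obtain \<kappa> where \<kappa>: "norm \<kappa> = 1" "\<And>w. Re w > 1 \<Longrightarrow> L_twist F chi (1 - cnj w) = \<kappa> * cnj (L_twist F chi w * of_nat N powr (w - 1 / 2) * gamma_ratio F (chi (-1)) w)"
      using functional_equation by blast
    define g where "g s = L_twist F chi (z0 + s) * exp (s\<^sup>2) * of_real 1 powr s / s" for s
    have cont: "continuous_on {z. Re z = b} g" if "b \<noteq> 0" for b
      unfolding g_def using contour_continuous[OF that, of 1 z0] by simp
    have formula: "2 * pi * L_twist F chi z0 = vertical_integral 3 g - vertical_integral (- 3) g"
      unfolding g_def using contour_formula[of 3 1 z0] by simp
    define E where "E = real N ^ 3 * exp (2 * d * \<bar>Im z0\<bar>)"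
    have E1: "E \<ge> 1"
    proof -
      have "1 * 1 \<le> E" unfolding E_def using N_pos d0 by (intro mult_mono) auto
      thus ?thesis by simp
    qed
    have ng: "norm (g (Complex b y)) \<le> norm (L_twist F chi (z0 + Complex b y)) * exp (9 - y\<^sup>2)" if "\<bar>b\<bar> = 3" for b y
    proof -
      have "b\<^sup>2 = \<bar>b\<bar>\<^sup>2" by simp
      hence b2: "b\<^sup>2 = 9" using that by simp
      have "norm (Complex b y) \<ge> 1" using norm_ge_abs_Re[of "Complex b y" 3] that by simp
      hence "norm (g (Complex b y)) \<le> norm (L_twist F chi (z0 + Complex b y) * exp ((Complex b y)\<^sup>2)) / 1"
        unfolding g_def norm_divide by (intro frac_le) auto
      thus ?thesis by (simp only: norm_mult norm_exp_square div_by_1 complex.sel b2)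
    qed
    have right: "norm (g (Complex 3 y)) \<le> (C1 * exp 9 * B) / (1 + y\<^sup>2)" for y
    proof -
      have "norm (g (Complex 3 y)) \<le> norm (L_twist F chi (z0 + Complex 3 y)) * exp (9 - y\<^sup>2)" by (rule ng) simp
      also have "\<dots> \<le> C1 * (exp 9 * B / (1 + y\<^sup>2))"
        by (intro mult_mono dec C1(2)[OF q prim]) (use z0 C1 in auto)
      finally show ?thesis by simp
    qed
    have left: "norm (g (Complex (- 3) y)) \<le> (C1 * C2 * exp 9 * B * E) / (1 + y\<^sup>2)" for y
    proof -
      define w where "w = 1 - cnj (z0 + Complex (- 3) y)"
      have w: "2 \<le> Re w" "Re w \<le> 7 / 2" using z0 by (auto simp: w_def)
      have zw: "z0 + Complex (- 3) y = 1 - cnj w" by (simp add: w_def)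
      have Imw: "\<bar>Im w\<bar> \<le> \<bar>Im z0\<bar> + \<bar>y\<bar>" by (simp add: w_def)
      have "norm (of_nat N powr (w - 1 / 2) :: complex) = real N powr (Re w - 1 / 2)"
        using N_pos norm_powr_real_powr[of "of_nat N" "w - 1 / 2"] by simp
      also have "\<dots> \<le> real N powr 3" using N_pos w by (intro powr_mono) auto
      also have "\<dots> = real N ^ 3" using N_pos by simp
      finally have nN: "norm (of_nat N powr (w - 1 / 2) :: complex) \<le> real N ^ 3" .
      have "norm (L_twist F chi (z0 + Complex (- 3) y)) = norm (L_twist F chi w) * norm (of_nat N powr (w - 1 / 2) :: complex) * norm (gamma_ratio F (chi (-1)) w)"
        unfolding zw using w \<kappa> by (simp add: norm_mult)
      also have "\<dots> \<le> C1 * real N ^ 3 * (C2 * exp (2 * d * (\<bar>Im z0\<bar> + \<bar>y\<bar>)))"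
      proof (intro mult_mono nN C1(2)[OF q prim])
        have "norm (gamma_ratio F (chi (-1)) w) \<le> C2 * exp (2 * d * \<bar>Im w\<bar>)" by (rule C2(2)[OF q prim]) (use w in simp)
        also have "\<dots> \<le> C2 * exp (2 * d * (\<bar>Im z0\<bar> + \<bar>y\<bar>))" using Imw C2(1) d0 by (intro mult_left_mono) (auto intro!: mult_left_mono)
        finally show "norm (gamma_ratio F (chi (-1)) w) \<le> C2 * exp (2 * d * (\<bar>Im z0\<bar> + \<bar>y\<bar>))" .
      qed (use w C1 in auto)
      also have "\<dots> = C1 * C2 * E * exp (2 * d * \<bar>y\<bar>)" by (simp add: E_def distrib_left exp_add)
      finally have Lb: "norm (L_twist F chi (z0 + Complex (- 3) y)) \<le> C1 * C2 * E * exp (2 * d * \<bar>y\<bar>)" .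
      have "norm (g (Complex (- 3) y)) \<le> norm (L_twist F chi (z0 + Complex (- 3) y)) * exp (9 - y\<^sup>2)" by (rule ng) simp
      also have "\<dots> \<le> C1 * C2 * E * exp (2 * d * \<bar>y\<bar>) * exp (9 - y\<^sup>2)" by (intro mult_right_mono Lb) auto
      also have "\<dots> = C1 * C2 * E * exp 9 * exp (2 * d * \<bar>y\<bar> - y\<^sup>2)" by (simp add: exp_diff)
      also have "\<dots> \<le> C1 * C2 * E * exp 9 * (B / (1 + y\<^sup>2))" by (intro mult_left_mono gd) (use C1 C2 E1 in auto)
      finally show ?thesis by (simp add: mult_ac)
    qed
    have "norm (vertical_integral 3 g) \<le> (C1 * exp 9 * B) * cauchy_weight"
      by (rule norm_vertical_integral_le[OF cont right]) simp
    also have "\<dots> \<le> (C1 * exp 9 * B * E) * cauchy_weight"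
      using mult_left_mono[OF E1, of "C1 * exp 9 * B"] C1 B0 cauchy_weight_nonneg by (intro mult_right_mono) simp_all
    finally have V1: "norm (vertical_integral 3 g) \<le> (C1 * exp 9 * B * E) * cauchy_weight" .
    have V2: "norm (vertical_integral (- 3) g) \<le> (C1 * C2 * exp 9 * B * E) * cauchy_weight"
      by (rule norm_vertical_integral_le[OF cont left]) simp
    have "1 * norm (L_twist F chi z0) \<le> 2 * pi * norm (L_twist F chi z0)"
      using pi_ge_two by (intro mult_right_mono) auto
    also have "\<dots> = norm (2 * pi * L_twist F chi z0)" by (simp add: norm_mult)
    also have "\<dots> \<le> norm (vertical_integral 3 g) + norm (vertical_integral (- 3) g)"
      unfolding formula by (rule norm_triangle_ineq4)
    also have "\<dots> \<le> C * E" using V1 V2 by (simp add: C_def algebra_simps)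
    finally show "norm (L_twist F chi z0) \<le> C * real N ^ 3 * exp (2 * real (degree_of F) * \<bar>Im z0\<bar>)"
      by (simp add: E_def d_def mult.assoc)
  qed
qed

text \<open>The reflection \<open>s \<mapsto> - cnj s\<close> turns the functional equation into an identity between conjugate
  integrands, so that the dual \<open>L\<close>-function does not appear.\<close>
lemma (in twisted_L) left_integral:
  assumes b: "b > 1 / 2" and X: "X > 0"
  shows "norm (vertical_integral (- b) (\<lambda>s. L_twist F chi (1 / 2 + s) * exp (s\<^sup>2) * of_real X powr s / s))
    = norm (vertical_integral b (\<lambda>s. L_twist F chi (1 / 2 + s) *
        (exp (s\<^sup>2) * of_real (real N / X) powr s * gamma_ratio F (chi (-1)) (1 / 2 + s) / s)))"
proof -
  obtain \<kappa> where \<kappa>: "norm \<kappa> = 1" "\<And>w. Re w > 1 \<Longrightarrow> L_twist F chi (1 - cnj w) = \<kappa> * cnj (L_twist F chi w * of_nat N powr (w - 1 / 2) * gamma_ratio F (chi (-1)) w)"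
    using functional_equation by blast
  let ?f = "\<lambda>s. L_twist F chi (1 / 2 + s) * exp (s\<^sup>2) * of_real X powr s / s"
  let ?g = "\<lambda>s. L_twist F chi (1 / 2 + s) *
        (exp (s\<^sup>2) * of_real (real N / X) powr s * gamma_ratio F (chi (-1)) (1 / 2 + s) / s)"
  have eq: "?f (Complex (- b) y) = - \<kappa> * cnj (?g (Complex b y))" for y
  proof -
    define s where "s = Complex b y"
    have m: "Complex (- b) y = - cnj s" by (simp add: s_def complex_eq_iff)
    have w: "1 / 2 + - cnj s = 1 - cnj (1 / 2 + s)" by (simp add: complex_eq_iff)
    have s1: "Re (1 / 2 + s) > 1" using b by (simp add: s_def)
    have p: "of_real X powr (- cnj s) = cnj (of_real X powr (- s))" using X by (simp add: cnj_powr)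
    have q: "of_nat N powr s * of_real X powr (- s) = (of_real (real N / X) powr s :: complex)"
    proof -
      have "(of_real (real N / X) * of_real X) powr s = (of_real (real N / X) powr s * of_real X powr s :: complex)"
        by (rule powr_times_real) (use X in auto)
      moreover have "of_real (real N / X) * of_real X = (of_nat N :: complex)" using X by simp
      ultimately show ?thesis using X by (simp add: powr_minus field_simps)
    qed
    have "?f (- cnj s) = L_twist F chi (1 - cnj (1 / 2 + s)) * exp ((- cnj s)\<^sup>2) * of_real X powr (- cnj s) / (- cnj s)"
      by (simp only: w)
    also have "\<dots> = - \<kappa> * cnj (L_twist F chi (1 / 2 + s) * (exp (s\<^sup>2) * (of_nat N powr s * of_real X powr (- s)) * gamma_ratio F (chi (-1)) (1 / 2 + s) / s))"
      unfolding \<kappa>(2)[OF s1] p by (simp add: exp_cnj mult_ac)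
    finally have "?f (- cnj s) = - \<kappa> * cnj (?g s)" unfolding q .
    thus ?thesis by (simp only: m s_def[symmetric])
  qed
  have "vertical_integral (- b) ?f = - \<kappa> * cnj (vertical_integral b ?g)"
    unfolding vertical_integral_def eq integral_mult_right_zero by (simp only: Bochner_Integration.integral_cnj)
  thus ?thesis using \<kappa>(1) by (simp add: norm_mult)
qed

text \<open>The common shape of the kernels on both sides of the functional equation. The domain
  begins at 1/2 - \<theta> > 0, which excludes the pole at 0 and those of the gamma quotient; the
  bound begins half-way from there to 1/2.\<close>

definition admissible_kernel :: "real \<Rightarrow> real \<Rightarrow> real \<Rightarrow> (complex \<Rightarrow> complex) \<Rightarrow> bool" where
  "admissible_kernel \<theta> A X K \<longleftrightarrow> K holomorphic_on {s. Re s > 1 / 2 - \<theta>} \<and>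
     (\<forall>s. 1 / 2 - \<theta> / 2 \<le> Re s \<and> Re s \<le> 3 / 2 \<longrightarrow>
        norm (K s) \<le> A * X powr (Re s) * exp (- \<bar>Im s\<bar>) / (1 + (Im s)\<^sup>2))"

text \<open>For N \<le> K0 X^2 the reflected side has N/X \<le> K0 X, so both integrals are of one
  type, with K0^(3/2) covering K0^(Re s). Twice |L(1/2)| is at most the sum of the two integrals
  because \<pi> \<ge> 1.\<close>

theorem central_value_bound:
  assumes F: "L_framework F"
  shows "\<exists>\<theta>>0. \<theta> < 1 / 2 \<and> (\<forall>K0\<ge>1. \<exists>A\<ge>0. \<forall>q\<ge>2. \<forall>chi. primitive_character q chi \<longrightarrow> (\<forall>X\<ge>1. \<forall>B.
     real (conductor F q) \<le> K0 * X\<^sup>2 \<longrightarrow>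
     (\<forall>K. admissible_kernel \<theta> A X K \<longrightarrow> norm (vertical_integral (3 / 2) (\<lambda>s. L_twist F chi (1 / 2 + s) * K s)) \<le> B) \<longrightarrow>
     norm (L_twist F chi (1 / 2)) \<le> B))"
proof -
  obtain \<theta> where \<theta>: "0 < \<theta>" "\<theta> < 1 / 2"
     "\<forall>q\<ge>2. \<forall>chi. primitive_character q chi \<longrightarrow>
           (\<forall>j\<in>{1..degree_of F}. Re (arch_param F (chi (-1)) j) \<ge> -1 + \<theta>)"
    by (rule framework_theta[OF F])
  define d where "d = real (degree_of F)"
  define \<sigma>1 where "\<sigma>1 = 1 / 2 - \<theta> / 2"
  have \<sigma>1: "\<sigma>1 > 0" "\<sigma>1 > 1 / 2 - \<theta>" using \<theta> by (auto simp: \<sigma>1_def)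
  have d0: "d \<ge> 0" by (simp add: d_def)
  obtain C2 where C2: "C2 \<ge> 0" "\<And>q chi w. q \<ge> 2 \<Longrightarrow> primitive_character q chi \<Longrightarrow> 1 - \<theta> / 2 \<le> Re w \<and> Re w \<le> 2 \<Longrightarrow>
      norm (gamma_ratio F (chi (-1)) w) \<le> C2 * exp (2 * d * \<bar>Im w\<bar>)"
    using gamma_ratio_uniform[OF \<theta>(3), of "1 - \<theta> / 2" 2] \<theta>(1) unfolding d_def by fastforce
  define B0 where "B0 = 2 * exp ((2 * d + 1)\<^sup>2 / 2)"
  have gd: "exp (2 * d * \<bar>y\<bar> - y\<^sup>2) \<le> B0 * exp (- \<bar>y\<bar>) / (1 + y\<^sup>2)" for y unfolding B0_def by (rule gaussian_decay)
  have expo: "norm (exp (s\<^sup>2)) \<le> exp 3 * exp (- (Im s)\<^sup>2)" if "0 \<le> Re s" "Re s \<le> 3 / 2" for s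
  proof -
    have "(Re s)\<^sup>2 \<le> (3 / 2)\<^sup>2" using that by (intro power_mono) auto
    also have "\<dots> \<le> 3" by (simp add: power2_eq_square)
    finally have "(Re s)\<^sup>2 - (Im s)\<^sup>2 \<le> 3 - (Im s)\<^sup>2" by simp
    thus ?thesis unfolding norm_exp_square by (simp flip: exp_add)
  qed
  show ?thesis
  proof (rule exI[of _ \<theta>], intro conjI allI impI \<theta>(1,2))
    fix K0 :: real assume K0: "K0 \<ge> 1"
    define A where "A = K0 powr (3 / 2) * (1 + C2) * exp 3 * B0 / \<sigma>1"
    have A0: "A \<ge> 0" using C2 \<sigma>1 by (simp add: A_def B0_def)
    show "\<exists>A\<ge>0. \<forall>q\<ge>2. \<forall>chi. primitive_character q chi \<longrightarrow> (\<forall>X\<ge>1. \<forall>B.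
     real (conductor F q) \<le> K0 * X\<^sup>2 \<longrightarrow>
     (\<forall>K. admissible_kernel \<theta> A X K \<longrightarrow> norm (vertical_integral (3 / 2) (\<lambda>s. L_twist F chi (1 / 2 + s) * K s)) \<le> B) \<longrightarrow>
     norm (L_twist F chi (1 / 2)) \<le> B)"
    proof (rule exI[of _ A], intro conjI allI impI A0)
      fix q :: nat and chi and X B :: real
      assume q: "2 \<le> q" and prim: "primitive_character q chi" and X: "1 \<le> X" and NX: "real (conductor F q) \<le> K0 * X\<^sup>2"
        and hyp: "\<forall>K. admissible_kernel \<theta> A X K \<longrightarrow>
       norm (vertical_integral (3 / 2) (\<lambda>s. L_twist F chi (1 / 2 + s) * K s)) \<le> B"
      interpret twisted_L F q chi by unfold_locales fact+
      have common: "norm (exp (s\<^sup>2) * p * g / s) \<le> A * X powr (Re s) * exp (- \<bar>Im s\<bar>) / (1 + (Im s)\<^sup>2)"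
        if s: "\<sigma>1 \<le> Re s" "Re s \<le> 3 / 2" and p: "norm p \<le> K0 powr (3 / 2) * X powr (Re s)"
          and g: "norm g \<le> (1 + C2) * exp (2 * d * \<bar>Im s\<bar>)" for s p g
      proof -
        have "norm (exp (s\<^sup>2) * p * g / s) \<le> (exp 3 * exp (- (Im s)\<^sup>2) * (K0 powr (3 / 2) * X powr (Re s)) * ((1 + C2) * exp (2 * d * \<bar>Im s\<bar>))) / \<sigma>1"
          unfolding norm_divide norm_mult
          using s \<sigma>1 K0 C2(1) abs_Re_le_cmod[of s] by (intro frac_le mult_mono expo p g mult_nonneg_nonneg) auto
        also have "\<dots> = K0 powr (3 / 2) * (1 + C2) * exp 3 / \<sigma>1 * X powr (Re s) * exp (2 * d * \<bar>Im s\<bar> - (Im s)\<^sup>2)"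
          by (simp add: exp_diff exp_minus field_simps)
        also have "\<dots> \<le> K0 powr (3 / 2) * (1 + C2) * exp 3 / \<sigma>1 * X powr (Re s) * (B0 * exp (- \<bar>Im s\<bar>) / (1 + (Im s)\<^sup>2))"
          by (intro mult_left_mono gd) (use C2 \<sigma>1 in auto)
        also have "\<dots> = A * X powr (Re s) * exp (- \<bar>Im s\<bar>) / (1 + (Im s)\<^sup>2)" by (simp add: A_def)
        finally show ?thesis .
      qed
      define K1 :: "complex \<Rightarrow> complex" where "K1 s = exp (s\<^sup>2) * of_real X powr s * 1 / s" for s
      define K2 :: "complex \<Rightarrow> complex" where "K2 s = exp (s\<^sup>2) * of_real (real N / X) powr s * gamma_ratio F (chi (-1)) (1 / 2 + s) / s" for s
      have ne: "s \<noteq> 0" if "Re s > 1 / 2 - \<theta>" for s using that \<theta> by auto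
      have K1: "norm (vertical_integral (3 / 2) (\<lambda>s. L_twist F chi (1 / 2 + s) * K1 s)) \<le> B"
      proof (rule hyp[rule_format], unfold admissible_kernel_def, intro conjI allI impI)
        show "K1 holomorphic_on {s. 1 / 2 - \<theta> < Re s}"
          unfolding K1_def using ne X by (intro holomorphic_intros) auto
        fix s assume s: "1 / 2 - \<theta> / 2 \<le> Re s \<and> Re s \<le> 3 / 2"
        show "norm (K1 s) \<le> A * X powr (Re s) * exp (- \<bar>Im s\<bar>) / (1 + (Im s)\<^sup>2)"
          unfolding K1_def
        proof (rule common)
          have "1 * X powr (Re s) \<le> K0 powr (3 / 2) * X powr (Re s)"
            using K0 by (intro mult_right_mono ge_one_powr_ge_zero) auto
          thus "norm (of_real X powr s :: complex) \<le> K0 powr (3 / 2) * X powr (Re s)"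
            using X by (simp add: norm_powr_real_powr)
          have "1 * 1 \<le> (1 + C2) * exp (2 * d * \<bar>Im s\<bar>)" using C2 d0 by (intro mult_mono) auto
          thus "norm (1 :: complex) \<le> (1 + C2) * exp (2 * d * \<bar>Im s\<bar>)" by simp
        qed (use s in \<open>auto simp: \<sigma>1_def\<close>)
      qed
      have K2: "norm (vertical_integral (3 / 2) (\<lambda>s. L_twist F chi (1 / 2 + s) * K2 s)) \<le> B"
      proof (rule hyp[rule_format], unfold admissible_kernel_def, intro conjI allI impI)
        have "gamma_ratio F (chi (-1)) holomorphic_on {w. Re w > 1 - \<theta>}"
          by (rule gamma_ratio_holo) (use \<theta>(3) q prim in blast)
        hence "(\<lambda>s. gamma_ratio F (chi (-1)) (1 / 2 + s)) holomorphic_on {s. 1 / 2 - \<theta> < Re s}"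
          by (intro holomorphic_on_compose_gen[of "\<lambda>s. 1 / 2 + s" _ "gamma_ratio F (chi (-1))", unfolded o_def])
             (auto intro!: holomorphic_intros)
        thus "K2 holomorphic_on {s. 1 / 2 - \<theta> < Re s}"
          unfolding K2_def using ne X N_pos by (intro holomorphic_intros) auto
        fix s assume s: "1 / 2 - \<theta> / 2 \<le> Re s \<and> Re s \<le> 3 / 2"
        hence s0: "Re s > 0" using \<theta> by auto
        show "norm (K2 s) \<le> A * X powr (Re s) * exp (- \<bar>Im s\<bar>) / (1 + (Im s)\<^sup>2)"
          unfolding K2_def
        proof (rule common)
          have "norm (of_real (real N / X) powr s :: complex) = (real N / X) powr (Re s)"
            using X N_pos norm_powr_real_powr[of "of_real (real N / X)" s] by simp
          also have "\<dots> \<le> (K0 * X) powr (Re s)"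
          proof (rule powr_mono2)
            show "real N / X \<le> K0 * X" using NX X by (simp add: divide_le_eq power2_eq_square mult.assoc)
          qed (use s0 X in auto)
          also have "\<dots> = K0 powr (Re s) * X powr (Re s)" using K0 X by (simp add: powr_mult)
          also have "\<dots> \<le> K0 powr (3 / 2) * X powr (Re s)" using K0 s by (intro mult_right_mono powr_mono) auto
          finally show "norm (of_real (real N / X) powr s :: complex) \<le> K0 powr (3 / 2) * X powr (Re s)" .
          have "norm (gamma_ratio F (chi (-1)) (1 / 2 + s)) \<le> C2 * exp (2 * d * \<bar>Im (1 / 2 + s)\<bar>)"
            by (rule C2(2)[OF q prim]) (use s in auto)
          also have "\<dots> \<le> (1 + C2) * exp (2 * d * \<bar>Im s\<bar>)" by simp
          finally show "norm (gamma_ratio F (chi (-1)) (1 / 2 + s)) \<le> (1 + C2) * exp (2 * d * \<bar>Im s\<bar>)" .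
        qed (use s in \<open>auto simp: \<sigma>1_def\<close>)
      qed
      let ?f = "\<lambda>s. L_twist F chi (1 / 2 + s) * exp (s\<^sup>2) * of_real X powr s / s"
      have "2 * norm (L_twist F chi (1 / 2)) \<le> 2 * pi * norm (L_twist F chi (1 / 2))"
        using pi_ge_two by (intro mult_right_mono) auto
      also have "\<dots> = norm (2 * pi * L_twist F chi (1 / 2))" by (simp add: norm_mult)
      also have "\<dots> \<le> norm (vertical_integral (3 / 2) ?f) + norm (vertical_integral (- (3 / 2)) ?f)"
        using contour_formula[of "3 / 2" X "1 / 2"] X by (simp only: norm_triangle_ineq4)
      also have "norm (vertical_integral (- (3 / 2)) ?f) = norm (vertical_integral (3 / 2) (\<lambda>s. L_twist F chi (1 / 2 + s) * K2 s))"
        unfolding K2_def by (rule left_integral) (use X in auto)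
      also have "?f = (\<lambda>s. L_twist F chi (1 / 2 + s) * K1 s)" by (simp add: K1_def fun_eq_iff)
      finally show "norm (L_twist F chi (1 / 2)) \<le> B" using K1 K2 by simp
    qed
  qed
qed

section \<open>Bounds on the line of real part 1 + 1/x and numerical estimates\<close>

lemma near_line_bound:
  assumes F: "L_framework F" and q: "q \<ge> 2" and prim: "primitive_character q chi"
    and A1: "\<And>n. n \<ge> 1 \<Longrightarrow> norm (coeff_of F n) \<le> real (divisor_tau (degree_of F) n)"
    and C0: "C0 \<ge> 0" "\<And>m. (\<Sum>n=1..m. norm (coeff_of F n)) \<le> C0 * real m"
    and x: "x \<ge> 1" and r: "0 < r" "r \<le> 1 / 2" and M: "M \<ge> 0"
    and nz: "\<And>\<sigma> t. \<sigma> > 1 - r \<Longrightarrow> \<bar>t\<bar> \<le> x + 1 \<Longrightarrow> L_twist F chi (Complex \<sigma> t) \<noteq> 0"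
    and growth: "\<And>z. 1 / 2 \<le> Re z \<Longrightarrow> Re z \<le> 2 \<Longrightarrow> \<bar>Im z\<bar> \<le> x + 1 \<Longrightarrow> norm (L_twist F chi z) \<le> exp M"
    and k: "k \<ge> 1" and h: "0 \<le> h" "h \<le> r / (16 * real k)" and xr: "1 / x \<le> r / 4"
    and e1: "(16 * real k * h / r) ^ k * (2 * (M + 1) + 6 * real (degree_of F) * (1 + 4 / r)) \<le> \<epsilon>" "\<epsilon> \<le> 1"
    and e2: "sieve_const (degree_of F) k * (3 * fact k * (2 * h) ^ k) \<le> \<epsilon>"
  shows "norm (dirichlet_series (twist_coeff F chi) (Complex (1 + 1 / x) t)
      - euler_series.sieved_series (twist_coeff F chi) h k (Complex (1 + 1 / x) t)) * exp (- \<bar>t\<bar>)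
    \<le> C0 * (1 + x) * (12 * \<epsilon> + 2 * exp (- x))"
proof -
  interpret twisted_L F q chi by unfold_locales fact+
  interpret E: euler_series "degree_of F" "twist_coeff F chi" "twist_satake F chi"
    by (rule twisted_euler_series) fact+
  let ?s = "Complex (1 + 1 / x) t"
  have s: "Re ?s > 1" using x by simp
  have tc: "norm (twist_coeff F chi n) \<le> norm (coeff_of F n)" for n
    unfolding twist_coeff_def norm_mult using norm_dirichlet_character_le[OF character] by (simp add: mult_left_le)
  have ds: "norm (dirichlet_series (twist_coeff F chi) ?s) \<le> C0 * (1 + x)"
    using norm_dirichlet_series_le[OF tc norm_ge_zero C0(2,1) E.summ[OF s], of "1 / x"] x by simp
  have e0: "\<epsilon> \<ge> 0" using order_trans[OF _ e2, of 0] h E.sieve_const_nonneg[of k] by simp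
  have cx: "C0 * (1 + x) \<ge> 0" using C0 x by simp
  show ?thesis
  proof (cases "\<bar>t\<bar> \<le> x")
    case True
    \<comment> \<open>The disc of \<open>fin_diff_log_bound\<close> stays to the right of 1 - r and
      of 1/2, and r \<le> 1/2 keeps its ordinates below x + 1.\<close>
    have ball: "1 - r < Re z" "1 / 2 \<le> Re z" "Re z \<le> 2" "\<bar>Im z\<bar> \<le> x + 1" if z: "z \<in> ball (Complex (1 + r / 4) t) r" for z
    proof -
      have "norm (Complex (1 + r / 4) t - z) < r" using z by (simp add: dist_norm)
      hence "\<bar>1 + r / 4 - Re z\<bar> < r" "\<bar>t - Im z\<bar> < r"
        using abs_Re_le_cmod[of "Complex (1 + r / 4) t - z"] abs_Im_le_cmod[of "Complex (1 + r / 4) t - z"] by auto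
      thus "1 - r < Re z" "1 / 2 \<le> Re z" "Re z \<le> 2" "\<bar>Im z\<bar> \<le> x + 1" using r True by linarith+
    qed
    have "norm (fin_diff (of_real h) k E.log_series ?s) \<le> (16 * real k * h / r) ^ k * (2 * (M + 1) + 6 * real (degree_of F) * (1 + 4 / r))"
    proof (rule E.fin_diff_log_bound[where f = "L_twist F chi"])
      show "L_twist F chi holomorphic_on ball (Complex (1 + r / 4) t) r" by (rule holomorphic_on_subset[OF L_holo]) auto
      show "L_twist F chi z \<noteq> 0" if "z \<in> ball (Complex (1 + r / 4) t) r" for z
        using nz[of "Re z" "Im z"] ball[OF that] by simp
      show "norm (L_twist F chi z) \<le> exp M" if "z \<in> ball (Complex (1 + r / 4) t) r" for z
        using growth ball[OF that] by simp
      show "L_twist F chi s = dirichlet_series (twist_coeff F chi) s" if "Re s > 1" for s by (rule L_series[OF that])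
    qed (use r M k h xr x in auto)
    also have "\<dots> \<le> \<epsilon>" by (rule e1)
    finally have D: "norm (fin_diff (of_real h) k E.log_series ?s) \<le> \<epsilon>" .
    have "norm (dirichlet_series (twist_coeff F chi) ?s - E.sieved_series h k ?s) \<le> norm (dirichlet_series (twist_coeff F chi) ?s) * (12 * \<epsilon>)"
      by (rule E.log_diff_to_sieved_error[OF h(1) s D e1(2) e2])
    also have "\<dots> \<le> C0 * (1 + x) * (12 * \<epsilon>)" using ds e0 by (intro mult_right_mono) auto
    also have "\<dots> \<le> C0 * (1 + x) * (12 * \<epsilon> + 2 * exp (- x))" using cx by (intro mult_left_mono) auto
    finally have 1: "norm (dirichlet_series (twist_coeff F chi) ?s - E.sieved_series h k ?s) \<le> C0 * (1 + x) * (12 * \<epsilon> + 2 * exp (- x))" .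
    have "norm (dirichlet_series (twist_coeff F chi) ?s - E.sieved_series h k ?s) * exp (- \<bar>t\<bar>) \<le> norm (dirichlet_series (twist_coeff F chi) ?s - E.sieved_series h k ?s) * 1"
      by (intro mult_left_mono) auto
    thus ?thesis using 1 by linarith
  next
    \<comment> \<open>Here the exponential factor, which comes from the decay of the kernel, suffices.\<close>
    case False
    have v: "0 \<le> prime_cutoff h k p \<and> prime_cutoff h k p \<le> 1" for p using prime_cutoff_bounds[OF h(1)] by auto
    have un: "norm (twist_coeff F chi n * of_real (sieve_weight h k n)) \<le> norm (coeff_of F n)" for n
    proof -
      have "norm (twist_coeff F chi n * of_real (sieve_weight h k n)) \<le> norm (twist_coeff F chi n)"
        using prime_weight_bounds[OF v, where P = "{p. prime p}" and n = n] by (simp add: norm_mult mult_left_le)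
      thus ?thesis using tc[of n] by linarith
    qed
    have us: "norm (E.sieved_series h k ?s) \<le> C0 * (1 + x)"
      unfolding E.sieved_series_def
      using norm_dirichlet_series_le[OF un norm_ge_zero C0(2,1) E.summable_sieved[OF s h(1)], of "1 / x"] x by simp
    have "norm (dirichlet_series (twist_coeff F chi) ?s - E.sieved_series h k ?s) \<le> C0 * (1 + x) + C0 * (1 + x)"
      using norm_triangle_ineq4 ds us by (meson add_mono order_trans)
    hence "norm (dirichlet_series (twist_coeff F chi) ?s - E.sieved_series h k ?s) * exp (- \<bar>t\<bar>) \<le> (C0 * (1 + x) + C0 * (1 + x)) * exp (- x)"
      using False cx by (intro mult_mono) auto
    also have "\<dots> = C0 * (1 + x) * (2 * exp (- x))" by simp
    also have "\<dots> \<le> C0 * (1 + x) * (12 * \<epsilon> + 2 * exp (- x))" using cx e0 by (intro mult_left_mono) auto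
    finally show ?thesis .
  qed
qed

text \<open>\<open>Y\<close> is the square root of X, in the application the target q^(d/4). The
  sieve bound starts at Q, about Y, and the cut is at M, about X; the first Q integers therefore
  cost only a relative Y^(-\<theta>/2).\<close>

lemma kernel_bound_arith:
  fixes X Y \<theta> \<kappa> C0 \<delta> \<epsilon> :: real and Q M :: nat
  assumes Y: "Y \<ge> 3" and XY: "X = Y\<^sup>2" and \<theta>: "0 < \<theta>" "\<theta> < 1 / 2"
    and pos: "\<kappa> \<ge> 0" "C0 \<ge> 0" and Q: "Q = nat \<lceil>Y\<rceil>" and M: "M = nat \<lfloor>X\<rfloor>"
  shows "1 \<le> Q" "Q \<le> M" "Y \<le> real Q"
    and "X powr (1 / 2 - \<theta> / 2) * ((\<kappa> * real M powr (\<theta> / 2) + C0 * real Q powr (\<theta> / 2)) / (\<theta> / 2))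
       + X powr (3 / 2) * (2 * \<kappa> / real M + C0 * real Q / (real M)\<^sup>2)
     \<le> Y * ((2 / \<theta> + 4) * \<kappa> + (4 / \<theta> + 8) * C0 * Y powr (- (\<theta> / 2)))"
proof -
  have YY: "Y * 3 \<le> Y * Y" using Y by (intro mult_left_mono) auto
  have X9: "X \<ge> 9" using power_mono[OF Y, of 2] by (simp add: XY)
  have Q1: "real Q \<le> Y + 1" "Y \<le> real Q" unfolding Q using Y by linarith+
  have M1: "X - 1 \<le> real M" "real M \<le> X" unfolding M using X9 by linarith+
  show "1 \<le> Q" "Y \<le> real Q" using Q1 Y by linarith+
  have "real Q \<le> real M" using Q1 M1 YY Y unfolding XY power2_eq_square by linarith
  thus "Q \<le> M" by simp
  have Q2: "real Q \<le> 2 * Y" using Q1 Y by linarith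
  have M2: "X / 2 \<le> real M" using M1 X9 by linarith
  have Y0: "Y > 0" and X0: "X > 0" using Y X9 by auto
  have XYp: "X powr a = Y powr (2 * a)" for a
    using Y0 unfolding XY by (simp add: powr_powr[symmetric])
  have 1: "X powr (1 / 2 - \<theta> / 2) * ((\<kappa> * real M powr (\<theta> / 2) + C0 * real Q powr (\<theta> / 2)) / (\<theta> / 2))
    \<le> Y * (2 / \<theta> * \<kappa> + 4 / \<theta> * C0 * Y powr (- (\<theta> / 2)))"
  proof -
    have "real M powr (\<theta> / 2) \<le> X powr (\<theta> / 2)" using M1 \<theta> by (intro powr_mono2) auto
    hence m: "real M powr (\<theta> / 2) \<le> Y powr \<theta>" by (simp add: XYp)
    have "real Q powr (\<theta> / 2) \<le> (2 * Y) powr (\<theta> / 2)" using Q2 \<theta> by (intro powr_mono2) auto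
    also have "\<dots> = 2 powr (\<theta> / 2) * Y powr (\<theta> / 2)" using Y0 by (simp add: powr_mult)
    also have "\<dots> \<le> 2 powr 1 * Y powr (\<theta> / 2)" using \<theta> by (intro mult_right_mono powr_mono) auto
    finally have qq: "real Q powr (\<theta> / 2) \<le> 2 * Y powr (\<theta> / 2)" by simp
    have "X powr (1 / 2 - \<theta> / 2) * ((\<kappa> * real M powr (\<theta> / 2) + C0 * real Q powr (\<theta> / 2)) / (\<theta> / 2))
      \<le> Y powr (1 - \<theta>) * ((\<kappa> * Y powr \<theta> + C0 * (2 * Y powr (\<theta> / 2))) / (\<theta> / 2))"
      unfolding XYp using m qq pos \<theta> by (intro mult_mono divide_right_mono add_mono mult_left_mono) (auto simp: algebra_simps)
    also have "\<dots> = (2 / \<theta>) * \<kappa> * (Y powr (1 - \<theta>) * Y powr \<theta>) + (4 / \<theta>) * C0 * (Y powr (1 - \<theta>) * Y powr (\<theta> / 2))"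
      using \<theta> by (simp add: field_simps)
    also have "Y powr (1 - \<theta>) * Y powr \<theta> = Y" using Y0 by (simp flip: powr_add)
    also have "Y powr (1 - \<theta>) * Y powr (\<theta> / 2) = Y powr (1 + - (\<theta> / 2))" by (simp add: field_simps flip: powr_add)
    also have "\<dots> = Y * Y powr (- (\<theta> / 2))" using Y0 by (subst powr_add) simp
    finally show ?thesis by (simp add: algebra_simps)
  qed
  have 2: "X powr (3 / 2) * (2 * \<kappa> / real M + C0 * real Q / (real M)\<^sup>2) \<le> Y * (4 * \<kappa> + 8 * C0 * Y powr (- (\<theta> / 2)))"
  proof -
    have x3: "X powr (3 / 2) = Y ^ 3" unfolding XYp using Y0 by (simp add: powr_numeral)
    have "2 * \<kappa> / real M \<le> 2 * \<kappa> / (X / 2)" using M2 X0 pos by (intro divide_left_mono) auto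
    moreover have "C0 * real Q / (real M)\<^sup>2 \<le> C0 * (2 * Y) / (X / 2)\<^sup>2"
      using M2 X0 pos Q2 by (intro frac_le mult_left_mono power_mono) auto
    ultimately have "X powr (3 / 2) * (2 * \<kappa> / real M + C0 * real Q / (real M)\<^sup>2) \<le> Y ^ 3 * (2 * \<kappa> / (X / 2) + C0 * (2 * Y) / (X / 2)\<^sup>2)"
      unfolding x3 using Y0 by (intro mult_left_mono add_mono) auto
    also have "\<dots> = Y * (4 * \<kappa> + 8 * C0 * Y powr (- 1))"
      unfolding XY using Y0 by (simp add: powr_minus field_simps power2_eq_square power3_eq_cube)
    also have "\<dots> \<le> Y * (4 * \<kappa> + 8 * C0 * Y powr (- (\<theta> / 2)))"
      using Y pos \<theta> by (intro mult_left_mono add_left_mono powr_mono) auto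
    finally show ?thesis .
  qed
  show "X powr (1 / 2 - \<theta> / 2) * ((\<kappa> * real M powr (\<theta> / 2) + C0 * real Q powr (\<theta> / 2)) / (\<theta> / 2))
       + X powr (3 / 2) * (2 * \<kappa> / real M + C0 * real Q / (real M)\<^sup>2)
     \<le> Y * ((2 / \<theta> + 4) * \<kappa> + (4 / \<theta> + 8) * C0 * Y powr (- (\<theta> / 2)))"
    using add_mono[OF 1 2] by (simp add: algebra_simps)
qed

text \<open>P1 = P2 = 5/2 sieves by no prime and makes the ratio of logarithms 1, so (A3) contains
  the full second moment. It requires X \<ge> 5/2; smaller m are compared with m = 3, hence the
  factor 3.\<close>

lemma L2_from_sieve_hypothesis:
  fixes l :: "nat \<Rightarrow> real"
  assumes A3: "\<And>P1 P2 X :: real. 2 \<le> P1 \<Longrightarrow> P1 \<le> P2 \<Longrightarrow> P2 \<le> X \<Longrightarrow>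
     sifted_sum l P1 P2 X \<le> K * (X * (ln P1 / ln P2))"
    and K: "K \<ge> 0"
  shows "(\<Sum>n=1..m. (l n)\<^sup>2) \<le> (3 * K) * real m"
proof -
  have big: "(\<Sum>n=1..m. (l n)\<^sup>2) \<le> K * real m" if m: "m \<ge> 3" for m
  proof -
    have none: "{p. prime p \<and> 5 / 2 \<le> real p \<and> real p \<le> 5 / 2} = {}"
    proof -
      have False if "5 / 2 \<le> real p" "real p \<le> 5 / 2" for p
      proof -
        have "real (2 * p) = real 5" using that by simp
        hence "2 * p = 5" using of_nat_eq_iff by blast
        thus False by presburger
      qed
      thus ?thesis by blast
    qed
    have "{n. 1 \<le> n \<and> real n \<le> real m \<and> coprime n (\<Prod>p | prime p \<and> 5 / 2 \<le> real p \<and> real p \<le> 5 / 2. p)} = {1..m}"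
      unfolding none by auto
    moreover have "sifted_sum l (5 / 2) (5 / 2) (real m) \<le> K * (real m * (ln (5 / 2) / ln (5 / 2)))"
      by (rule A3) (use m in auto)
    ultimately show ?thesis by simp
  qed
  consider "m = 0" | "m \<ge> 3" | "1 \<le> m" "m \<le> 3" by linarith
  thus ?thesis
  proof cases
    case 2
    have "K * real m \<le> 3 * K * real m" using K by (simp add: mult_right_mono)
    thus ?thesis using big[OF 2] by linarith
  next
    case 3
    have "(\<Sum>n=1..m. (l n)\<^sup>2) \<le> (\<Sum>n=1..3. (l n)\<^sup>2)" using 3 by (intro sum_mono2) auto
    also have "\<dots> \<le> K * 3" using big[of 3] by simp
    also have "\<dots> \<le> 3 * K * real m" using K 3 mult_left_mono[of 1 "real m" "3 * K"] by simp
    finally show ?thesis .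
  qed simp
qed

section \<open>The central value\<close>

text \<open>All requirements that q be large are gathered as inequalities in x = log q, which leaves
  an explicit constant free of q and \<chi>.\<close>

lemma large_conductor_estimate:
  fixes F :: L_datum and q k :: nat and \<beta> \<epsilon> \<eta> \<theta> x A K c1 :: real
  defines "d \<equiv> real (degree_of F)" and "x \<equiv> ln (real q)" and "C0 \<equiv> sqrt (3 * K)"
  defines "\<kappa>c \<equiv> sqrt (4 * K / d) + C0 * real k"
  assumes F: "L_framework F" and q: "q \<ge> 2" and prim: "primitive_character q chi" and deg: "degree_of F \<ge> 3"
    and A1: "\<And>n. n \<ge> 1 \<Longrightarrow> norm (coeff_of F n) \<le> real (divisor_tau (degree_of F) n)"
    and K: "K \<ge> 0"
    and A3: "\<And>P1 P2 X :: real. 2 \<le> P1 \<Longrightarrow> P1 \<le> P2 \<Longrightarrow> P2 \<le> X \<Longrightarrow>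
     sifted_sum (\<lambda>n. norm (coeff_of F n)) P1 P2 X
       \<le> K * (X * (ln P1 / ln P2))"
    and \<beta>: "0 \<le> \<beta>" and \<epsilon>: "0 < \<epsilon>" "\<beta> + 2 * \<epsilon> < 1" "\<eta> \<le> (1 - \<beta>) / 2 - \<epsilon>"
    and k: "k \<ge> 1" "\<epsilon> * real k \<ge> 4" and c1: "0 < c1" "c1 \<le> 1 / 2"
    and \<theta>: "0 < \<theta>" "\<theta> < 1 / 2" and A: "A \<ge> 0"
    and nz: "\<And>\<sigma> t. \<sigma> > 1 - c1 / (2 * x) powr \<beta> \<Longrightarrow> \<bar>t\<bar> \<le> x + 1 \<Longrightarrow> L_twist F chi (Complex \<sigma> t) \<noteq> 0"
    and growth: "\<And>z. 1 / 2 \<le> Re z \<Longrightarrow> Re z \<le> 2 \<Longrightarrow> \<bar>Im z\<bar> \<le> x + 1 \<Longrightarrow> norm (L_twist F chi z) \<le> exp ((5 * d + 1) * x)"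
    and reduce: "\<And>B. (\<And>J. admissible_kernel \<theta> A (real q powr (d / 2)) J \<Longrightarrow>
       norm (vertical_integral (3 / 2) (\<lambda>s. L_twist F chi (1 / 2 + s) * J s)) \<le> B) \<Longrightarrow>
       norm (L_twist F chi (1 / 2)) \<le> B"
    and x4: "x \<ge> 4"
    and x1: "16 * real k * 2 powr \<beta> / c1 * x powr (- \<epsilon>) \<le> 1"
    and x2: "4 * 2 powr \<beta> / c1 * x powr (\<beta> - 1) \<le> 1"
    and x3: "(16 * real k * 2 powr \<beta> / c1) ^ k * (2 * (5 * d + 1) + 2 + 12 * d) \<le> x"
    and x5: "sieve_const (degree_of F) k * (3 * fact k * 2 ^ k) \<le> x"
    and x6: "x powr (\<beta> + 2 * \<epsilon> - 1) * (4 / d) \<le> 1"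
    and x7: "fact k \<le> x" and x8: "2 / (\<theta> * d / 8)\<^sup>2 \<le> x"
  shows "norm (L_twist F chi (1 / 2)) \<le> cauchy_weight * A * ((2 / \<theta> + 4) * \<kappa>c + (4 / \<theta> + 8) * C0 + 32 * C0 * exp (d / 2))
    * (real q powr (d / 4) / ln (real q) powr \<eta>)"
proof -
  interpret twisted_L F q chi by unfold_locales fact+
  interpret E: euler_series "degree_of F" "twist_coeff F chi" "twist_satake F chi"
    by (rule twisted_euler_series) fact+
  \<comment> \<open>Smaller by x^(-\<epsilon>) than the radius of the zero-free disc: this is the
    gain per difference.\<close>
  define h where "h = x powr (- \<beta> - \<epsilon>)"
  \<comment> \<open>The 2 comes from log(qT) \<le> 2 log q for large q.\<close>
  define r where "r = c1 / (2 * x) powr \<beta>"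
  define Y where "Y = real q powr (d / 4)"
  define X where "X = real q powr (d / 2)"
  define Q where "Q = nat \<lceil>Y\<rceil>"
  define M where "M = nat \<lfloor>X\<rfloor>"
  define l where "l n = norm (coeff_of F n)" for n
  have x0: "x > 0" and xge1: "x \<ge> 1" using x4 by auto
  have d3: "d \<ge> 3" using deg by (simp add: d_def)
  have q0: "real q > 0" using q by simp
  have Yexp: "Y = exp (d * x / 4)" and Xexp: "X = exp (d * x / 2)" using q0 by (simp_all add: Y_def X_def x_def powr_def)
  have XY: "X = Y\<^sup>2" unfolding Xexp Yexp power2_eq_square by (simp flip: exp_add)
  have Y3: "Y \<ge> 3"
  proof -
    have "3 * 4 \<le> d * x" using d3 x4 by (intro mult_mono) auto
    hence "3 \<le> d * x / 4" by simp
    also have "\<dots> \<le> exp (d * x / 4)" using exp_ge_add_one_self[of "d * x / 4"] by linarith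
    finally show ?thesis by (simp add: Yexp)
  qed
  have r0: "r > 0" using c1 x0 by (simp add: r_def)
  have r1: "r \<le> 1 / 2"
  proof -
    have "r \<le> c1 / 1" unfolding r_def using c1 x4 \<beta> by (intro divide_left_mono ge_one_powr_ge_zero) auto
    thus ?thesis using c1 by simp
  qed
  have r_inv: "a / r = a * 2 powr \<beta> / c1 * x powr \<beta>" for a
    unfolding r_def using x0 c1 by (simp add: powr_mult)
  have h0: "h > 0" using x0 by (simp add: h_def)
  have hr: "16 * real k * h / r = 16 * real k * 2 powr \<beta> / c1 * x powr (- \<epsilon>)"
    unfolding r_inv h_def using x0 by (simp add: powr_diff powr_minus field_simps)
  have h_le: "h \<le> r / (16 * real k)"
    using x1 r0 k unfolding hr[symmetric] by (simp add: field_simps)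
  have xr: "1 / x \<le> r / 4"
  proof -
    have "4 / r = (4 * 2 powr \<beta> / c1 * x powr (\<beta> - 1)) * x" unfolding r_inv using x0 by (simp add: powr_diff)
    also have "\<dots> \<le> 1 * x" using x2 x0 by (intro mult_right_mono) auto
    finally show ?thesis using r0 x0 by (simp add: field_simps)
  qed
  have xek: "(x powr (- \<epsilon>)) ^ k \<le> x powr (- 4)"
  proof -
    have "(x powr (- \<epsilon>)) ^ k = x powr (- (\<epsilon> * real k))" using x0 by (simp add: powr_power mult.commute)
    also have "\<dots> \<le> x powr (- 4)" using k xge1 by (intro powr_mono) auto
    finally show ?thesis .
  qed
  have x4': "x powr (- 4) = 1 / x ^ 4" using x0 by (simp add: powr_minus field_simps)
  \<comment> \<open>Of the x^(-4) won by k differences, one x pays for the size of log L and one for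
    the constants in \<open>x3\<close>; x^(-2) remains.\<close>
  define e where "e = 1 / x\<^sup>2"
  have e1: "e \<le> 1" unfolding e_def using xge1 by simp
  have E1: "(16 * real k * h / r) ^ k * (2 * ((5 * d + 1) * x + 1) + 6 * d * (1 + 4 / r)) \<le> e"
  proof -
    have "4 / r \<le> x" using xr r0 x0 by (simp add: field_simps)
    hence "2 * ((5 * d + 1) * x + 1) + 6 * d * (1 + 4 / r) \<le> 2 * ((5 * d + 1) * x + x) + 6 * d * (x + x)"
      using d3 xge1 by (intro add_mono mult_left_mono) auto
    also have "\<dots> = (2 * (5 * d + 1) + 2 + 12 * d) * x" by (simp add: algebra_simps)
    finally have "(16 * real k * h / r) ^ k * (2 * ((5 * d + 1) * x + 1) + 6 * d * (1 + 4 / r)) \<le>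
      ((16 * real k * 2 powr \<beta> / c1) ^ k * x powr (- 4)) * ((2 * (5 * d + 1) + 2 + 12 * d) * x)"
      unfolding hr power_mult_distrib using c1 d3 r0 x0 xek by (intro mult_mono mult_left_mono) auto
    also have "\<dots> = ((16 * real k * 2 powr \<beta> / c1) ^ k * (2 * (5 * d + 1) + 2 + 12 * d)) * (x powr (- 4) * x)" by simp
    also have "\<dots> \<le> x * (x powr (- 4) * x)" using x3 x0 by (intro mult_right_mono) auto
    also have "\<dots> = e" unfolding x4' e_def using x0 by (simp add: field_simps eval_nat_numeral)
    finally show ?thesis .
  qed
  have E2: "sieve_const (degree_of F) k * (3 * fact k * (2 * h) ^ k) \<le> e"
  proof -
    have "h \<le> x powr (- \<epsilon>)" unfolding h_def using \<beta> xge1 by (intro powr_mono) auto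
    hence "h ^ k \<le> (x powr (- \<epsilon>)) ^ k" using h0 by (intro power_mono) auto
    hence hk: "h ^ k \<le> 1 / x ^ 4" using xek x4' by linarith
    have "sieve_const (degree_of F) k * (3 * fact k * (2 * h) ^ k) = (sieve_const (degree_of F) k * (3 * fact k * 2 ^ k)) * h ^ k"
      by (simp add: power_mult_distrib)
    also have "\<dots> \<le> x * (1 / x ^ 4)" using x5 hk x0 h0 by (intro mult_mono) auto
    also have "\<dots> \<le> e" unfolding e_def using xge1 by (simp add: field_simps eval_nat_numeral)
    finally show ?thesis .
  qed
  have L2: "(\<Sum>n=1..m. (l n)\<^sup>2) \<le> (3 * K) * real m" for m
    unfolding l_def by (rule L2_from_sieve_hypothesis[OF A3 K])
  have L1: "(\<Sum>n=1..m. l n) \<le> C0 * real m" for m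
    unfolding C0_def by (rule sum_le_of_L2[OF _ L2]) (simp add: l_def)
  have C0: "C0 \<ge> 0" using K by (simp add: C0_def)
  have near: "norm (dirichlet_series (twist_coeff F chi) (Complex (1 + 1 / x) t) - E.sieved_series h k (Complex (1 + 1 / x) t)) * exp (- \<bar>t\<bar>) \<le> 32 * C0 / x" for t
  proof -
    have "norm (dirichlet_series (twist_coeff F chi) (Complex (1 + 1 / x) t) - E.sieved_series h k (Complex (1 + 1 / x) t)) * exp (- \<bar>t\<bar>)
      \<le> C0 * (1 + x) * (12 * e + 2 * exp (- x))"
    proof (rule near_line_bound[OF F q prim A1 C0 L1[unfolded l_def] xge1 r0 r1])
      show "0 \<le> (5 * d + 1) * x" using d3 x0 by simp
    qed (use nz growth k h0 h_le xr E1 E2 e1 in \<open>simp_all add: r_def d_def\<close>)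
    \<comment> \<open>One of the two powers in \<open>e\<close> is spent on the Dirichlet series,
      whose size can be x. The constant is 2 (12 + 4) = 32.\<close>
    also have "\<dots> \<le> C0 * (2 * x) * (12 * e + 2 * (2 * e))"
    proof (intro mult_mono add_mono mult_left_mono)
      have "x\<^sup>2 \<le> 2 * exp x" using power_le_fact_exp[of x 2] x0 by (simp add: fact_numeral)
      thus "exp (- x) \<le> 2 * e" unfolding e_def exp_minus using x0 by (simp add: field_simps)
    qed (use C0 xge1 in \<open>auto simp: e_def\<close>)
    also have "\<dots> = 32 * C0 / x" unfolding e_def using x0 by (simp add: field_simps power2_eq_square)
    finally show ?thesis .
  qed
  \<comment> \<open>Half of 1 - \<beta> - 2 \<epsilon>: Cauchy-Schwarz takes the square root of the
    saving in (A3).\<close>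
  define \<eta>' where "\<eta>' = (1 - \<beta>) / 2 - \<epsilon>"
  have \<eta>'1: "\<eta>' \<le> 1"
  proof -
    have "1 - \<beta> \<le> 2 * (1 + \<epsilon>)" using \<epsilon>(1) \<beta> by (simp add: algebra_simps)
    hence "(1 - \<beta>) / 2 \<le> 1 + \<epsilon>" by simp
    thus ?thesis by (simp only: \<eta>'_def diff_le_eq)
  qed
  have \<eta>': "\<eta> \<le> \<eta>'" "\<eta>' \<le> 1" using \<epsilon>(3) \<eta>'1 by (simp_all add: \<eta>'_def)
  define \<kappa> where "\<kappa> = \<kappa>c * x powr (- \<eta>')"
  have \<kappa>c: "\<kappa>c \<ge> 0" using C0 K d3 by (simp add: \<kappa>c_def)
  have \<kappa>0: "\<kappa> \<ge> 0" using \<kappa>c by (simp add: \<kappa>_def)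
  note ar = kernel_bound_arith[OF Y3 XY \<theta> \<kappa>0 C0 Q_def M_def]
  have xinv: "1 / x \<le> x powr (- \<eta>')"
  proof -
    have "1 / x = x powr (- 1)" using x0 by (simp add: powr_minus field_simps)
    also have "\<dots> \<le> x powr (- \<eta>')" using xge1 \<eta>' by (intro powr_mono) auto
    finally show ?thesis .
  qed
  have small: "(\<Sum>n=1..m. l n * sieve_weight h k n) \<le> C0 * real m" for m
  proof -
    have v: "0 \<le> prime_cutoff h k p \<and> prime_cutoff h k p \<le> 1" for p using prime_cutoff_bounds[of h] h0 by auto
    have "(\<Sum>n=1..m. l n * sieve_weight h k n) \<le> (\<Sum>n=1..m. l n)"
      by (intro sum_mono mult_left_le prime_weight_bounds v) (simp add: l_def)
    thus ?thesis using L1[of m] by linarith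
  qed
  have large: "(\<Sum>n=1..m. l n * sieve_weight h k n) \<le> \<kappa> * real m" if m: "m \<ge> Q" for m
  proof -
    \<comment> \<open>Here h log P1 = x^\<epsilon>, so the weight of integers with a prime factor in
      [P1, Y] is negligible, while log P1 / log Y is still of size x^(\<beta> + 2 \<epsilon> -
      1).\<close>
    define P1 where "P1 = exp (x powr (\<beta> + 2 * \<epsilon>))"
    have P1_2: "2 \<le> P1"
    proof -
      have "1 \<le> x powr (\<beta> + 2 * \<epsilon>)" using xge1 \<beta> \<epsilon> by (intro ge_one_powr_ge_zero) auto
      thus ?thesis unfolding P1_def using exp_ge_add_one_self[of "x powr (\<beta> + 2 * \<epsilon>)"] by linarith
    qed
    have eqx: "x powr (\<beta> + 2 * \<epsilon>) = x powr (\<beta> + 2 * \<epsilon> - 1) * x" using x0 by (simp add: powr_diff)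
    have ratio: "ln P1 / ln Y = (4 / d) * x powr (\<beta> + 2 * \<epsilon> - 1)"
      unfolding P1_def Yexp eqx using x0 d3 by (simp add: field_simps)
    have "x powr (\<beta> + 2 * \<epsilon>) \<le> d * x / 4"
    proof -
      have "x powr (\<beta> + 2 * \<epsilon> - 1) \<le> d / 4" using x6 d3 by (simp add: field_simps)
      hence "x powr (\<beta> + 2 * \<epsilon> - 1) * x \<le> d / 4 * x" using x0 by (intro mult_right_mono) auto
      thus ?thesis unfolding eqx by simp
    qed
    hence P1_Y: "P1 \<le> Y" by (simp add: P1_def Yexp)
    have Ym: "Y \<le> real m" using ar(3) m by linarith
    have "(\<Sum>n=1..m. l n * sieve_weight h k n)
       \<le> (sqrt (K * (ln P1 / ln Y)) + sqrt (3 * K) * (real k * P1 powr (- h))) * real m"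
    proof (rule sum_sieved_le[OF _ _ P1_2 P1_Y Ym L2])
      show "sifted_sum l P1 Y (real m) \<le> K * (real m * (ln P1 / ln Y))"
        unfolding l_def by (rule A3[OF P1_2 P1_Y Ym])
    qed (use h0 in \<open>auto simp: l_def\<close>)
    also have "\<dots> \<le> \<kappa> * real m"
    proof (rule mult_right_mono)
      have p: "(x powr (- \<eta>'))\<^sup>2 = x powr (\<beta> + 2 * \<epsilon> - 1)"
      proof -
        have "- \<eta>' + - \<eta>' = \<beta> + 2 * \<epsilon> - 1" by (simp add: \<eta>'_def field_simps)
        thus ?thesis unfolding power2_eq_square powr_add[symmetric] by (simp only:)
      qed
      have "sqrt (K * (ln P1 / ln Y)) = sqrt (4 * K / d * (x powr (- \<eta>'))\<^sup>2)" unfolding ratio p by (simp add: mult_ac)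
      also have "\<dots> = sqrt (4 * K / d) * x powr (- \<eta>')" unfolding real_sqrt_mult by simp
      finally have s1: "sqrt (K * (ln P1 / ln Y)) = sqrt (4 * K / d) * x powr (- \<eta>')" .
      have "P1 powr (- h) = exp (- (x powr \<epsilon>))"
      proof -
        have "h * x powr (\<beta> + 2 * \<epsilon>) = x powr \<epsilon>" unfolding h_def by (simp flip: powr_add)
        thus ?thesis unfolding P1_def powr_def by simp
      qed
      also have "\<dots> \<le> 1 / x"
      proof -
        \<comment> \<open>exp(x^\<epsilon>) beats powers of x by the k-th term of its series; the
          condition on \<epsilon> k is used a second time.\<close>
        have "x ^ 4 = x powr 4" using x0 by (simp add: powr_numeral)
        also have "\<dots> \<le> x powr (\<epsilon> * real k)" using k xge1 by (intro powr_mono) auto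
        also have "\<dots> = (x powr \<epsilon>) ^ k" using x0 by (simp add: powr_power mult.commute)
        also have "\<dots> \<le> fact k * exp (x powr \<epsilon>)" by (intro power_le_fact_exp) simp
        also have "\<dots> \<le> x * exp (x powr \<epsilon>)" using x7 by (intro mult_right_mono) auto
        finally have "x ^ 3 \<le> exp (x powr \<epsilon>)" using x0 by (simp add: eval_nat_numeral)
        moreover have "x \<le> x ^ 3" using xge1 by (simp add: self_le_power)
        ultimately have "x \<le> exp (x powr \<epsilon>)" by linarith
        thus ?thesis using x0 by (simp add: exp_minus field_simps)
      qed
      finally have "P1 powr (- h) \<le> x powr (- \<eta>')" using xinv by linarith
      hence "sqrt (3 * K) * (real k * P1 powr (- h)) \<le> C0 * (real k * x powr (- \<eta>'))"
        unfolding C0_def using K by (intro mult_left_mono) auto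
      thus "sqrt (K * (ln P1 / ln Y)) + sqrt (3 * K) * (real k * P1 powr (- h)) \<le> \<kappa>"
        unfolding s1 \<kappa>_def \<kappa>c_def by (simp add: algebra_simps)
    qed simp
    finally show ?thesis .
  qed
  have Ypow: "Y powr (- (\<theta> / 2)) \<le> 1 / x"
  proof -
    define a where "a = \<theta> * d / 8"
    have a: "a > 0" using \<theta> d3 by (simp add: a_def)
    have "(a * x)\<^sup>2 \<le> 2 * exp (a * x)" using power_le_fact_exp[of "a * x" 2] a x0 by (simp add: fact_numeral)
    hence "a\<^sup>2 * x * x \<le> 2 * exp (a * x)" by (simp add: power2_eq_square mult_ac)
    moreover have "2 \<le> a\<^sup>2 * x" using x8 a unfolding a_def[symmetric] by (simp add: field_simps)
    hence "2 * x \<le> a\<^sup>2 * x * x" using x0 by (intro mult_right_mono) auto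
    ultimately have "x \<le> exp (a * x)" by linarith
    hence "exp (- (a * x)) \<le> 1 / x" using x0 by (simp add: exp_minus field_simps)
    moreover have "Y powr (- (\<theta> / 2)) = exp (- (a * x))" unfolding Yexp powr_def by (simp add: a_def)
    ultimately show ?thesis by simp
  qed
  have Xd: "X powr (1 / 2 + 1 / x) = Y * exp (d / 2)"
    unfolding Xexp Yexp powr_def using x0 by (simp add: field_simps flip: exp_add)
  define B where "B = cauchy_weight * A * ((2 / \<theta> + 4) * \<kappa>c + (4 / \<theta> + 8) * C0 + 32 * C0 * exp (d / 2)) * (Y / x powr \<eta>)"
  have tc: "norm (twist_coeff F chi n) \<le> l n" for n
    unfolding twist_coeff_def norm_mult l_def using norm_dirichlet_character_le[OF character] by (simp add: mult_left_le)
  have "norm (L_twist F chi (1 / 2)) \<le> B"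
  proof (rule reduce)
    fix J assume J: "admissible_kernel \<theta> A (real q powr (d / 2)) J"
    hence Jh: "J holomorphic_on {s. Re s > 1 / 2 - \<theta>}"
      and Jb: "\<And>s. 1 / 2 - \<theta> / 2 \<le> Re s \<Longrightarrow> Re s \<le> 3 / 2 \<Longrightarrow> norm (J s) \<le> A * X powr (Re s) * exp (- \<bar>Im s\<bar>) / (1 + (Im s)\<^sup>2)"
      unfolding admissible_kernel_def X_def by blast+
    \<comment> \<open>On this line the argument has real part 2, where L is its series.\<close>
    have veq: "vertical_integral (3 / 2) (\<lambda>s. L_twist F chi (1 / 2 + s) * J s) = vertical_integral (3 / 2) (\<lambda>s. dirichlet_series (twist_coeff F chi) (1 / 2 + s) * J s)"
      unfolding vertical_integral_def by (simp add: L_series)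
    define T1 where "T1 = cauchy_weight * A *
      (X powr (1 / 2 - \<theta> / 2) * ((\<kappa> * real M powr (1 / 2 - (1 / 2 - \<theta> / 2)) + C0 * real Q powr (1 / 2 - (1 / 2 - \<theta> / 2))) / (1 / 2 - (1 / 2 - \<theta> / 2)))
       + X powr (3 / 2) * (2 * \<kappa> / real M + C0 * real Q / (real M)\<^sup>2)
       + X powr (1 / 2 + 1 / x) * (32 * C0 / x))"
    define T2 where "T2 = cauchy_weight * A * (Y * ((2 / \<theta> + 4) * \<kappa> + (4 / \<theta> + 8) * C0 * Y powr (- (\<theta> / 2))) + Y * exp (d / 2) * (32 * C0 / x))"
    have step1: "norm (vertical_integral (3 / 2) (\<lambda>s. dirichlet_series (twist_coeff F chi) (1 / 2 + s) * J s)) \<le> T1"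
      unfolding T1_def
    proof (rule E.kernel_integral_bound[where l = l and h = h and k = k and ?\<sigma>0.0 = "1 / 2 - \<theta>"])
      show "X \<ge> 1" using Y3 unfolding XY by (simp add: one_le_power)
    qed (use \<theta> Jh Jb A h0 tc small large C0 \<kappa>0 ar(1,2) x0 xge1 near in \<open>auto simp: X_def\<close>)
    have step2: "T1 \<le> T2"
    proof -
      have e: "1 / 2 - (1 / 2 - \<theta> / 2) = \<theta> / 2" by simp
      show ?thesis
        unfolding T1_def T2_def e Xd by (rule mult_left_mono[OF add_mono[OF ar(4) order_refl]]) (use A cauchy_weight_nonneg in simp)
    qed
    have step3: "T2 \<le> B"
    proof -
      have xe: "x powr (- \<eta>') \<le> x powr (- \<eta>)" using \<eta>' xge1 by (intro powr_mono) auto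
      have 1: "(2 / \<theta> + 4) * \<kappa> \<le> (2 / \<theta> + 4) * (\<kappa>c * x powr (- \<eta>))"
        unfolding \<kappa>_def using xe \<kappa>c \<theta> by (intro mult_left_mono) auto
      have 2: "(4 / \<theta> + 8) * C0 * Y powr (- (\<theta> / 2)) \<le> (4 / \<theta> + 8) * C0 * x powr (- \<eta>)"
        using Ypow xinv xe C0 \<theta> by (intro mult_left_mono) auto
      have "32 * C0 * (1 / x) \<le> 32 * C0 * x powr (- \<eta>)" using xinv xe C0 by (intro mult_left_mono) auto
      hence 3: "exp (d / 2) * (32 * C0 / x) \<le> exp (d / 2) * (32 * C0 * x powr (- \<eta>))" by (intro mult_left_mono) auto
      have "Y * ((2 / \<theta> + 4) * \<kappa> + (4 / \<theta> + 8) * C0 * Y powr (- (\<theta> / 2))) + Y * exp (d / 2) * (32 * C0 / x)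
        = Y * (((2 / \<theta> + 4) * \<kappa> + (4 / \<theta> + 8) * C0 * Y powr (- (\<theta> / 2))) + exp (d / 2) * (32 * C0 / x))" by (simp add: algebra_simps)
      also have "\<dots> \<le> Y * (((2 / \<theta> + 4) * (\<kappa>c * x powr (- \<eta>)) + (4 / \<theta> + 8) * C0 * x powr (- \<eta>)) + exp (d / 2) * (32 * C0 * x powr (- \<eta>)))"
        by (rule mult_left_mono[OF add_mono[OF add_mono[OF 1 2] 3]]) (use Y3 in simp)
      also have "\<dots> = ((2 / \<theta> + 4) * \<kappa>c + (4 / \<theta> + 8) * C0 + 32 * C0 * exp (d / 2)) * (Y / x powr \<eta>)"
      proof -
        have zeq: "Y / x powr \<eta> = Y * x powr (- \<eta>)" by (simp add: powr_minus divide_inverse)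
        have "Y' * ((p * (k' * z) + r' * c * z) + E * (32 * c * z)) = (p * k' + r' * c + 32 * c * E) * (Y' * z)" for Y' p k' z r' c E :: real
          by (simp add: algebra_simps)
        thus ?thesis unfolding zeq .
      qed
      finally have fin: "Y * ((2 / \<theta> + 4) * \<kappa> + (4 / \<theta> + 8) * C0 * Y powr (- (\<theta> / 2))) + Y * exp (d / 2) * (32 * C0 / x)
        \<le> ((2 / \<theta> + 4) * \<kappa>c + (4 / \<theta> + 8) * C0 + 32 * C0 * exp (d / 2)) * (Y / x powr \<eta>)" .
      have "cauchy_weight * A \<ge> 0" using A cauchy_weight_nonneg by simp
      from mult_left_mono[OF fin this] show ?thesis unfolding T2_def B_def by (simp only: mult.assoc)
    qed
    show "norm (vertical_integral (3 / 2) (\<lambda>s. L_twist F chi (1 / 2 + s) * J s)) \<le> B"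
      unfolding veq by (rule order_trans[OF step1 order_trans[OF step2 step3]])
  qed
  thus ?thesis unfolding B_def Y_def x_def .
qed

text \<open>\<open>Bs\<close> holds the constants that log q has to exceed. Finiteness sits inside
  the claim, which is therefore valid for every set.\<close>

lemma eventually_parameters:
  fixes \<epsilon> \<beta> :: real
  assumes "0 < \<epsilon>" "\<beta> + 2 * \<epsilon> < 1"
  shows "\<forall>\<^sub>F q in sequentially. (\<forall>b\<in>Bs. finite Bs \<longrightarrow> b \<le> ln (real q))
    \<and> a1 * ln (real q) powr (- \<epsilon>) \<le> 1 \<and> a2 * ln (real q) powr (\<beta> - 1) \<le> 1 \<and> ln (real q) powr (\<beta> + 2 * \<epsilon> - 1) * a3 \<le> 1"
proof -
  have lim: "filterlim (\<lambda>q. ln (real q)) at_top sequentially"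
    by (rule filterlim_compose[OF ln_at_top filterlim_real_sequentially])
  have p: "\<forall>\<^sub>F q in sequentially. a * ln (real q) powr s \<le> 1" if "s < 0" for a s :: real
  proof -
    have "(\<lambda>q. a * ln (real q) powr s) \<longlonglongrightarrow> a * 0"
      by (intro tendsto_mult tendsto_const tendsto_neg_powr that lim)
    hence "\<forall>\<^sub>F q in sequentially. a * ln (real q) powr s < 1" by (rule order_tendstoD) simp
    thus ?thesis by eventually_elim simp
  qed
  have b: "\<forall>\<^sub>F q in sequentially. \<forall>b\<in>Bs. finite Bs \<longrightarrow> b \<le> ln (real q)"
  proof (cases "finite Bs")
    case True
    have "\<forall>\<^sub>F q in sequentially. b \<le> ln (real q)" for b
      using lim by (auto simp: filterlim_at_top)
    thus ?thesis using True by (simp add: eventually_ball_finite)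
  qed simp
  have s: "- \<epsilon> < 0" "\<beta> - 1 < 0" "\<beta> + 2 * \<epsilon> - 1 < 0" using assms by auto
  show ?thesis
    using b p[OF s(1), of a1] p[OF s(2), of a2] p[OF s(3), of a3]
    by eventually_elim (simp add: mult.commute)
qed

theorem corollary1p3:
  fixes F :: L_datum and \<beta> \<eta> :: real
  assumes degree: "degree_of F \<ge> 3"
    and framework: "L_framework F"
    and beta: "0 \<le> \<beta>" "\<beta> < 1"
    and A1: "\<And>n. n \<ge> 1 \<Longrightarrow> norm (coeff_of F n) \<le> real (divisor_tau (degree_of F) n)"
    and A2: "\<exists>\<epsilon>>0. \<exists>K X0. \<forall>X Y :: real. X \<ge> 2 \<and> X \<ge> X0 \<and> X powr (1 - \<epsilon>) \<le> Y \<and> Y \<le> X \<longrightarrow>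
               (\<Sum>n | X \<le> real n \<and> real n \<le> X + Y. (norm (coeff_of F n))\<^sup>2) \<le> K * Y"
    and A3: "\<exists>K. \<forall>P1 P2 X :: real. 2 \<le> P1 \<and> P1 \<le> P2 \<and> P2 \<le> X \<longrightarrow>
               (\<Sum>n | 1 \<le> n \<and> real n \<le> X \<and>
                      coprime n (\<Prod>p | prime p \<and> P1 \<le> real p \<and> real p \<le> P2. p).
                  (norm (coeff_of F n))\<^sup>2) \<le> K * (X * (ln P1 / ln P2))"
    and A4: "\<exists>c>0. \<forall>T :: nat \<Rightarrow> real.
               (\<forall>q. T q > 0) \<and>
               T \<in> \<Omega>(\<lambda>q. ln (real q) ^ 100) \<and>
               (\<lambda>q. ln (T q)) \<in> o(\<lambda>q. ln (real q)) \<longrightarrow>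
               (\<forall>\<^sub>F q in sequentially. \<forall>chi. primitive_character q chi \<longrightarrow>
                  (\<forall>\<sigma> t. \<sigma> > 1 - c / ln (real q * T q) powr \<beta> \<and> \<bar>t\<bar> \<le> T q \<longrightarrow>
                     L_twist F chi (Complex \<sigma> t) \<noteq> 0))"
    and eta: "\<eta> < (1 - \<beta>) / 2"
  shows "\<exists>K. \<forall>q\<ge>2. \<forall>chi. primitive_character q chi \<longrightarrow>
           norm (L_twist F chi (1 / 2)) \<le>
             K * (real q powr (real (degree_of F) / 4) / ln (real q) powr \<eta>)"
proof -
  define d where "d = real (degree_of F)"
  have d3: "d \<ge> 3" using degree by (simp add: d_def)
  obtain K0 where K0: "\<And>P1 P2 X :: real. 2 \<le> P1 \<Longrightarrow> P1 \<le> P2 \<Longrightarrow> P2 \<le> X \<Longrightarrow>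
     sifted_sum (\<lambda>n. norm (coeff_of F n)) P1 P2 X
       \<le> K0 * (X * (ln P1 / ln P2))"
    using A3 by blast
  \<comment> \<open>The constant of (A3) comes without a sign; its absolute value also works because
    the ratio of logarithms is nonnegative.\<close>
  define K where "K = \<bar>K0\<bar>"
  have K: "K \<ge> 0" by (simp add: K_def)
  have K3: "sifted_sum (\<lambda>n. norm (coeff_of F n)) P1 P2 X
       \<le> K * (X * (ln P1 / ln P2))" if "2 \<le> P1" "P1 \<le> P2" "P2 \<le> X" for P1 P2 X :: real
  proof -
    have "K0 * (X * (ln P1 / ln P2)) \<le> K * (X * (ln P1 / ln P2))"
      using that unfolding K_def by (intro mult_right_mono mult_nonneg_nonneg divide_nonneg_nonneg) auto
    thus ?thesis using K0[OF that] by linarith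
  qed
  obtain c where c: "c > 0" and A4': "\<And>T :: nat \<Rightarrow> real. (\<And>q. T q > 0) \<Longrightarrow>
               T \<in> \<Omega>(\<lambda>q. ln (real q) ^ 100) \<Longrightarrow>
               (\<lambda>q. ln (T q)) \<in> o(\<lambda>q. ln (real q)) \<Longrightarrow>
               (\<forall>\<^sub>F q in sequentially. \<forall>chi. primitive_character q chi \<longrightarrow>
                  (\<forall>\<sigma> t. \<sigma> > 1 - c / ln (real q * T q) powr \<beta> \<and> \<bar>t\<bar> \<le> T q \<longrightarrow>
                     L_twist F chi (Complex \<sigma> t) \<noteq> 0))"
    using A4 by blast
  \<comment> \<open>The cap keeps the zero-free discs inside Re s \<ge> 1/2, where the growth bound
    holds; a smaller constant only shrinks the region.\<close>
  define c1 where "c1 = min c (1 / 2)"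
  have c1: "0 < c1" "c1 \<le> 1 / 2" "c1 \<le> c" using c by (auto simp: c1_def)
  \<comment> \<open>The smallest admissible order of magnitude suffices: only \<open>|t| \<le> ln q + 1\<close> matters.\<close>
  define T :: "nat \<Rightarrow> real" where "T q = 1 + ln (real q) ^ 100" for q
  have T_pos: "T q > 0" for q
    unfolding T_def by (intro add_pos_nonneg zero_le_even_power) auto
  have zf: "\<forall>\<^sub>F q in sequentially. \<forall>chi. primitive_character q chi \<longrightarrow>
                  (\<forall>\<sigma> t. \<sigma> > 1 - c / ln (real q * T q) powr \<beta> \<and> \<bar>t\<bar> \<le> T q \<longrightarrow>
                     L_twist F chi (Complex \<sigma> t) \<noteq> 0)"
  proof (rule A4'[OF T_pos])
    show "T \<in> \<Omega>(\<lambda>q. ln (real q) ^ 100)" unfolding T_def by real_asymp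
    show "(\<lambda>q. ln (T q)) \<in> o(\<lambda>q. ln (real q))" unfolding T_def by real_asymp
  qed
  have lnT: "\<forall>\<^sub>F q in sequentially. ln (real q * T q) \<le> 2 * ln (real q)" unfolding T_def by real_asymp
  have T_ge: "\<forall>\<^sub>F q in sequentially. ln (real q) + 1 \<le> T q" unfolding T_def by real_asymp
  \<comment> \<open>The first entry gives \<beta> + 2 \<epsilon> < 1, the second spends at most the
    gap between \<eta> and (1 - \<beta>)/2.\<close>
  define \<epsilon> where "\<epsilon> = min ((1 - \<beta>) / 4) ((1 - \<beta>) / 2 - \<eta>)"
  have \<epsilon>1: "0 < \<epsilon>" using beta eta by (simp add: \<epsilon>_def)
  have \<epsilon>2: "\<epsilon> \<le> (1 - \<beta>) / 4" "\<epsilon> \<le> (1 - \<beta>) / 2 - \<eta>"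
    unfolding \<epsilon>_def by (rule min.cobounded1, rule min.cobounded2)
  have \<epsilon>: "0 < \<epsilon>" "\<beta> + 2 * \<epsilon> < 1" "\<eta> \<le> (1 - \<beta>) / 2 - \<epsilon>"
    using \<epsilon>1 \<epsilon>2 beta by (auto simp: field_simps)
  define k where "k = nat \<lceil>4 / \<epsilon>\<rceil> + 1"
  have k: "k \<ge> 1" "\<epsilon> * real k \<ge> 4"
  proof -
    have "real k \<ge> 4 / \<epsilon>" unfolding k_def by linarith
    thus "\<epsilon> * real k \<ge> 4" using \<epsilon>(1) by (simp add: field_simps)
  qed (simp add: k_def)
  obtain CG where CG: "CG \<ge> 0" "\<And>q chi z. q \<ge> 2 \<Longrightarrow> primitive_character q chi \<Longrightarrow> 1 / 2 \<le> Re z \<Longrightarrow> Re z \<le> 2 \<Longrightarrow>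
    norm (L_twist F chi z) \<le> CG * real (conductor F q) ^ 3 * exp (2 * d * \<bar>Im z\<bar>)"
    using L_growth_uniform[OF framework] unfolding d_def by blast
  obtain Kc0 where Kc0: "\<forall>\<^sub>F q in sequentially. \<forall>chi. primitive_character q chi \<longrightarrow> real (conductor F q) \<le> Kc0 * real q ^ degree_of F"
    using framework unfolding L_framework_def by blast
  define Kc where "Kc = max 1 Kc0"
  have Kc1: "Kc \<ge> 1" by (simp add: Kc_def)
  obtain \<theta> A where \<theta>: "0 < \<theta>" "\<theta> < 1 / 2" and A: "A \<ge> 0"
    and red: "\<And>q chi X B. 2 \<le> q \<Longrightarrow> primitive_character q chi \<Longrightarrow> 1 \<le> X \<Longrightarrow>
     real (conductor F q) \<le> Kc * X\<^sup>2 \<Longrightarrow>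
     (\<And>J. admissible_kernel \<theta> A X J \<Longrightarrow>
       norm (vertical_integral (3 / 2) (\<lambda>s. L_twist F chi (1 / 2 + s) * J s)) \<le> B) \<Longrightarrow>
     norm (L_twist F chi (1 / 2)) \<le> B"
  proof -
    obtain \<theta> where \<theta>: "0 < \<theta>" "\<theta> < 1 / 2" and all: "\<forall>K0\<ge>1. \<exists>A\<ge>0. \<forall>q\<ge>2. \<forall>chi. primitive_character q chi \<longrightarrow> (\<forall>X\<ge>1. \<forall>B.
     real (conductor F q) \<le> K0 * X\<^sup>2 \<longrightarrow>
     (\<forall>K. admissible_kernel \<theta> A X K \<longrightarrow> norm (vertical_integral (3 / 2) (\<lambda>s. L_twist F chi (1 / 2 + s) * K s)) \<le> B) \<longrightarrow>
     norm (L_twist F chi (1 / 2)) \<le> B)"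
      using central_value_bound[OF framework] by blast
    from all[rule_format, OF Kc1] show ?thesis using that[OF \<theta>] by auto
  qed
  define C0 where "C0 = sqrt (3 * K)"
  define Cf where "Cf = cauchy_weight * A * ((2 / \<theta> + 4) * (sqrt (4 * K / d) + C0 * real k) + (4 / \<theta> + 8) * C0 + 32 * C0 * exp (d / 2))"
  \<comment> \<open>The last entry makes the constant of the growth bound at most x, so that it
    disappears into exp(x).\<close>
  define Bs where "Bs = {4, (16 * real k * 2 powr \<beta> / c1) ^ k * (2 * (5 * d + 1) + 2 + 12 * d),
     sieve_const (degree_of F) k * (3 * fact k * 2 ^ k), fact k, 2 / (\<theta> * d / 8)\<^sup>2, CG * Kc ^ 3 * exp (2 * d)}"
  have finite_Bs: "finite Bs" by (simp add: Bs_def)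
  have large: "\<forall>\<^sub>F q in sequentially. \<forall>chi. primitive_character q chi \<longrightarrow>
    norm (L_twist F chi (1 / 2)) \<le> Cf * (real q powr (d / 4) / ln (real q) powr \<eta>)"
    using zf lnT T_ge Kc0 eventually_parameters[OF \<epsilon>(1,2), of Bs "16 * real k * 2 powr \<beta> / c1" "4 * 2 powr \<beta> / c1" "4 / d"] eventually_ge_at_top[of 2]
  proof eventually_elim
    case (elim q)
    define x where "x = ln (real q)"
    have xb: "\<And>b. b \<in> Bs \<Longrightarrow> b \<le> x" using elim(5) finite_Bs unfolding x_def by blast
    have x4: "x \<ge> 4" by (rule xb) (simp add: Bs_def)
    have q2: "q \<ge> 2" using elim by simp
    show ?case
    proof (intro allI impI)
      fix chi assume prim: "primitive_character q chi"
      have N: "real (conductor F q) \<le> Kc * real q ^ degree_of F"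
      proof -
        have "Kc0 * real q ^ degree_of F \<le> Kc * real q ^ degree_of F" unfolding Kc_def by (intro mult_right_mono) auto
        thus ?thesis using elim(4) prim by fastforce
      qed
      have qd: "real q ^ degree_of F = exp (d * x)"
        using q2 by (simp add: d_def x_def exp_of_nat_mult)
      show "norm (L_twist F chi (1 / 2)) \<le> Cf * (real q powr (d / 4) / ln (real q) powr \<eta>)"
        unfolding Cf_def C0_def d_def
      proof (rule large_conductor_estimate[OF framework q2 prim degree A1 K K3 beta(1) \<epsilon> k c1(1,2) \<theta> A])
        fix \<sigma> t assume s: "1 - c1 / (2 * ln (real q)) powr \<beta> < \<sigma>" and t: "\<bar>t\<bar> \<le> ln (real q) + 1"
        have Tq1: "T q \<ge> 1" using elim(3) x4 unfolding x_def by linarith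
        have pos: "ln (real q * T q) > 0"
          using q2 Tq1 mult_mono[of 2 "real q" 1 "T q"] by (intro ln_gt_zero) auto
        have "ln (real q * T q) powr \<beta> \<le> (2 * ln (real q)) powr \<beta>" using elim(2) pos beta by (intro powr_mono2) auto
        hence "c1 / (2 * ln (real q)) powr \<beta> \<le> c / ln (real q * T q) powr \<beta>"
          using c1 c pos by (intro frac_le) auto
        hence "1 - c / ln (real q * T q) powr \<beta> < \<sigma>" using s by linarith
        moreover have "\<bar>t\<bar> \<le> T q" using t elim(3) by linarith
        ultimately show "L_twist F chi (Complex \<sigma> t) \<noteq> 0" using elim(1) prim by blast
      next
        fix z :: complex assume z: "1 / 2 \<le> Re z" "Re z \<le> 2" "\<bar>Im z\<bar> \<le> ln (real q) + 1"
        have "norm (L_twist F chi z) \<le> CG * real (conductor F q) ^ 3 * exp (2 * d * \<bar>Im z\<bar>)"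
          by (rule CG(2)[OF q2 prim z(1,2)])
        \<comment> \<open>The cube of the conductor gives 3dx in the exponent and the ordinates up
          to x + 1 give 2dx; together with exp(x) this is (5d + 1)x.\<close>
        also have "\<dots> \<le> CG * (Kc * exp (d * x)) ^ 3 * exp (2 * d * (x + 1))"
          using N z(3) d3 CG(1) unfolding qd x_def by (intro mult_mono mult_left_mono power_mono) (auto intro!: mult_left_mono)
        also have "\<dots> = (CG * Kc ^ 3 * exp (2 * d)) * exp (5 * d * x)"
          by (simp add: power_mult_distrib algebra_simps flip: exp_add exp_of_nat_mult)
        also have "\<dots> \<le> exp x * exp (5 * d * x)"
        proof (rule mult_right_mono)
          have "CG * Kc ^ 3 * exp (2 * d) \<le> x" by (rule xb) (simp add: Bs_def)
          also have "\<dots> \<le> exp x" using exp_ge_add_one_self[of x] by linarith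
          finally show "CG * Kc ^ 3 * exp (2 * d) \<le> exp x" .
        qed simp
        also have "\<dots> = exp ((5 * real (degree_of F) + 1) * ln (real q))"
          by (simp add: x_def d_def algebra_simps flip: exp_add)
        finally show "norm (L_twist F chi z) \<le> exp ((5 * real (degree_of F) + 1) * ln (real q))" .
      next
        fix B :: real
        assume hyp: "\<And>J. admissible_kernel \<theta> A (real q powr (real (degree_of F) / 2)) J \<Longrightarrow>
          norm (vertical_integral (3 / 2) (\<lambda>s. L_twist F chi (1 / 2 + s) * J s)) \<le> B"
        show "norm (L_twist F chi (1 / 2)) \<le> B"
        proof (rule red[OF q2 prim _ _ hyp])
          show "1 \<le> real q powr (real (degree_of F) / 2)" using q2 by (intro ge_one_powr_ge_zero) auto
          have "(real q powr (real (degree_of F) / 2))\<^sup>2 = real q ^ degree_of F"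
            using q2 by (simp add: power2_eq_square powr_realpow flip: powr_add)
          thus "real (conductor F q) \<le> Kc * (real q powr (real (degree_of F) / 2))\<^sup>2" using N by simp
        qed
      qed (use elim(5) xb in \<open>auto simp: Bs_def x_def d_def\<close>)
    qed
  qed
  then obtain q0 where q0: "\<And>q chi. q \<ge> q0 \<Longrightarrow> primitive_character q chi \<Longrightarrow>
    norm (L_twist F chi (1 / 2)) \<le> Cf * (real q powr (d / 4) / ln (real q) powr \<eta>)"
    unfolding eventually_sequentially by blast
  define R where "R q = real q powr (d / 4) / ln (real q) powr \<eta>" for q
  have R: "R q > 0" if "q \<ge> 2" for q using that by (simp add: R_def)
  \<comment> \<open>The moduli below \<open>q0\<close> are finite in number, and
    \<open>L_growth_uniform\<close> bounds L for each of them uniformly in \<chi>; the sum of the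
    ratios to the target is one common constant.\<close>
  define S where "S = (\<Sum>q\<in>{2..<q0}. CG * real (conductor F q) ^ 3 / R q)"
  have S_term: "CG * real (conductor F q) ^ 3 / R q \<ge> 0" if "q \<ge> 2" for q
    using CG(1) R[OF that] by simp
  have S0: "S \<ge> 0" unfolding S_def by (intro sum_nonneg S_term) auto
  show ?thesis
  proof (intro exI[of _ "\<bar>Cf\<bar> + S"] allI impI)
    fix q chi assume q: "(2::nat) \<le> q" and prim: "primitive_character q chi"
    have "norm (L_twist F chi (1 / 2)) \<le> (\<bar>Cf\<bar> + S) * R q"
    proof (cases "q \<ge> q0")
      case True
      have "norm (L_twist F chi (1 / 2)) \<le> Cf * R q" unfolding R_def by (rule q0[OF True prim])
      also have "\<dots> \<le> (\<bar>Cf\<bar> + S) * R q" using S0 R[OF q] by (intro mult_right_mono) auto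
      finally show ?thesis .
    next
      case False
      have "norm (L_twist F chi (1 / 2)) \<le> CG * real (conductor F q) ^ 3"
        using CG(2)[OF q prim, of "1 / 2"] by simp
      also have "\<dots> = CG * real (conductor F q) ^ 3 / R q * R q" using R[OF q] by simp
      also have "\<dots> \<le> (\<bar>Cf\<bar> + S) * R q"
      proof (rule mult_right_mono)
        have "CG * real (conductor F q) ^ 3 / R q \<le> S"
          unfolding S_def by (rule member_le_sum) (use False q S_term in auto)
        thus "CG * real (conductor F q) ^ 3 / R q \<le> \<bar>Cf\<bar> + S" by linarith
      qed (use R[OF q] in simp)
      finally show ?thesis .
    qed
    thus "norm (L_twist F chi (1 / 2)) \<le> (\<bar>Cf\<bar> + S) * (real q powr (real (degree_of F) / 4) / ln (real q) powr \<eta>)"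
      by (simp add: R_def d_def)
  qed
qed

end
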